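(* Let $k$ be a field, $d,e$ positive integers, $P(X,Z)\in k[X,Z]$ monic in $Z$ with $r:=\deg_Z P(X,Z)$, and $Q(X,Y,Z)\in k[X,Y,Z]$ monic in $Y$ with $s:=\deg_Y Q(X,Y,Z)$. Let $$B=\frac{k[X,Y,Z,T]}{(X^{d}Y-P(X,Z),\;X^{e}T-Q(X,Y,Z))}$$ and let $x$ denote the image of $X$ in $B$. Suppose that one of the following holds: (1) $r\ge 2$ and $s\ge 2$; or (2) $r\ge 2$ and $s=1$; or (3) $r=1$, $s\ge 2$ and $e\ge 2$. Then $\operatorname{ML}(B)=k[x]$.
   Context: Let $A$ be a $k$-algebra. An exponential map on $A$ is a $k$-algebra homomorphism $\phi=\phi_U: A\to A[U]$ ($U$ an indeterminate over $A$) such that (i) $\varepsilon_0\phi_U=\mathrm{id}_A$, where $\varepsilon_0:A[U]\to A$ is evaluation at $U=0$; and (ii) $\phi_V\phi_U=\phi_{V+U}$, where $\phi_V:A\to A[V]$ (the same map with $V$ in place of $U$) is extended to $\phi_V:A[U]\to A[V,U]$ by $\phi_V(U)=U$. Its ring of invariants is $A^{\phi}=\{a\in A\mid \phi(a)=a\}$. For an affine domain $A$ over $k$, $\operatorname{ML}(A)=\bigcap_{\phi}A^{\phi}$, the intersection over all exponential maps $\phi$ on $A$ (Makar-Limanov invariant). The ring $B$ is an integral domain. *)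

theory Defs
  imports "HOL-Algebra.Algebra" "HOL-Algebra.Algebraic_Closure_Type"
begin

section \<open>Exponential maps and the Makar-Limanov invariant\<close>

text \<open>
  A commutative \<open>k\<close>-algebra is given by a commutative ring \<open>A\<close> and the image \<open>K\<close> of
  \<open>k\<close> in \<open>A\<close>. The rings \<open>A[U]\<close> and \<open>A[V,U] = A[V][U]\<close> are \<^term>\<open>UP A\<close> and
  \<^term>\<open>UP (UP A)\<close>; thus \<open>U\<close> is the outer and \<open>V\<close> the inner variable of
  \<^term>\<open>UP (UP A)\<close>.
\<close>

definition alg_hom_UP :: "'a set \<Rightarrow> ('a, 'm) ring_scheme \<Rightarrow> ('a \<Rightarrow> nat \<Rightarrow> 'a) \<Rightarrow> bool" where
  "alg_hom_UP K A \<phi> \<longleftrightarrow>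
     \<phi> \<in> ring_hom A (UP A) \<and> (\<forall>c\<in>K. \<phi> c = up_ring.monom (UP A) c 0)"

definition var_U :: "('a, 'm) ring_scheme \<Rightarrow> nat \<Rightarrow> nat \<Rightarrow> 'a" where
  "var_U A = up_ring.monom (UP (UP A)) \<one>\<^bsub>UP A\<^esub> 1"

definition var_V :: "('a, 'm) ring_scheme \<Rightarrow> nat \<Rightarrow> nat \<Rightarrow> 'a" where
  "var_V A = up_ring.monom (UP (UP A)) (up_ring.monom (UP A) \<one>\<^bsub>A\<^esub> 1) 0"

text \<open>The extension \<open>A[U] \<rightarrow> A[V,U]\<close> of \<open>\<phi>\<^sub>V : A \<rightarrow> A[V]\<close> that sends \<open>U\<close> to \<open>U\<close>.\<close>

definition extend_V ::
    "('a, 'm) ring_scheme \<Rightarrow> ('a \<Rightarrow> nat \<Rightarrow> 'a) \<Rightarrow> (nat \<Rightarrow> 'a) \<Rightarrow> nat \<Rightarrow> nat \<Rightarrow> 'a" where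
  "extend_V A \<phi> =
     eval A (UP (UP A)) (\<lambda>a. up_ring.monom (UP (UP A)) (\<phi> a) 0) (var_U A)"

text \<open>The substitution \<open>A[U] \<rightarrow> A[V,U]\<close>, \<open>U \<mapsto> V + U\<close>, that fixes \<open>A\<close>.\<close>

definition subst_V_plus_U ::
    "('a, 'm) ring_scheme \<Rightarrow> (nat \<Rightarrow> 'a) \<Rightarrow> nat \<Rightarrow> nat \<Rightarrow> 'a" where
  "subst_V_plus_U A =
     eval A (UP (UP A)) (\<lambda>a. up_ring.monom (UP (UP A)) (up_ring.monom (UP A) a 0) 0)
       (var_V A \<oplus>\<^bsub>UP (UP A)\<^esub> var_U A)"

definition exponential_map ::
    "'a set \<Rightarrow> ('a, 'm) ring_scheme \<Rightarrow> ('a \<Rightarrow> nat \<Rightarrow> 'a) \<Rightarrow> bool" where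
  "exponential_map K A \<phi> \<longleftrightarrow>
     alg_hom_UP K A \<phi> \<and>
     (\<forall>a\<in>carrier A. eval A A (\<lambda>c. c) \<zero>\<^bsub>A\<^esub> (\<phi> a) = a) \<and>
     (\<forall>a\<in>carrier A. extend_V A \<phi> (\<phi> a) = subst_V_plus_U A (\<phi> a))"

definition exp_invariants :: "('a, 'm) ring_scheme \<Rightarrow> ('a \<Rightarrow> nat \<Rightarrow> 'a) \<Rightarrow> 'a set" where
  "exp_invariants A \<phi> = {a \<in> carrier A. \<phi> a = up_ring.monom (UP A) a 0}"

text \<open>
  The intersection is over a nonempty family, since \<open>a \<mapsto> a\<close> (constant polynomials) is
  an exponential map.
\<close>

definition makar_limanov :: "'a set \<Rightarrow> ('a, 'm) ring_scheme \<Rightarrow> 'a set" where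
  "makar_limanov K A = (\<Inter>\<phi>\<in>{\<phi>. exponential_map K A \<phi>}. exp_invariants A \<phi>)"


section \<open>The algebra \<open>B\<close>\<close>

text \<open>
  Polynomial rings over \<open>k\<close> are iterated univariate ones, with the variables adjoined in
  the order \<open>X\<close>, \<open>Z\<close>, \<open>Y\<close>, \<open>T\<close>:
  \<open>k[X,Z] = k[X][Z]\<close>, \<open>k[X,Y,Z] = k[X][Z][Y]\<close> and \<open>k[X,Y,Z,T] = k[X][Z][Y][T]\<close>.
  So for \<open>P \<in> k[X,Z]\<close> and \<open>Q \<in> k[X,Y,Z]\<close> the degree and leading coefficient of the outermost
  variable are those in \<open>Z\<close> and in \<open>Y\<close>, respectively.
\<close>

type_synonym 'k poly_XZ = "'k poly poly"
type_synonym 'k poly_XZY = "'k poly poly poly"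
type_synonym 'k poly_XZYT = "'k poly poly poly poly"

definition const4 :: "'k::field \<Rightarrow> 'k poly_XZYT" where
  "const4 c = [:[:[:[:c:]:]:]:]"

definition var_X4 :: "'k::field poly_XZYT" where
  "var_X4 = [:[:[:[:0, 1:]:]:]:]"

definition var_Y4 :: "'k::field poly_XZYT" where
  "var_Y4 = [:[:0, 1:]:]"

definition var_T4 :: "'k::field poly_XZYT" where
  "var_T4 = [:0, 1:]"

definition ideal_B ::
    "nat \<Rightarrow> nat \<Rightarrow> 'k::field poly_XZ \<Rightarrow> 'k poly_XZY \<Rightarrow> 'k poly_XZYT set" where
  "ideal_B d e P Q =
     Idl\<^bsub>ring_of_type_algebra\<^esub>
       {var_X4 ^ d * var_Y4 - [:[:P:]:], var_X4 ^ e * var_T4 - [:Q:]}"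

definition ring_B ::
    "nat \<Rightarrow> nat \<Rightarrow> 'k::field poly_XZ \<Rightarrow> 'k poly_XZY \<Rightarrow> 'k poly_XZYT set ring" where
  "ring_B d e P Q = ring_of_type_algebra Quot ideal_B d e P Q"

definition class_B ::
    "nat \<Rightarrow> nat \<Rightarrow> 'k::field poly_XZ \<Rightarrow> 'k poly_XZY \<Rightarrow> 'k poly_XZYT \<Rightarrow> 'k poly_XZYT set" where
  "class_B d e P Q f = ideal_B d e P Q +>\<^bsub>ring_of_type_algebra\<^esub> f"

definition base_B ::
    "nat \<Rightarrow> nat \<Rightarrow> 'k::field poly_XZ \<Rightarrow> 'k poly_XZY \<Rightarrow> 'k poly_XZYT set set" where
  "base_B d e P Q = range (\<lambda>c. class_B d e P Q (const4 c))"

definition x_B ::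
    "nat \<Rightarrow> nat \<Rightarrow> 'k::field poly_XZ \<Rightarrow> 'k poly_XZY \<Rightarrow> 'k poly_XZYT set" where
  "x_B d e P Q = class_B d e P Q var_X4"

end

theory Submission
  imports Defs "HOL-Computational_Algebra.Formal_Laurent_Series"
begin

text \<open>
  Embed \<open>B\<close> into \<open>L = k[z]((x))\<close> by \<open>y = P(x,z) / x\<^sup>d\<close> and \<open>t = Q(x,y,z) / x\<^sup>e\<close>, and let \<open>v\<close> be the
  lexicographic valuation (minus the order in \<open>x\<close>, degree in \<open>z\<close> of the lowest coefficient). Up to
  terms of smaller value, \<open>z\<^sup>r\<close> is \<open>x\<^sup>d y\<close> and \<open>y\<^sup>s\<close> is \<open>x\<^sup>e t\<close>, and the monomials that are reduced
  with respect to these two rules have distinct values. Hence every \<open>b\<close> in \<open>B\<close> is a combination of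
  monomials in \<open>x, z, y, t\<close> of value at most \<open>v b\<close>.

  Let \<open>\<phi> = \<Sum> D\<^sub>i U\<^sup>i\<close> be an exponential map that moves \<open>x\<close>, and let \<open>\<rho>\<close> be the largest slope
  \<open>(v (D\<^sub>i g) - v g) / i\<close> over the generators \<open>g\<close>. The leading coefficients of those \<open>D\<^sub>i b\<close> that
  have value \<open>v b + i \<rho>\<close> form a polynomial over \<open>k\<close> whose degree \<open>dl b\<close> is additive and depends
  only on \<open>v b\<close>. If \<open>dl x > 0\<close>, then \<open>v b + dl b \<rho>\<close> is a multiple of \<open>v t\<close> for all \<open>b\<close>, and all
  degrees are multiples of the smallest positive one, attained at a generator \<open>g\<close>. So \<open>v g\<close> and
  \<open>v t\<close> span \<open>\<int>\<^sup>2\<close>; but the determinants of \<open>v t\<close> with \<open>v x, v z, v y, v t\<close> are, up to sign,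
  \<open>r s, d s + e, r e, 0\<close>, and none of these is 1. If \<open>dl x = 0\<close>, then \<open>\<rho> < 0\<close>, every invariant has
  the value of a power of \<open>x\<close>, and the top coefficient of \<open>\<phi> x\<close> must be a scalar because otherwise
  \<open>x\<close> would divide an invariant; but the value 0 of a scalar exceeds \<open>v x + n \<rho>\<close>.

  Conversely, \<open>z \<mapsto> z + x\<^sup>d\<^sup>+\<^sup>e U\<close> defines an exponential map of \<open>B\<close> with invariants \<open>k[x]\<close>.
\<close>

section \<open>Leading forms of locally finite iterative derivations\<close>

text \<open>The value group has no least element to serve as \<open>v 0\<close>, so zero is declared
  to lie below every bound.\<close>

definition below :: "('a::zero \<Rightarrow> 'g::order) \<Rightarrow> 'g \<Rightarrow> 'a \<Rightarrow> bool" where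
  "below v w a \<longleftrightarrow> a = 0 \<or> v a \<le> w"

text \<open>The component of degree \<open>w\<close> in the associated graded group: additive on
  elements below \<open>w\<close>, with zero and the elements of smaller value as kernel.\<close>

definition lead_at :: "('a::zero \<Rightarrow> 'g) \<Rightarrow> ('a \<Rightarrow> 'k::zero) \<Rightarrow> 'g \<Rightarrow> 'a \<Rightarrow> 'k" where
  "lead_at v lc w a = (if a \<noteq> 0 \<and> v a = w then lc a else 0)"

text \<open>\<open>v\<close> follows the degree convention, minus a valuation. As \<open>lc\<close>
  takes values in the field of scalars, of two elements of equal value one is a scalar multiple of
  the other up to an element of smaller value.\<close>

locale leading_form =
  fixes v :: "'a::idom \<Rightarrow> 'g::linordered_idom" and lc :: "'a \<Rightarrow> 'k::field"
    and \<kappa> :: "'k \<Rightarrow> 'a"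
  assumes v_mult: "a \<noteq> 0 \<Longrightarrow> b \<noteq> 0 \<Longrightarrow> v (a * b) = v a + v b"
    and lc_mult: "a \<noteq> 0 \<Longrightarrow> b \<noteq> 0 \<Longrightarrow> lc (a * b) = lc a * lc b"
    and lc_nonzero: "a \<noteq> 0 \<Longrightarrow> lc a \<noteq> 0"
    and below_add: "below v w a \<Longrightarrow> below v w b \<Longrightarrow> below v w (a + b)"
    and lead_add: "below v w a \<Longrightarrow> below v w b \<Longrightarrow>
          lead_at v lc w (a + b) = lead_at v lc w a + lead_at v lc w b"
    and \<kappa>_zero [simp]: "\<kappa> 0 = 0" and \<kappa>_one [simp]: "\<kappa> 1 = 1"
    and \<kappa>_add: "\<kappa> (c + c') = \<kappa> c + \<kappa> c'"
    and \<kappa>_mult: "\<kappa> (c * c') = \<kappa> c * \<kappa> c'"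
    and v_\<kappa>: "c \<noteq> 0 \<Longrightarrow> v (\<kappa> c) = 0" and lc_\<kappa>: "c \<noteq> 0 \<Longrightarrow> lc (\<kappa> c) = c"
    and \<kappa>_nonzero: "c \<noteq> 0 \<Longrightarrow> \<kappa> c \<noteq> 0"
begin

lemma below_0 [simp]: "below v w 0"
  by (simp add: below_def)

lemma below_refl [simp]: "below v (v a) a"
  by (simp add: below_def)

lemma below_mono: "below v w a \<Longrightarrow> w \<le> w' \<Longrightarrow> below v w' a"
  by (auto simp: below_def)

lemma below_mult: "below v w a \<Longrightarrow> below v w' b \<Longrightarrow> below v (w + w') (a * b)"
  by (cases "a = 0 \<or> b = 0") (auto simp: below_def v_mult add_mono)

lemma below_sum: "(\<And>i. i \<in> A \<Longrightarrow> below v w (f i)) \<Longrightarrow> below v w (\<Sum>i\<in>A. f i)"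
  by (induction A rule: infinite_finite_induct) (auto intro: below_add)

lemma lead_at_0 [simp]: "lead_at v lc w 0 = 0"
  by (simp add: lead_at_def)

lemma lead_at_self: "a \<noteq> 0 \<Longrightarrow> lead_at v lc (v a) a = lc a"
  by (simp add: lead_at_def)

lemma lead_sum: "finite A \<Longrightarrow> (\<And>i. i \<in> A \<Longrightarrow> below v w (f i)) \<Longrightarrow>
    lead_at v lc w (\<Sum>i\<in>A. f i) = (\<Sum>i\<in>A. lead_at v lc w (f i))"
  by (induction A rule: finite_induct) (auto simp: lead_add below_sum)

lemma lead_mult: "below v w a \<Longrightarrow> below v w' b \<Longrightarrow>
    lead_at v lc (w + w') (a * b) = lead_at v lc w a * lead_at v lc w' b"
  using add_le_less_mono[of "v a" w "v b" w'] add_less_le_mono[of "v a" w "v b" w']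
  by (cases "a = 0 \<or> b = 0") (auto simp: below_def lead_at_def v_mult lc_mult)

lemma lead_at_less: "below v w a \<Longrightarrow> w < w' \<Longrightarrow> lead_at v lc w' a = 0"
  by (auto simp: below_def lead_at_def)

lemma of_nat_\<kappa>: "of_nat n = \<kappa> (of_nat n)"
  by (induction n) (auto simp: \<kappa>_add)

lemma v_one: "v 1 = 0" and lc_one: "lc 1 = 1"
  using v_\<kappa>[of 1] lc_\<kappa>[of 1] by simp_all

lemma v_power: "a \<noteq> 0 \<Longrightarrow> v (a ^ n) = of_nat n * v a"
  by (induction n) (auto simp: v_mult v_one algebra_simps)

lemma \<kappa>_uminus: "\<kappa> (- c) = - \<kappa> c"
  using \<kappa>_add[of c "- c"] by (simp add: eq_neg_iff_add_eq_0 add.commute)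

lemma v_uminus: "v (- a) = v a" and lc_uminus: "lc (- a) = - lc a" if "a \<noteq> 0"
proof -
  have "\<kappa> (- 1) = - 1" by (simp add: \<kappa>_uminus)
  then show "v (- a) = v a" "lc (- a) = - lc a"
    using v_mult[of "\<kappa> (- 1)" a] lc_mult[of "\<kappa> (- 1)" a] v_\<kappa>[of "- 1"] lc_\<kappa>[of "- 1"] that
    by simp_all
qed

lemma v_diff_less:
  assumes "a \<noteq> 0" "b \<noteq> 0" "v a = v b" "lc a = lc b" "a \<noteq> b"
  shows "v (a - b) < v a"
proof -
  have "below v (v a) (a - b)"
    using below_add[OF below_refl[of a], of "- b"] assms by (simp add: below_def v_uminus)
  moreover have "lead_at v lc (v a) (a - b) = 0"
    using lead_add[OF below_refl[of a], of "- b"] assms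
    by (simp add: below_def v_uminus lead_at_def lc_uminus)
  ultimately show ?thesis using assms lc_nonzero[of "a - b"]
    by (auto simp: below_def lead_at_def split: if_splits)
qed

lemma v_add_less:
  assumes "a \<noteq> 0" "below v w b" "w < v a"
  shows "a + b \<noteq> 0" "v (a + b) = v a"
proof -
  have b: "below v (v a) b" using assms(2,3) below_mono by fastforce
  have "lead_at v lc (v a) (a + b) = lc a"
    using lead_add[OF below_refl b] lead_at_less[OF assms(2,3)] assms(1) lead_at_self by simp
  with lc_nonzero[OF assms(1)] show "a + b \<noteq> 0" "v (a + b) = v a"
    by (auto simp: lead_at_def split: if_splits)
qed

end

text \<open>\<open>D i b\<close> is the coefficient of \<open>U\<^sup>i\<close> in the image of \<open>b\<close>; the axiom \<open>D_D\<close> is condition (ii) for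
  exponential maps, read off at \<open>U\<^sup>i V\<^sup>j\<close>.\<close>

locale locally_finite_hs =
  fixes B :: "'a::idom set" and \<kappa> :: "'k::field \<Rightarrow> 'a" and D :: "nat \<Rightarrow> 'a \<Rightarrow> 'a"
  assumes B_add: "a \<in> B \<Longrightarrow> b \<in> B \<Longrightarrow> a + b \<in> B"
    and B_mult: "a \<in> B \<Longrightarrow> b \<in> B \<Longrightarrow> a * b \<in> B"
    and \<kappa>_B: "\<kappa> c \<in> B"
    and D_B: "a \<in> B \<Longrightarrow> D i a \<in> B"
    and D_0: "a \<in> B \<Longrightarrow> D 0 a = a"
    and D_add: "a \<in> B \<Longrightarrow> b \<in> B \<Longrightarrow> D i (a + b) = D i a + D i b"
    and D_mult: "a \<in> B \<Longrightarrow> b \<in> B \<Longrightarrow> D i (a * b) = (\<Sum>j\<le>i. D j a * D (i - j) b)"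
    and D_\<kappa>: "i > 0 \<Longrightarrow> D i (\<kappa> c) = 0"
    and D_D: "a \<in> B \<Longrightarrow> D j (D i a) = of_nat (binomial (i + j) i) * D (i + j) a"
    and D_finite: "a \<in> B \<Longrightarrow> \<exists>n. \<forall>i>n. D i a = 0"
begin

lemma top_coefficient:
  assumes "a \<in> B" "a \<noteq> 0"
  obtains n where "D n a \<noteq> 0" "\<And>i. i > n \<Longrightarrow> D i a = 0"
proof -
  obtain m where m: "\<forall>i>m. D i a = 0" using D_finite assms by blast
  define n where "n = (GREATEST i. D i a \<noteq> 0)"
  have bd: "\<forall>i. D i a \<noteq> 0 \<longrightarrow> i \<le> m" using m not_le by blast
  have "D n a \<noteq> 0" unfolding n_def
    by (rule GreatestI_nat[of _ 0 m]) (use assms bd D_0 in auto)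
  moreover have "D i a = 0" if "i > n" for i
  proof (rule ccontr)
    assume "D i a \<noteq> 0"
    then have "i \<le> n" unfolding n_def using bd by (intro Greatest_le_nat) auto
    then show False using that by simp
  qed
  ultimately show ?thesis using that by blast
qed

text \<open>In a domain the top coefficients of the images of \<open>a\<close> and \<open>b\<close>
  multiply to a nonzero coefficient at \<open>n + m\<close>. So degrees in \<open>U\<close> add, and
  a product of degree 0 has factors of degree 0.\<close>

lemma factorially_closed:
  assumes "a \<in> B" "b \<in> B" "a * b \<noteq> 0" "\<And>i. i > 0 \<Longrightarrow> D i (a * b) = 0" "i > 0"
  shows "D i a = 0"
proof -
  obtain n where n: "D n a \<noteq> 0" "\<And>i. i > n \<Longrightarrow> D i a = 0"
    using top_coefficient[of a] assms by auto
  obtain m where m: "D m b \<noteq> 0" "\<And>i. i > m \<Longrightarrow> D i b = 0"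
    using top_coefficient[of b] assms by auto
  have "D (n + m) (a * b) = (\<Sum>j\<le>n+m. if j = n then D n a * D m b else 0)"
    unfolding D_mult[OF assms(1,2)]
  proof (rule sum.cong)
    fix j assume "j \<in> {..n + m}"
    then consider "j > n" | "j = n" | "n + m - j > m" by fastforce
    then show "D j a * D (n + m - j) b = (if j = n then D n a * D m b else 0)"
      by cases (use n m in auto)
  qed simp
  also have "\<dots> = D n a * D m b" by simp
  finally have "n + m = 0" using n(1) m(1) assms(4)[of "n + m"] by (cases "n + m = 0") auto
  then show ?thesis using n assms(5) by simp
qed

end

section \<open>The induced map on leading forms and its degree function\<close>

locale graded_hs = leading_form v lc \<kappa> + locally_finite_hs B \<kappa> D
  for v :: "'a::idom \<Rightarrow> 'g::linordered_idom" and lc :: "'a \<Rightarrow> 'k::field" and \<kappa> B D +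
  fixes \<rho> :: 'g
  assumes below_D: "a \<in> B \<Longrightarrow> below v (v a + of_nat i * \<rho>) (D i a)"
begin

lemma D_zero: "D i 0 = 0"
  using D_add[OF \<kappa>_B[of 0] \<kappa>_B[of 0], of i] by (metis \<kappa>_zero add_0 add_cancel_right_right)

lemma below_D_of_below: "a \<in> B \<Longrightarrow> below v w a \<Longrightarrow> below v (w + of_nat i * \<rho>) (D i a)"
  using below_mono[OF below_D[of a i]] D_zero by (cases "a = 0") (simp_all add: below_def)

text \<open>If \<open>U\<close> is given the value \<open>- \<rho>\<close>, the image of
  \<open>a\<close> has value at most \<open>v a\<close> by \<open>below_D\<close>. The terms
  reaching this bound are collected, each represented by its scalar leading coefficient.\<close>

definition lead_poly :: "'a \<Rightarrow> 'k poly" where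
  "lead_poly a = Abs_poly (\<lambda>i. lead_at v lc (v a + of_nat i * \<rho>) (D i a))"

lemma coeff_lead_poly:
  assumes "a \<in> B"
  shows "coeff (lead_poly a) i = lead_at v lc (v a + of_nat i * \<rho>) (D i a)"
proof -
  obtain n where "\<forall>i>n. D i a = 0" using D_finite assms by blast
  then show ?thesis unfolding lead_poly_def by (subst coeff_Abs_poly[of n]) auto
qed

lemma lead_poly_nonzero: "a \<in> B \<Longrightarrow> a \<noteq> 0 \<Longrightarrow> lead_poly a \<noteq> 0"
  using coeff_lead_poly[of a 0] lc_nonzero by (auto simp: D_0 lead_at_self)

lemma lead_poly_mult:
  assumes "a \<in> B" "b \<in> B" "a \<noteq> 0" "b \<noteq> 0"
  shows "lead_poly (a * b) = lead_poly a * lead_poly b"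
proof (rule poly_eqI)
  fix i
  have w: "v (a * b) + of_nat i * \<rho> = (v a + of_nat j * \<rho>) + (v b + of_nat (i - j) * \<rho>)"
    if "j \<le> i" for j
    using that by (simp add: v_mult assms of_nat_diff algebra_simps)
  have "coeff (lead_poly (a * b)) i =
      lead_at v lc (v (a * b) + of_nat i * \<rho>) (\<Sum>j\<le>i. D j a * D (i - j) b)"
    using assms by (simp add: coeff_lead_poly B_mult D_mult)
  also have "\<dots> = (\<Sum>j\<le>i. lead_at v lc (v (a * b) + of_nat i * \<rho>) (D j a * D (i - j) b))"
    by (rule lead_sum) (use w assms below_mult[OF below_D below_D] in \<open>simp_all del: of_nat_diff\<close>)
  also have "\<dots> = (\<Sum>j\<le>i. coeff (lead_poly a) j * coeff (lead_poly b) (i - j))"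
    by (rule sum.cong) (use w assms lead_mult[OF below_D below_D] coeff_lead_poly
        in \<open>simp_all del: of_nat_diff\<close>)
  finally show "coeff (lead_poly (a * b)) i = coeff (lead_poly a * lead_poly b) i"
    by (simp add: coeff_mult)
qed

text \<open>The difference of \<open>a\<close> and \<open>b\<close> has smaller value, so its
  coefficients stay strictly below the bounds and leave no trace in the leading polynomial.\<close>

lemma lead_poly_cong:
  assumes "a \<in> B" "b \<in> B" "a \<noteq> 0" "b \<noteq> 0" "v a = v b" "lc a = lc b"
  shows "lead_poly a = lead_poly b"
proof (rule poly_eqI)
  fix i
  \<comment> \<open>The axioms close \<open>B\<close> under sums, products and scalars, so
    \<open>a - b\<close> is built from these.\<close>
  define c where "c = \<kappa> (- 1) * b + a"
  have c: "c \<in> B" "a = b + c" "c = a - b"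
    using assms B_add[OF B_mult[OF \<kappa>_B[of "- 1"] assms(2)] assms(1)]
    by (auto simp: c_def \<kappa>_uminus)
  have "c = 0 \<or> v c < v a" using v_diff_less assms c(3) by auto
  then have "lead_at v lc (v a + of_nat i * \<rho>) (D i c) = 0"
  proof
    assume "c = 0"
    then show ?thesis by (simp add: D_zero)
  next
    assume "v c < v a"
    then show ?thesis using lead_at_less[OF below_D[OF c(1), of i]] by simp
  qed
  moreover have "below v (v a + of_nat i * \<rho>) (D i b)"
    using below_D[OF assms(2), of i] assms by simp
  moreover have "below v (v a + of_nat i * \<rho>) (D i c)"
    by (rule below_D_of_below[OF c(1)]) (use \<open>c = 0 \<or> v c < v a\<close> in \<open>auto simp: below_def\<close>)
  moreover have "D i a = D i b + D i c" using D_add[OF assms(2) c(1)] c(2) by simp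
  ultimately show "coeff (lead_poly a) i = coeff (lead_poly b) i"
    using assms(1,2,5) by (simp add: coeff_lead_poly lead_add)
qed

definition dl :: "'a \<Rightarrow> nat" where "dl a = degree (lead_poly a)"

lemma dl_mult: "a \<in> B \<Longrightarrow> b \<in> B \<Longrightarrow> a \<noteq> 0 \<Longrightarrow> b \<noteq> 0 \<Longrightarrow> dl (a * b) = dl a + dl b"
  by (simp add: dl_def lead_poly_mult degree_mult_eq lead_poly_nonzero)

lemma dl_invariant: "a \<in> B \<Longrightarrow> (\<And>i. i > 0 \<Longrightarrow> D i a = 0) \<Longrightarrow> dl a = 0"
  unfolding dl_def using degree_le[of 0 "lead_poly a"] by (auto simp: coeff_lead_poly)

lemma dl_\<kappa>: "dl (\<kappa> c) = 0"
  by (rule dl_invariant) (auto simp: \<kappa>_B D_\<kappa>)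

lemma B_power: "a \<in> B \<Longrightarrow> a ^ n \<in> B"
  using \<kappa>_B[of 1] by (induction n) (auto simp: B_mult)

lemma dl_power: "a \<in> B \<Longrightarrow> a \<noteq> 0 \<Longrightarrow> dl (a ^ n) = n * dl a"
  using dl_\<kappa>[of 1] by (induction n) (auto simp: dl_mult B_power)

text \<open>Multiplying each element by the leading coefficient of the other makes the leading
  coefficients agree as well, and scalars have degree 0.\<close>

lemma dl_cong:
  assumes "a \<in> B" "b \<in> B" "a \<noteq> 0" "b \<noteq> 0" "v a = v b"
  shows "dl a = dl b"
proof -
  define a' b' where "a' = \<kappa> (lc b) * a" and "b' = \<kappa> (lc a) * b"
  have nz: "\<kappa> (lc a) \<noteq> 0" "\<kappa> (lc b) \<noteq> 0" using assms lc_nonzero \<kappa>_nonzero by auto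
  have "lead_poly a' = lead_poly b'"
    by (rule lead_poly_cong)
      (use assms nz in \<open>auto simp: a'_def b'_def B_mult \<kappa>_B v_mult lc_mult v_\<kappa> lc_\<kappa> lc_nonzero\<close>)
  then have "dl a' = dl b'" by (simp add: dl_def)
  then show ?thesis using assms nz by (simp add: a'_def b'_def dl_mult \<kappa>_B dl_\<kappa>)
qed

text \<open>With \<open>N = dl a\<close>, \<open>D (N - i) (D i a)\<close> is a nonzero scalar times
  \<open>D N a\<close>, which attains the slope bound; so both steps of the composition attain it.
  Beyond \<open>N - i\<close>, the derivatives of \<open>D i a\<close> are scalar multiples of
  derivatives of \<open>a\<close> beyond \<open>N\<close>, which miss the bound.\<close>

lemma hasse_degree:
  assumes "a \<in> B" "a \<noteq> 0" "i \<le> dl a" "of_nat (binomial (dl a) i) \<noteq> (0::'k)"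
  shows "D i a \<noteq> 0" "v (D i a) = v a + of_nat i * \<rho>" "dl (D i a) = dl a - i"
proof -
  let ?N = "dl a"
  have c: "coeff (lead_poly a) ?N \<noteq> 0"
    using lead_poly_nonzero[OF assms(1,2)] by (simp add: dl_def)
  then have N: "D ?N a \<noteq> 0" "v (D ?N a) = v a + of_nat ?N * \<rho>"
    by (auto simp: coeff_lead_poly assms lead_at_def split: if_splits)
  have b: "\<kappa> (of_nat (binomial ?N i)) \<noteq> 0" using assms(4) \<kappa>_nonzero by blast
  have DD: "D (?N - i) (D i a) = \<kappa> (of_nat (binomial ?N i)) * D ?N a"
    using D_D[OF assms(1), of "?N - i" i] assms(3) by (simp add: of_nat_\<kappa>)
  then have nz: "D (?N - i) (D i a) \<noteq> 0" using b N by simp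
  have iB: "D i a \<in> B" using D_B assms by blast
  show nzi: "D i a \<noteq> 0"
  proof
    assume "D i a = 0"
    with nz show False by (simp add: D_zero)
  qed
  have vDD: "v (D (?N - i) (D i a)) = v a + of_nat ?N * \<rho>"
    unfolding DD using v_mult[OF b N(1)] v_\<kappa>[OF assms(4)] N(2) by simp
  moreover have "v (D (?N - i) (D i a)) \<le> v (D i a) + of_nat (?N - i) * \<rho>"
    using below_D[OF iB, of "?N - i"] nz by (simp add: below_def)
  moreover have "v (D i a) \<le> v a + of_nat i * \<rho>"
    using below_D[OF assms(1), of i] nzi by (simp add: below_def)
  ultimately show vi: "v (D i a) = v a + of_nat i * \<rho>"
    using assms(3) by (simp add: of_nat_diff algebra_simps)
  have "coeff (lead_poly (D i a)) (?N - i) \<noteq> 0"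
    using nz vDD vi assms(3) lc_nonzero[OF nz]
    by (simp add: coeff_lead_poly iB lead_at_def of_nat_diff algebra_simps)
  then have "?N - i \<le> dl (D i a)" unfolding dl_def by (rule le_degree)
  moreover have "degree (lead_poly (D i a)) \<le> ?N - i"
  proof (rule degree_le, intro allI impI)
    fix j assume j: "?N - i < j"
    have "D j (D i a) = \<kappa> (of_nat (binomial (i + j) i)) * D (i + j) a"
      using D_D[OF assms(1), of j i] by (simp add: of_nat_\<kappa>)
    moreover have "lead_at v lc (v a + of_nat (i + j) * \<rho>) (D (i + j) a) = 0"
      using coeff_lead_poly[OF assms(1), of "i + j"] coeff_eq_0[of "lead_poly a" "i + j"] j
      by (simp add: dl_def)
    ultimately have "lead_at v lc (v a + of_nat (i + j) * \<rho>) (D j (D i a)) = 0"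
      using lead_mult[of 0 "\<kappa> (of_nat (binomial (i + j) i))"
          "v a + of_nat (i + j) * \<rho>" "D (i + j) a"] below_D[OF assms(1), of "i + j"]
      by (cases "of_nat (binomial (i + j) i) = (0::'k)")
         (auto simp: below_def v_\<kappa>)
    then show "coeff (lead_poly (D i a)) j = 0"
      using vi by (simp add: coeff_lead_poly iB algebra_simps)
  qed
  ultimately show "dl (D i a) = ?N - i" by (simp add: dl_def)
qed

end

section \<open>Monomials and reduction\<close>

text \<open>Linear polynomials over \<open>\<rat>\<close> serve as values: they form a lexicographically ordered group, with
  the coefficient of degree one dominating, in which slopes can be formed.\<close>

lemma linear_less_iff:
  fixes a b a' b' :: rat
  shows "[:a, b:] < [:a', b':] \<longleftrightarrow> b < b' \<or> b = b' \<and> a < a'"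
  by (auto simp: less_poly_def pos_poly_def)

lemma linear_le_iff:
  fixes a b a' b' :: rat
  shows "[:a, b:] \<le> [:a', b':] \<longleftrightarrow> b < b' \<or> b = b' \<and> a \<le> a'"
  by (auto simp: less_eq_poly_def pos_poly_def)

text \<open>The constant coefficient of a value stands for the degree in \<open>z\<close>, the
  dominating one for minus the order in \<open>x\<close>. The values of \<open>y\<close> and
  \<open>t\<close> are those for which \<open>x^d y\<close> has the value of \<open>z^r\<close> and
  \<open>x^e t\<close> that of \<open>y^s\<close>.\<close>

locale double_danielewski = leading_form v lc \<kappa>
  for v :: "'a::idom \<Rightarrow> rat poly" and lc :: "'a \<Rightarrow> 'k::field" and \<kappa> +
  fixes x z y t :: 'a and d e r s :: nat
  assumes nonzero [simp]: "x \<noteq> 0" "z \<noteq> 0" "y \<noteq> 0" "t \<noteq> 0"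
    and v_gen: "v x = [:0, -1:]" "v z = [:1, 0:]" "v y = [:of_nat r, of_nat d:]"
      "v t = [:of_nat (r * s), of_nat (d * s + e):]"
    and v_int: "a \<noteq> 0 \<Longrightarrow> \<exists>J \<Omega>. v a = [:of_nat J, of_int \<Omega>:]"
    and r_pos: "r \<ge> 1" and s_pos: "s \<ge> 1"
begin

definition mon :: "nat \<Rightarrow> nat \<Rightarrow> nat \<Rightarrow> nat \<Rightarrow> 'a" where
  "mon a i j l = x ^ a * z ^ i * y ^ j * t ^ l"

lemma mon_nonzero [simp]: "mon a i j l \<noteq> 0"
  by (simp add: mon_def)

lemma mon_mult: "mon a i j l * mon a' i' j' l' = mon (a + a') (i + i') (j + j') (l + l')"
  by (simp add: mon_def power_add algebra_simps)

lemma v_mon_eq: "v (mon a i j l) = of_nat a * v x + of_nat i * v z + of_nat j * v y + of_nat l * v t"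
  by (simp add: mon_def v_mult v_power)

lemma of_nat_mult_linear: "of_nat n * [:a, b:] = [:of_nat n * a, of_nat n * b:]" for a b :: rat
  by (simp add: of_nat_poly)

lemma v_mon: "v (mon a i j l) = [:of_nat (i + r * (j + s * l)),
    of_int (int (d * j + (d * s + e) * l) - int a):]"
  unfolding v_mon_eq v_gen of_nat_mult_linear by (simp add: algebra_simps)

text \<open>With \<open>u \<le> w\<close> for \<open>W u\<close> this is a filtration by monomials,
  to be compared with the filtration of \<open>B\<close> by \<open>v\<close>.\<close>

inductive_set span_of :: "(rat poly \<Rightarrow> bool) \<Rightarrow> 'a set" for W where
  zero: "0 \<in> span_of W"
| add: "b \<in> span_of W \<Longrightarrow> W (v (mon a i j l)) \<Longrightarrow> b + \<kappa> c * mon a i j l \<in> span_of W"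

lemma span_of_mono: "b \<in> span_of W \<Longrightarrow> (\<And>u. W u \<Longrightarrow> W' u) \<Longrightarrow> b \<in> span_of W'"
  by (induction rule: span_of.induct) (auto intro: span_of.intros)

lemma span_of_add: "b \<in> span_of W \<Longrightarrow> a \<in> span_of W \<Longrightarrow> a + b \<in> span_of W"
  by (induction rule: span_of.induct) (auto intro: span_of.intros simp flip: add.assoc)

lemma span_of_mon: "W (v (mon a i j l)) \<Longrightarrow> \<kappa> c * mon a i j l \<in> span_of W"
  using span_of.add[OF span_of.zero] by simp

lemma span_of_mult_mon:
  "b \<in> span_of W \<Longrightarrow> (\<And>u. W u \<Longrightarrow> W' (u + v (mon a i j l))) \<Longrightarrow> b * (\<kappa> c * mon a i j l) \<in> span_of W'"
proof (induction rule: span_of.induct)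
  case zero
  then show ?case by (simp add: span_of.zero)
next
  case (add b a' i' j' l' c')
  have "(b + \<kappa> c' * mon a' i' j' l') * (\<kappa> c * mon a i j l) =
      b * (\<kappa> c * mon a i j l) + \<kappa> (c' * c) * mon (a' + a) (i' + i) (j' + j) (l' + l)"
    by (simp add: \<kappa>_mult mon_mult[symmetric] algebra_simps)
  moreover have "W' (v (mon (a' + a) (i' + i) (j' + j) (l' + l)))"
    using add(2,4) by (simp add: v_mult mon_mult[symmetric])
  ultimately show ?case using add span_of.add by simp
qed

lemma span_of_scale: "b \<in> span_of W \<Longrightarrow> \<kappa> c * b \<in> span_of W"
  using span_of_mult_mon[of b W W 0 0 0 0 c] by (simp add: mon_def v_one mult.commute)

lemma span_of_uminus: "b \<in> span_of W \<Longrightarrow> - b \<in> span_of W"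
  using span_of_scale[of b W "- 1"] by (simp add: \<kappa>_uminus)

abbreviation B :: "'a set" where "B \<equiv> span_of (\<lambda>_. True)"

lemma B_times: "a \<in> B \<Longrightarrow> b \<in> B \<Longrightarrow> b * a \<in> B"
proof (induction rule: span_of.induct)
  case zero
  then show ?case by (simp add: span_of.zero)
next
  case (add a a' i j l c)
  then show ?case using span_of_mult_mon[of b "\<lambda>_. True" "\<lambda>_. True" a' i j l c]
    by (simp add: distrib_left span_of_add add.commute)
qed

lemma \<kappa>_in_span: "W 0 \<Longrightarrow> \<kappa> c \<in> span_of W"
  using span_of_mon[of W 0 0 0 0 c] by (simp add: mon_def v_one)

lemma gen_in_B: "x \<in> B" "z \<in> B" "y \<in> B" "t \<in> B"
  using span_of_mon[of "\<lambda>_. True" 1 0 0 0 1] span_of_mon[of "\<lambda>_. True" 0 1 0 0 1]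
    span_of_mon[of "\<lambda>_. True" 0 0 1 0 1] span_of_mon[of "\<lambda>_. True" 0 0 0 1 1]
  by (auto simp: mon_def)

lemma span_less: "b \<in> span_of (\<lambda>u. u < w) \<Longrightarrow> b = 0 \<or> v b < w"
proof (induction rule: span_of.induct)
  case (add b a i j l c)
  have "below v (max (v b) (v (mon a i j l))) (b + \<kappa> c * mon a i j l)"
    by (rule below_add) (cases "c = 0"; auto simp: below_def v_mult \<kappa>_nonzero v_\<kappa>)+
  then show ?case using add
    by (cases "b = 0"; cases "c = 0") (auto simp: below_def v_mult v_\<kappa> \<kappa>_nonzero)
qed auto

lemma span_le: "b \<in> span_of (\<lambda>u. u \<le> w) \<Longrightarrow> below v w b"
proof (induction rule: span_of.induct)
  case (add b a i j l c)
  show ?case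
    by (rule below_add) (use add in \<open>cases "c = 0"; auto simp: below_def v_mult \<kappa>_nonzero v_\<kappa>\<close>)+
qed auto

text \<open>A finite combination has a monomial of largest value. Replacing a strict bound by the
  value of a monomial, with integer entries, lets the descent in \<open>in_span_le_v\<close>
  terminate.\<close>

lemma span_less_imp_le:
  "b \<in> span_of (\<lambda>u. u < w) \<Longrightarrow> b = 0 \<or> (\<exists>a i j l. v (mon a i j l) < w \<and> b \<in> span_of (\<lambda>u. u \<le> v (mon a i j l)))"
proof (induction rule: span_of.induct)
  case (add b a i j l c)
  let ?m = "mon a i j l"
  show ?case
  proof (cases "b = 0")
    case True
    then show ?thesis using span_of_mon[of "\<lambda>u. u \<le> v ?m" a i j l c] add by auto
  next
    case False
    then obtain a' i' j' l' where *: "v (mon a' i' j' l') < w" "b \<in> span_of (\<lambda>u. u \<le> v (mon a' i' j' l'))"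
      using add by blast
    show ?thesis
    proof (cases "v ?m \<le> v (mon a' i' j' l')")
      case True
      then show ?thesis using * span_of.add[OF *(2), of a i j l c] by blast
    next
      case False
      then have "b \<in> span_of (\<lambda>u. u \<le> v ?m)" using span_of_mono[OF *(2)] by fastforce
      then show ?thesis using add span_of.add[of b "\<lambda>u. u \<le> v ?m" a i j l c] by blast
    qed
  qed
qed auto

lemma span_le_attained:
  "b \<in> span_of (\<lambda>u. u \<le> w) \<Longrightarrow> (\<exists>a i j l. v (mon a i j l) = w) \<or> b \<in> span_of (\<lambda>u. u < w)"
proof (induction rule: span_of.induct)
  case (add b a i j l c)
  then show ?case using span_of.add[of b "\<lambda>u. u < w" a i j l c] by (cases "v (mon a i j l) = w") auto
qed (auto intro: span_of.zero)

end

section \<open>Reduction to monomials with distinct values\<close>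

locale double_danielewski_relations = double_danielewski +
  assumes rel_z: "x ^ d * y - z ^ r \<in> span_of (\<lambda>u. u < v (z ^ r))"
    and rel_y: "x ^ e * t - y ^ s \<in> span_of (\<lambda>u. u < v (y ^ s))"
begin

text \<open>The exponents of \<open>y\<close> and \<open>t\<close> are encoded as remainder and
  quotient of one number by \<open>s\<close>, so that of \<open>y\<close> is below \<open>s\<close>
  by construction. Together with \<open>i < r\<close> this describes the reduced monomials.\<close>

definition nmon :: "nat \<Rightarrow> nat \<Rightarrow> nat \<Rightarrow> 'a" where
  "nmon a i q = mon a i (q mod s) (q div s)"

lemma v_nmon: "v (nmon a i q) = [:of_nat (i + r * q), of_int (int (d * q + e * (q div s)) - int a):]"
proof -
  have *: "q mod s + s * (q div s) = q" by simp
  have "d * (q mod s) + (d * s + e) * (q div s) = d * (q mod s + s * (q div s)) + e * (q div s)"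
    by (simp only: distrib_left distrib_right mult.assoc add.assoc)
  then show ?thesis unfolding nmon_def v_mon * by metis
qed

text \<open>Division with remainder by \<open>r\<close> recovers \<open>i\<close> and
  \<open>q\<close> from the first coordinate; the second one then yields \<open>a\<close>.\<close>

lemma v_nmon_inj:
  assumes "v (nmon a i q) = v (nmon a' i' q')" "i < r" "i' < r"
  shows "a = a' \<and> i = i' \<and> q = q'"
proof -
  have 1: "i + r * q = i' + r * q'"
    using assms(1) unfolding v_nmon by (metis of_nat_eq_iff pCons_eq_iff)
  have i: "i = i'" using arg_cong[OF 1, of "\<lambda>n. n mod r"] assms(2,3) by simp
  then have q: "q = q'" using 1 r_pos by simp
  have "int (d * q + e * (q div s)) - int a = int (d * q' + e * (q' div s)) - int a'"
    using assms(1) unfolding v_nmon by (metis of_int_eq_iff pCons_eq_iff)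
  then show ?thesis using i q by simp
qed

lemma v_rel_z: "v (x ^ d * y) = v (z ^ r)"
  unfolding v_mult[OF power_not_zero[OF nonzero(1)] nonzero(3)] v_power[OF nonzero(1)] v_power[OF nonzero(2)]
  unfolding v_gen of_nat_mult_linear by simp

lemma v_rel_y: "v (x ^ e * t) = v (y ^ s)"
  unfolding v_mult[OF power_not_zero[OF nonzero(1)] nonzero(4)] v_power[OF nonzero(1)] v_power[OF nonzero(3)]
  unfolding v_gen of_nat_mult_linear by (simp add: algebra_simps)

lemma normal_form:
  "\<exists>a' i' q. i' < r \<and> v (nmon a' i' q) = v (mon a i j l) \<and>
     mon a i j l - nmon a' i' q \<in> span_of (\<lambda>u. u < v (mon a i j l))"
\<comment> \<open>Trading \<open>z^r\<close> for \<open>x^d y\<close> creates a \<open>y\<close>, so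
  \<open>z\<close> gets weight 2; then both rewriting rules lower the weight.\<close>
proof (induction "2 * i + j" arbitrary: a i j l rule: less_induct)
  case less
  let ?m = "mon a i j l"
  have step: ?case
    if IH: "\<exists>a' i' q. i' < r \<and> v (nmon a' i' q) = v m' \<and> m' - nmon a' i' q \<in> span_of (\<lambda>u. u < v m')"
      and m: "?m = g * mon a1 i1 j1 l1" "m' = g' * mon a1 i1 j1 l1" "v g = v g'" "g \<noteq> 0" "g' \<noteq> 0"
        "g' - g \<in> span_of (\<lambda>u. u < v g)"
    for m' g g' a1 i1 j1 l1
  proof -
    have v: "v m' = v ?m" using m by (simp add: v_mult)
    have "(g' - g) * (\<kappa> 1 * mon a1 i1 j1 l1) \<in> span_of (\<lambda>u. u < v ?m)"
      by (rule span_of_mult_mon[OF m(6)]) (simp add: m v_mult)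
    then have "m' - ?m \<in> span_of (\<lambda>u. u < v ?m)"
      using m by (simp add: algebra_simps)
    then have d: "- (m' - ?m) \<in> span_of (\<lambda>u. u < v ?m)" by (rule span_of_uminus)
    obtain a' i' q where *: "i' < r" "v (nmon a' i' q) = v ?m" "m' - nmon a' i' q \<in> span_of (\<lambda>u. u < v ?m)"
      using IH v by auto
    have "?m - nmon a' i' q \<in> span_of (\<lambda>u. u < v ?m)"
      using span_of_add[OF d *(3)] by simp
    then show ?case using * by blast
  qed
  consider "i \<ge> r" | "i < r" "j \<ge> s" | "i < r" "j < s" by linarith
  then show ?case
  proof cases
    case 1
    have "2 * (i - r) + (j + 1) < 2 * i + j" using 1 r_pos by simp
    from less[OF this, of "a + d" l] show ?thesis
      by (rule step[of _ "z ^ r" a "i - r" j l "x ^ d * y"])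
         (use 1 v_rel_z rel_z in \<open>auto simp: mon_def power_add[symmetric] mult_ac\<close>)
  next
    case 2
    have "2 * i + (j - s) < 2 * i + j" using 2 s_pos by simp
    from less[OF this, of "a + e" "l + 1"] show ?thesis
      by (rule step[of _ "y ^ s" a i "j - s" l "x ^ e * t"])
         (use 2 v_rel_y rel_y in \<open>auto simp: mon_def power_add[symmetric] mult_ac\<close>)
  next
    case 3
    then have "(j + s * l) mod s = j" "(j + s * l) div s = l" by simp_all
    then have "nmon a i (j + s * l) = ?m" by (simp add: nmon_def)
    then show ?thesis using 3 span_of.zero by (metis diff_self)
  qed
qed

text \<open>Modulo smaller values each monomial of value \<open>w\<close> equals a reduced one, and
  at most one reduced monomial has that value, so the coefficients simply add up.\<close>

lemma span_le_normal:
  "b \<in> span_of (\<lambda>u. u \<le> w) \<Longrightarrow> b \<in> span_of (\<lambda>u. u < w) \<or>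
     (\<exists>a i q c. i < r \<and> v (nmon a i q) = w \<and> b - \<kappa> c * nmon a i q \<in> span_of (\<lambda>u. u < w))"
proof (induction rule: span_of.induct)
  case (add b a i j l c)
  let ?m = "mon a i j l"
  show ?case
  proof (cases "v ?m = w")
    case False
    with add(2) have m: "v ?m < w" by simp
    from add.IH show ?thesis
    proof
      assume "b \<in> span_of (\<lambda>u. u < w)"
      then show ?thesis using span_of.add m by blast
    next
      assume "\<exists>a i q c. i < r \<and> v (nmon a i q) = w \<and> b - \<kappa> c * nmon a i q \<in> span_of (\<lambda>u. u < w)"
      then obtain a' i' q' c' where *: "i' < r" "v (nmon a' i' q') = w" "b - \<kappa> c' * nmon a' i' q' \<in> span_of (\<lambda>u. u < w)"
        by blast
      have "b + \<kappa> c * ?m - \<kappa> c' * nmon a' i' q' = (b - \<kappa> c' * nmon a' i' q') + \<kappa> c * ?m" by simp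
      also have "\<dots> \<in> span_of (\<lambda>u. u < w)" using span_of.add[OF *(3), of a i j l] m by blast
      finally show ?thesis using * by blast
    qed
  next
    case True
    obtain a1 i1 q1 where n: "i1 < r" "v (nmon a1 i1 q1) = w" "?m - nmon a1 i1 q1 \<in> span_of (\<lambda>u. u < w)"
      using normal_form[of a i j l] True by auto
    have n3: "\<kappa> c * (?m - nmon a1 i1 q1) \<in> span_of (\<lambda>u. u < w)" by (rule span_of_scale[OF n(3)])
    from add.IH show ?thesis
    proof
      assume "b \<in> span_of (\<lambda>u. u < w)"
      from span_of_add[OF this n3] have "b + \<kappa> c * ?m - \<kappa> c * nmon a1 i1 q1 \<in> span_of (\<lambda>u. u < w)"
        by (simp add: algebra_simps)
      then show ?thesis using n by blast
    next
      assume "\<exists>a i q c. i < r \<and> v (nmon a i q) = w \<and> b - \<kappa> c * nmon a i q \<in> span_of (\<lambda>u. u < w)"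
      then obtain a' i' q' c' where *: "i' < r" "v (nmon a' i' q') = w" "b - \<kappa> c' * nmon a' i' q' \<in> span_of (\<lambda>u. u < w)"
        by blast
      have "a' = a1 \<and> i' = i1 \<and> q' = q1" using v_nmon_inj n * by metis
      with span_of_add[OF *(3) n3]
      have "b + \<kappa> c * ?m - \<kappa> (c' + c) * nmon a1 i1 q1 \<in> span_of (\<lambda>u. u < w)"
        by (simp add: algebra_simps \<kappa>_add)
      then show ?thesis using n by blast
    qed
  qed
qed (auto intro: span_of.zero)

text \<open>Terms of smaller value cannot cancel a nonzero multiple of a reduced monomial; hence a
  drop in value is already visible in the monomials.\<close>

lemma span_le_cancel:
  assumes "b \<in> span_of (\<lambda>u. u \<le> w)" "b \<noteq> 0" "v b < w"
  shows "b \<in> span_of (\<lambda>u. u < w)"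
proof (rule ccontr)
  assume not: "b \<notin> span_of (\<lambda>u. u < w)"
  then obtain a i q c where *: "i < r" "v (nmon a i q) = w" "b - \<kappa> c * nmon a i q \<in> span_of (\<lambda>u. u < w)"
    using span_le_normal[OF assms(1)] by blast
  have c: "c \<noteq> 0" using not * by auto
  have 1: "\<kappa> c * nmon a i q \<noteq> 0" "v (\<kappa> c * nmon a i q) = w"
    using c * by (auto simp: v_mult v_\<kappa> \<kappa>_nonzero nmon_def)
  have "b = \<kappa> c * nmon a i q \<or> v (b - \<kappa> c * nmon a i q) < w" using span_less[OF *(3)] by auto
  then have "v b = w"
  proof
    assume "v (b - \<kappa> c * nmon a i q) < w"
    then show ?thesis using v_add_less(2)[of "\<kappa> c * nmon a i q" _ "b - \<kappa> c * nmon a i q"] 1 below_refl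
      by fastforce
  qed (use 1 in auto)
  with assms show False by simp
qed

text \<open>Cancellation in \<open>v\<close> is always explained by the rewriting rules: starting
  from any expression of \<open>b\<close>, the bound on its monomials is lowered until it reaches
  \<open>v b\<close>.\<close>

lemma in_span_le_v:
  assumes "b \<in> B" "b \<noteq> 0"
  shows "b \<in> span_of (\<lambda>u. u \<le> v b)"
proof -
  obtain Jb \<Omega>b where vb: "v b = [:of_nat Jb, of_int \<Omega>b:]" using v_int[OF assms(2)] by blast
  have desc: "b \<in> span_of (\<lambda>u. u \<le> v b)"
    if "b \<in> span_of (\<lambda>u. u \<le> w)" "w = [:of_nat J, of_int \<Omega>:]" for w J \<Omega>
    using that
  \<comment> \<open>The dominating coordinate is an integer but cannot pass below that of
    \<open>b\<close>; the other one is a natural number. So the lexicographic descent ends.\<close>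
  proof (induction "(nat (\<Omega> - \<Omega>b), J)" arbitrary: J \<Omega> w rule: wf_induct[OF wf_lex_prod[OF wf_less wf_less]])
    case 1
    have le: "v b \<le> w" using span_le[OF 1(2)] assms(2) by (simp add: below_def)
    show ?case
    proof (cases "v b = w")
      case True
      then show ?thesis using 1 by simp
    next
      case False
      then have "b \<in> span_of (\<lambda>u. u < w)" using span_le_cancel 1(2) le assms(2) by auto
      then obtain a i j l where m: "v (mon a i j l) < w" "b \<in> span_of (\<lambda>u. u \<le> v (mon a i j l))"
        using span_less_imp_le assms(2) by blast
      define J' \<Omega>' where "J' = i + r * (j + s * l)" and "\<Omega>' = int (d * j + (d * s + e) * l) - int a"
      have vm: "v (mon a i j l) = [:of_nat J', of_int \<Omega>':]" unfolding J'_def \<Omega>'_def v_mon ..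
      have "v b \<le> v (mon a i j l)" using span_le[OF m(2)] assms(2) by (simp add: below_def)
      then have "\<Omega>b \<le> \<Omega>'" unfolding vm vb linear_le_iff by auto
      moreover have "\<Omega>' < \<Omega> \<or> \<Omega>' = \<Omega> \<and> J' < J"
        using m(1) unfolding vm 1(3) linear_less_iff by auto
      ultimately have "((nat (\<Omega>' - \<Omega>b), J'), (nat (\<Omega> - \<Omega>b), J)) \<in> {(x, y). x < y} <*lex*> {(x, y). x < y}"
        by auto
      then show ?thesis using 1(1) m(2) vm by blast
    qed
  qed
  have "b = 0 \<or> (\<exists>a i j l. b \<in> span_of (\<lambda>u. u \<le> v (mon a i j l)))" using assms(1)
  proof (induction rule: span_of.induct)
    case (add b a i j l c)
    show ?case
    proof (cases "b = 0")
      case True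
      then show ?thesis using span_of_mon[of "\<lambda>u. u \<le> v (mon a i j l)" a i j l c] by auto
    next
      case False
      then obtain a' i' j' l' where *: "b \<in> span_of (\<lambda>u. u \<le> v (mon a' i' j' l'))" using add by blast
      show ?thesis
      proof (cases "v (mon a i j l) \<le> v (mon a' i' j' l')")
        case True
        then show ?thesis using span_of.add[OF *, of a i j l c] by blast
      next
        case False
        then have "b \<in> span_of (\<lambda>u. u \<le> v (mon a i j l))" using span_of_mono[OF *] by fastforce
        then show ?thesis using span_of.add[of b "\<lambda>u. u \<le> v (mon a i j l)" a i j l c] by blast
      qed
    qed
  qed auto
  then show ?thesis using desc assms(2) v_mon by metis
qed

lemma v_semigroup: "b \<in> B \<Longrightarrow> b \<noteq> 0 \<Longrightarrow> \<exists>a i j l. v (mon a i j l) = v b"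
  using in_span_le_v[of b] span_le_attained[of b "v b"] span_less[of b "v b"] by auto

text \<open>In an expression of \<open>b\<close> bounded by \<open>v b\<close> all monomials have
  negative dominating coordinate. Only \<open>x\<close> contributes negatively to it, so each of
  them contains \<open>x\<close>.\<close>

lemma x_dvd:
  assumes "b \<in> B" "b \<noteq> 0" "v b = [:\<alpha>, \<beta>:]" "\<beta> \<le> - 1"
  shows "\<exists>g\<in>B. b = x * g"
proof -
  have "b \<in> span_of (\<lambda>u. u \<le> [:\<alpha>, \<beta>:])" using in_span_le_v assms by metis
  then show ?thesis
  proof (induction rule: span_of.induct)
    case (add b a i j l c)
    have "of_int (int (d * j + (d * s + e) * l) - int a) \<le> \<beta>"
      using add(2) unfolding v_mon linear_le_iff by auto
    with assms(4) have "of_int (int (d * j + (d * s + e) * l) - int a) \<le> (of_int (- 1) :: rat)" by simp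
    then have "int (d * j + (d * s + e) * l) - int a \<le> - 1" by (simp only: of_int_le_iff)
    then obtain a' where a: "a = Suc a'" by (cases a; simp del: of_nat_mult of_nat_add)
    obtain g where g: "g \<in> B" "b = x * g" using add by blast
    have "b + \<kappa> c * mon a i j l = x * (g + \<kappa> c * mon a' i j l)"
      using g a by (simp add: mon_def algebra_simps)
    moreover have "g + \<kappa> c * mon a' i j l \<in> B" using g span_of.add by blast
    ultimately show ?case by blast
  qed (auto intro: span_of.zero bexI[of _ 0])
qed

end

section \<open>The maximal slope of an iterative derivation\<close>

lemma (in leading_form) below_mult_D:
  assumes "locally_finite_hs B \<kappa> D" "a \<in> B" "b \<in> B"
    and "\<And>i. below v (w + of_nat i * \<rho>) (D i a)" "\<And>i. below v (w' + of_nat i * \<rho>) (D i b)"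
  shows "below v ((w + w') + of_nat i * \<rho>) (D i (a * b))"
proof -
  interpret locally_finite_hs B \<kappa> D by fact
  have "below v ((w + w') + of_nat i * \<rho>) (D j a * D (i - j) b)" if "j \<le> i" for j
  proof -
    have "(w + of_nat j * \<rho>) + (w' + of_nat (i - j) * \<rho>) = (w + w') + of_nat i * \<rho>"
      using that by (simp add: of_nat_diff algebra_simps)
    with below_mult[OF assms(4)[of j] assms(5)[of "i - j"]] show ?thesis by simp
  qed
  then show ?thesis unfolding D_mult[OF assms(2,3)] by (intro below_sum) auto
qed

text \<open>The numbers in \<open>numeric\<close> are, up to sign, the determinants of
  \<open>v t\<close> with \<open>v x\<close>, \<open>v z\<close> and \<open>v y\<close>; excluding 1
  keeps these pairs from spanning the integer lattice.\<close>

locale double_danielewski_hs = double_danielewski_relations +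
  fixes D :: "nat \<Rightarrow> 'a \<Rightarrow> 'a"
  assumes hs: "locally_finite_hs B \<kappa> D"
    and numeric: "r * s \<noteq> 1" "d * s + e \<noteq> 1" "r * e \<noteq> 1" and e_pos: "e \<ge> 1"
begin

sublocale hs: locally_finite_hs B \<kappa> D by (rule hs)

text \<open>The bound by the largest slope of the generators passes to monomials by the product
  rule. It passes to every \<open>b\<close> because \<open>in_span_le_v\<close> offers an expression
  whose monomials have value at most \<open>v b\<close>.\<close>

lemma exists_slope:
  assumes "i0 > 0" "D i0 x \<noteq> 0"
  obtains \<rho> where "graded_hs v lc \<kappa> B D \<rho>"
    "\<exists>g\<in>{x, z, y, t}. \<exists>i>0. D i g \<noteq> 0 \<and> v (D i g) = v g + of_nat i * \<rho>"
proof -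
  define slope where "slope g i = smult (1 / of_nat i) (v (D i g) - v g)" for g i
  have slope: "of_nat i * slope g i = v (D i g) - v g" if "i > 0" for g i
    using that by (simp add: slope_def of_nat_poly)
  define \<Gamma> where "\<Gamma> = {x, z, y, t}"
  have \<Gamma>B: "\<Gamma> \<subseteq> B" using gen_in_B by (simp add: \<Gamma>_def)
  have "finite {i. D i g \<noteq> 0}" if g: "g \<in> \<Gamma>" for g
  proof -
    obtain n where "\<forall>i>n. D i g = 0" using hs.D_finite \<Gamma>B g by blast
    then have "{i. D i g \<noteq> 0} \<subseteq> {..n}" using not_le by auto
    then show ?thesis using finite_subset by blast
  qed
  then have "finite (SIGMA g:\<Gamma>. {i. D i g \<noteq> 0})" by (intro finite_SigmaI) (simp_all add: \<Gamma>_def)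
  then have fin: "finite {(g, i). g \<in> \<Gamma> \<and> i > 0 \<and> D i g \<noteq> 0}"
    by (rule rev_finite_subset) auto
  let ?S = "(\<lambda>(g, i). slope g i) ` {(g, i). g \<in> \<Gamma> \<and> i > 0 \<and> D i g \<noteq> 0}"
  define \<rho> where "\<rho> = Max ?S"
  \<comment> \<open>\<open>D i0 x \<noteq> 0\<close> makes the set of slopes nonempty.\<close>
  have S: "finite ?S" "?S \<noteq> {}" using fin assms by (auto simp: \<Gamma>_def)
  have "\<rho> \<in> ?S" unfolding \<rho>_def using Max_in[OF S] .
  then obtain g i where att: "g \<in> \<Gamma>" "i > 0" "D i g \<noteq> 0" "\<rho> = slope g i" by auto
  have gen: "below v (v g + of_nat i * \<rho>) (D i g)" if g: "g \<in> \<Gamma>" for g i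
  proof (cases "i = 0 \<or> D i g = 0")
    case True
    then show ?thesis using hs.D_0 \<Gamma>B g by (auto simp: below_def)
  next
    case False
    then have "slope g i \<le> \<rho>" unfolding \<rho>_def using g S by (intro Max_ge) auto
    then have "of_nat i * slope g i \<le> of_nat i * \<rho>" by (intro mult_left_mono) auto
    then have "v (D i g) - v g \<le> of_nat i * \<rho>" using slope False by simp
    then show ?thesis by (simp add: below_def diff_le_eq add.commute)
  qed
  have pow: "g ^ n \<in> B \<and> (\<forall>i. below v (of_nat n * v g + of_nat i * \<rho>) (D i (g ^ n)))" if g: "g \<in> \<Gamma>" for g n
  proof (induction n)
    case 0
    have "below v (of_nat i * \<rho>) (D i 1)" for i
      using \<kappa>_in_span[of "\<lambda>_. True" 1] hs.D_0[of 1] hs.D_\<kappa>[of i 1]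
      by (cases "i = 0") (simp_all add: below_def v_one)
    then show ?case using \<kappa>_in_span[of "\<lambda>_. True" 1] by simp
  next
    case (Suc n)
    then have "below v ((v g + of_nat n * v g) + of_nat i * \<rho>) (D i (g * g ^ n))" for i
      using below_mult_D[OF hs, of g "g ^ n" "v g" \<rho>] \<Gamma>B g gen by blast
    then show ?case using Suc \<Gamma>B g hs.B_mult by (auto simp: algebra_simps)
  qed
  have mult: "a * b \<in> B \<and> (\<forall>i. below v (w + w' + of_nat i * \<rho>) (D i (a * b)))"
    if "a \<in> B \<and> (\<forall>i. below v (w + of_nat i * \<rho>) (D i a))" "b \<in> B \<and> (\<forall>i. below v (w' + of_nat i * \<rho>) (D i b))" for a b w w'
    using that below_mult_D[OF hs, of a b w \<rho> w'] hs.B_mult by blast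
  have mon: "mon a i j l \<in> B \<and> (\<forall>k. below v (v (mon a i j l) + of_nat k * \<rho>) (D k (mon a i j l)))" for a i j l
    unfolding v_mon_eq unfolding mon_def by (intro mult pow) (auto simp: \<Gamma>_def)
  have \<kappa>: "\<kappa> c \<in> B \<and> (\<forall>i. below v (0 + of_nat i * \<rho>) (D i (\<kappa> c)))" for c
  proof -
    have "below v (0 + of_nat i * \<rho>) (D i (\<kappa> c))" for i
      using hs.D_\<kappa>[of i c] hs.D_0[OF hs.\<kappa>_B, of c] v_\<kappa>[of c]
      by (cases "i = 0"; cases "c = 0") (auto simp: below_def)
    then show ?thesis using hs.\<kappa>_B by blast
  qed
  have D0: "D i 0 = 0" for i
  proof -
    have "D i 0 + D i 0 = D i 0 + 0" using hs.D_add[of 0 0 i] span_of.zero by simp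
    then show ?thesis by (rule add_left_imp_eq)
  qed
  have span: "b \<in> B \<and> (\<forall>i. below v (w + of_nat i * \<rho>) (D i b))" if "b \<in> span_of (\<lambda>u. u \<le> w)" for b w
    using that
  proof (induction rule: span_of.induct)
    case zero
    then show ?case by (simp add: D0 span_of.zero)
  next
    case (add b a i j l c)
    have m: "\<kappa> c * mon a i j l \<in> B \<and> (\<forall>k. below v (0 + v (mon a i j l) + of_nat k * \<rho>) (D k (\<kappa> c * mon a i j l)))"
      using mult[OF \<kappa> mon] .
    have "below v (w + of_nat k * \<rho>) (D k (b + \<kappa> c * mon a i j l))" for k
    proof -
      have "below v (w + of_nat k * \<rho>) (D k (\<kappa> c * mon a i j l))"
        using m below_mono[of "0 + v (mon a i j l) + of_nat k * \<rho>" _ "w + of_nat k * \<rho>"] add(2) by simp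
      then show ?thesis using m add hs.D_add below_add by simp
    qed
    then show ?case using m add hs.B_add by blast
  qed
  have "below v (v a + of_nat i * \<rho>) (D i a)" if "a \<in> B" for a i
    using span[OF in_span_le_v[OF that]] D0 by (cases "a = 0") auto
  then have "graded_hs v lc \<kappa> B D \<rho>"
    by unfold_locales
  moreover have "v (D i g) = v g + of_nat i * \<rho>" using slope[OF att(2), of g] att(4) by simp
  ultimately show ?thesis using that att unfolding \<Gamma>_def by blast
qed

end

section \<open>Divisibility of all degrees by the least positive one\<close>

context graded_hs
begin

text \<open>By minimality the inner binomial coefficients of \<open>n\<close> vanish in \<open>k\<close>, so \<open>(1 + U)\<^sup>n = 1 + U\<^sup>n\<close>. For
  \<open>dl a = n q + m\<close> with \<open>0 < m < n\<close> the coefficient of \<open>U\<^sup>n\<^sup>q\<close> in \<open>(1 + U)\<^sup>d\<^sup>l\<^sup>a\<close> is then 1, and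
  \<open>D (n q) a\<close> has degree \<open>m\<close>.\<close>

lemma minimal_degree_dvd:
  assumes "b \<in> B" "b \<noteq> 0" "dl b = n" "n > 0"
    and min: "\<And>a. a \<in> B \<Longrightarrow> a \<noteq> 0 \<Longrightarrow> dl a > 0 \<Longrightarrow> n \<le> dl a"
    and "a \<in> B" "a \<noteq> 0"
  shows "n dvd dl a"
proof (rule ccontr)
  assume nd: "\<not> n dvd dl a"
  \<comment> \<open>Otherwise \<open>D i f\<close> would have degree \<open>dl f - i\<close>,
    positive and below the minimum \<open>n\<close>.\<close>
  have step: "of_nat (binomial (dl f) i) = (0::'k)"
    if "f \<in> B" "f \<noteq> 0" "0 < i" "i < dl f" "dl f - i < n" for f i
  proof (rule ccontr)
    assume "of_nat (binomial (dl f) i) \<noteq> (0::'k)"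
    then have "D i f \<noteq> 0" "dl (D i f) = dl f - i" using hasse_degree[of f i] that by auto
    with min[of "D i f"] that D_B show False by force
  qed
  have pow_n: "[:1, 1::'k:] ^ n = 1 + monom 1 n"
  proof (rule poly_eqI)
    fix i
    have c: "coeff ([:1, 1::'k:] ^ n) i = of_nat (n choose i)" for i n
    proof (cases "i \<le> n")
      case True
      then show ?thesis using coeff_linear_poly_power[of i n 1 "1::'k"] by simp
    next
      case False
      then show ?thesis by (simp add: coeff_eq_0 degree_linear_power binomial_eq_0)
    qed
    show "coeff ([:1, 1::'k:] ^ n) i = coeff (1 + monom 1 n) i"
      using step[OF assms(1,2), of i] assms(3,4) linorder_less_linear[of i n]
      by (cases "i = 0") (auto simp: c binomial_eq_0)
  qed
  define q m where "q = dl a div n" and "m = dl a mod n"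
  have a: "dl a = n * q + m" "m < n" "m > 0" using nd assms(4) by (auto simp: q_def m_def mod_greater_zero_iff_not_dvd)
  have "min n (dl a) = n" using min[of a] assms(6,7) a by simp
  then have "q > 0" using assms(4) by (simp add: q_def div_greater_zero_iff)
  have "of_nat (binomial (dl a) (n * q)) = coeff ([:1, 1::'k:] ^ dl a) (n * q)"
    using coeff_linear_poly_power[of "n * q" "dl a" 1 "1::'k"] a by simp
  also have "\<dots> = coeff ((1 + monom 1 n) ^ q * [:1, 1::'k:] ^ m) (n * q)"
    by (simp add: a power_add power_mult pow_n)
  also have "\<dots> = coeff ([:1, 1::'k:] ^ m) 0"
  \<comment> \<open>As \<open>m < n\<close>, the product with \<open>q\<close> factors has degree
    below \<open>n * q + n\<close>; so only the summand \<open>monom 1 n\<close> of the next factor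
    reaches the coefficient sought.\<close>
  proof (induction q)
    case (Suc q)
    let ?R = "(1 + monom 1 n) ^ q * [:1, 1::'k:] ^ m"
    have "degree (1 + monom (1::'k) n) \<le> n" by (intro degree_add_le) (auto simp: degree_monom_le)
    then have "degree ((1 + monom (1::'k) n) ^ q) \<le> n * q"
      using degree_power_le[of "1 + monom (1::'k) n" q] by (meson le_trans mult_le_mono1)
    then have "degree ?R < n * q + n"
      using degree_mult_le[of "(1 + monom 1 n) ^ q" "[:1, 1::'k:] ^ m"] a by (simp add: degree_linear_power)
    then have "coeff ?R (n * q + n) = 0" by (rule coeff_eq_0)
    moreover have "(1 + monom 1 n) ^ Suc q * [:1, 1::'k:] ^ m = ?R + monom 1 n * ?R"
      by (simp add: algebra_simps)
    ultimately show ?case using Suc by (simp add: coeff_monom_mult add.commute)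
  qed simp
  also have "\<dots> = 1" by (simp add: coeff_0_power)
  finally have "of_nat (binomial (dl a) (n * q)) = (1::'k)" .
  moreover have "0 < n * q" "n * q < dl a" "dl a - n * q < n" using a \<open>q > 0\<close> assms(4) by auto
  ultimately show False using step[of a "n * q"] assms(6,7) by simp
qed

text \<open>The case \<open>i = dl a\<close> of \<open>hasse_degree\<close>, where the binomial
  coefficient is 1: adding \<open>dl a\<close> times \<open>\<rho>\<close> to a value gives the
  value of an element of degree 0.\<close>

lemma v_lattice:
  assumes "a \<in> B" "a \<noteq> 0"
  shows "D (dl a) a \<in> B" "D (dl a) a \<noteq> 0" "dl (D (dl a) a) = 0"
    "v (D (dl a) a) = v a + of_nat (dl a) * \<rho>"
  using hasse_degree[OF assms, of "dl a"] D_B assms by auto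

end

section \<open>Invariance of \<open>x\<close> under every exponential map\<close>

context double_danielewski_hs
begin

lemma x_invariant:
  assumes "i0 > 0"
  shows "D i0 x = 0"
proof (rule ccontr)
  assume nonzero_D: "D i0 x \<noteq> 0"
  obtain \<rho> where "graded_hs v lc \<kappa> B D \<rho>" and
    att: "\<exists>g\<in>{x, z, y, t}. \<exists>i>0. D i g \<noteq> 0 \<and> v (D i g) = v g + of_nat i * \<rho>"
    using exists_slope[OF assms nonzero_D] by blast
  interpret gr: graded_hs v lc \<kappa> B D \<rho> by fact
  have dlm: "gr.dl (mon a i j l) = a * gr.dl x + i * gr.dl z + j * gr.dl y + l * gr.dl t" for a i j l
    unfolding mon_def by (simp add: gr.dl_mult gr.dl_power gr.B_power hs.B_mult gen_in_B)
  have monB: "mon a i j l \<in> B" for a i j l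
    using span_of_mon[of "\<lambda>_. True" a i j l 1] by simp
  \<comment> \<open>The two sides of each rewriting rule have equal value, hence equal
    degree.\<close>
  have rel1: "d * gr.dl x + gr.dl y = r * gr.dl z"
    using gr.dl_cong[of "mon d 0 1 0" "mon 0 r 0 0"] v_rel_z monB by (simp add: dlm) (simp add: mon_def)
  have rel2: "e * gr.dl x + gr.dl t = s * gr.dl y"
    using gr.dl_cong[of "mon e 0 0 1" "mon 0 0 s 0"] v_rel_y monB by (simp add: dlm) (simp add: mon_def)
  have comb: "\<exists>a i j l. v b = v (mon a i j l) \<and> gr.dl b = a * gr.dl x + i * gr.dl z + j * gr.dl y + l * gr.dl t"
    if b: "b \<in> B" "b \<noteq> 0" for b
  proof -
    obtain a i j l where *: "v (mon a i j l) = v b" using v_semigroup[OF b] by blast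
    then have "gr.dl b = gr.dl (mon a i j l)" using b monB by (intro gr.dl_cong) auto
    then show ?thesis using * dlm by metis
  qed
  show False
  proof (cases "gr.dl x = 0")
    case False
    \<comment> \<open>Positivity passes from \<open>x\<close> to \<open>y\<close> by
      \<open>rel2\<close> and on to \<open>z\<close> by \<open>rel1\<close>; \<open>t\<close> may
      have degree 0.\<close>
    then have pos: "gr.dl x > 0" "gr.dl z > 0" "gr.dl y > 0"
      using rel1 rel2 e_pos by (auto intro!: Nat.gr0I)
    \<comment> \<open>The top derivative has degree 0, so its value is that of a power of
      \<open>t\<close>, the other generators having positive degree.\<close>
    have inv: "\<exists>l. v b + of_nat (gr.dl b) * \<rho> = of_nat l * v t" if b: "b \<in> B" "b \<noteq> 0" for b
    proof -
      obtain a i j l where *: "v (D (gr.dl b) b) = v (mon a i j l)"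
          "0 = a * gr.dl x + i * gr.dl z + j * gr.dl y + l * gr.dl t"
        using comb[of "D (gr.dl b) b"] gr.v_lattice[OF b] by metis
      then have "a = 0" "i = 0" "j = 0" using pos by auto
      then have "v (D (gr.dl b) b) = of_nat l * v t" using * by (simp add: v_mon_eq)
      then show ?thesis using gr.v_lattice[OF b] by metis
    qed
    define n where "n = (LEAST n. n > 0 \<and> (\<exists>b\<in>B. b \<noteq> 0 \<and> gr.dl b = n))"
    have ex: "\<exists>n. n > 0 \<and> (\<exists>b\<in>B. b \<noteq> 0 \<and> gr.dl b = n)" using pos gen_in_B nonzero by blast
    then have "n > 0 \<and> (\<exists>b\<in>B. b \<noteq> 0 \<and> gr.dl b = n)" unfolding n_def by (rule LeastI_ex)
    then obtain b where b: "n > 0" "b \<in> B" "b \<noteq> 0" "gr.dl b = n" by blast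
    have min: "n \<le> gr.dl a" if "a \<in> B" "a \<noteq> 0" "gr.dl a > 0" for a
      unfolding n_def using that by (intro Least_le) auto
    have dvd: "n dvd gr.dl a" if "a \<in> B" "a \<noteq> 0" for a
      using gr.minimal_degree_dvd[OF b(2-4,1) min that] .
    \<comment> \<open>\<open>n\<close> is a combination of degrees of generators with natural
      coefficients, so one of these degrees is positive and at most \<open>n\<close>; minimality
      gives equality.\<close>
    have "\<exists>g\<in>{x, z, y, t}. gr.dl g = n"
    proof -
      obtain a i j l where *: "n = a * gr.dl x + i * gr.dl z + j * gr.dl y + l * gr.dl t"
        using comb[OF b(2,3)] b(4) by auto
      have "\<exists>g\<in>{x, z, y, t}. gr.dl g > 0 \<and> gr.dl g \<le> n"
      proof (rule ccontr)
        assume "\<not> ?thesis"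
        then have "gr.dl g = 0 \<or> gr.dl g > n" if "g \<in> {x, z, y, t}" for g using that not_le by blast
        then have "c * gr.dl g = 0 \<or> c * gr.dl g > n" if "g \<in> {x, z, y, t}" for g c
          using that mult_le_mono1[of 1 c "gr.dl g"] by (cases "c = 0") fastforce+
        from this[of x a] this[of z i] this[of y j] this[of t l] show False using * b(1) by auto
      qed
      then show ?thesis using min gen_in_B nonzero by (metis insertE le_antisym singletonD)
    qed
    then obtain g where g: "g \<in> {x, z, y, t}" "gr.dl g = n" by blast
    have gB: "g \<in> B" "g \<noteq> 0" using g gen_in_B by auto
    obtain lg where lg: "v g + of_nat n * \<rho> = of_nat lg * v t" using inv[OF gB] g by auto
    \<comment> \<open>As \<open>n\<close> divides \<open>dl a\<close>, \<open>\<rho>\<close> can be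
      eliminated between the relations for \<open>a\<close> and for \<open>g\<close> with integer
      coefficients.\<close>
    have lat: "\<exists>c u. v a = of_int c * v g + of_int u * v t" if a: "a \<in> B" "a \<noteq> 0" for a
    proof -
      obtain c where c: "gr.dl a = n * c" using dvd[OF a] by (auto elim: dvdE)
      obtain la where la: "v a + of_nat (gr.dl a) * \<rho> = of_nat la * v t" using inv[OF a] by blast
      have "v a = of_nat la * v t - of_nat c * (of_nat n * \<rho>)"
        using la c by (simp add: algebra_simps)
      also have "of_nat n * \<rho> = of_nat lg * v t - v g" using lg by (simp add: algebra_simps)
      finally have "v a = of_int (int c) * v g + of_int (int la - int c * int lg) * v t"
        by (simp add: algebra_simps)
      then show ?thesis by blast
    qed
    obtain p q where pq: "v g = [:of_int p, of_int q:]" and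
      det: "\<bar>p * (int d * int s + int e) - q * (int r * int s)\<bar> \<in> {int (r * s), int (d * s + e), int (r * e), 0}"
    proof -
      from g(1) consider "g = x" | "g = z" | "g = y" | "g = t" by blast
      then show ?thesis
      proof cases
        case 1 then show ?thesis using that[of 0 "- 1"] v_gen by (simp add: abs_mult)
      next
        case 2 then show ?thesis using that[of 1 0] v_gen by (simp add: abs_mult)
      next
        case 3 then show ?thesis using that[of "int r" "int d"] v_gen by (simp add: abs_mult algebra_simps)
      next
        case 4 then show ?thesis using that[of "int (r * s)" "int (d * s + e)"] v_gen by (simp add: algebra_simps)
      qed
    qed
    have int_mult_linear: "of_int n * [:a, b:] = [:of_int n * a, of_int n * b:]" for n and a b :: rat
      by (simp add: of_int_poly)
    obtain c1 u1 where 1: "v x = of_int c1 * v g + of_int u1 * v t" using lat gen_in_B nonzero by blast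
    obtain c2 u2 where 2: "v z = of_int c2 * v g + of_int u2 * v t" using lat gen_in_B nonzero by blast
    have t: "v t = [:of_int (int r * int s), of_int (int d * int s + int e):]" by (simp add: v_gen)
    have "(0::rat) = of_int (c1 * p + u1 * (int r * int s))" "(- 1::rat) = of_int (c1 * q + u1 * (int d * int s + int e))"
      using 1 unfolding pq t v_gen int_mult_linear by simp_all
    then have e1: "0 = c1 * p + u1 * (int r * int s)" "- 1 = c1 * q + u1 * (int d * int s + int e)"
      by (metis of_int_eq_iff of_int_0 of_int_minus of_int_1)+
    have "(1::rat) = of_int (c2 * p + u2 * (int r * int s))" "(0::rat) = of_int (c2 * q + u2 * (int d * int s + int e))"
      using 2 unfolding pq t v_gen int_mult_linear by simp_all
    then have e2: "1 = c2 * p + u2 * (int r * int s)" "0 = c2 * q + u2 * (int d * int s + int e)"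
      by (metis of_int_eq_iff of_int_0 of_int_1)+
    \<comment> \<open>Determinants multiply: on the left that of \<open>v g, v t\<close> times that
      of the coefficients, on the right that of \<open>v x, v z\<close>, which is 1.\<close>
    have "(p * (int d * int s + int e) - q * (int r * int s)) * (c1 * u2 - c2 * u1) =
        (c1 * p + u1 * (int r * int s)) * (c2 * q + u2 * (int d * int s + int e)) -
        (c1 * q + u1 * (int d * int s + int e)) * (c2 * p + u2 * (int r * int s))"
      by (simp add: algebra_simps)
    also have "\<dots> = 1" unfolding e1[symmetric] e2[symmetric] by simp
    finally have "\<bar>p * (int d * int s + int e) - q * (int r * int s)\<bar> = 1"
      by (metis abs_mult_pos' abs_zmult_eq_1 abs_1 abs_mult)
    then have "int (r * s) = 1 \<or> int (d * s + e) = 1 \<or> int (r * e) = 1" using det by auto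
    then show False using numeric by linarith
  next
    case True
    then have dl: "gr.dl y = r * gr.dl z" "gr.dl t = s * (r * gr.dl z)" using rel1 rel2 by auto
    \<comment> \<open>Some generator attains the slope at a positive index and so has positive
      degree; with \<open>dl x = 0\<close> all these degrees are multiples of
      \<open>dl z\<close>.\<close>
    have z: "gr.dl z > 0"
    proof -
      obtain g i where g: "g \<in> {x, z, y, t}" "i > 0" "D i g \<noteq> 0" "v (D i g) = v g + of_nat i * \<rho>"
        using att by blast
      have gB: "g \<in> B" using g gen_in_B by auto
      have "coeff (gr.lead_poly g) i \<noteq> 0"
        using g lc_nonzero by (simp add: gr.coeff_lead_poly[OF gB] lead_at_def)
      then have "i \<le> gr.dl g" unfolding gr.dl_def by (rule le_degree)
      then show ?thesis using g True dl by (auto intro!: Nat.gr0I)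
    qed
    have inv: "\<exists>a. v b = [:0, - of_nat a:]" if b: "b \<in> B" "b \<noteq> 0" "gr.dl b = 0" for b
    proof -
      obtain a i j l where *: "v b = v (mon a i j l)"
          "0 = a * gr.dl x + i * gr.dl z + j * gr.dl y + l * gr.dl t"
        using comb[of b] b by metis
      then have "i = 0" "j = 0" "l = 0" using z dl r_pos s_pos by auto
      then show ?thesis using * by (auto simp: v_mon)
    qed
    obtain a where a: "v (D (gr.dl z) z) = [:0, - of_nat a:]"
      using inv[OF gr.v_lattice(1-3)[OF gen_in_B(2) nonzero(2)]] by blast
    \<comment> \<open>The top derivative of \<open>z\<close> has the value of a power of
      \<open>x\<close>, so \<open>dl z\<close> times \<open>\<rho>\<close> is
      \<open>[:- 1, - of_nat a:]\<close>, which is negative.\<close>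
    have \<rho>: "\<rho> < 0"
    proof (rule ccontr)
      assume "\<not> \<rho> < 0"
      then have "0 \<le> of_nat (gr.dl z) * \<rho>" by simp
      also have "\<dots> = [:0, - of_nat a:] - [:1, 0:]"
        unfolding v_gen(2)[symmetric] using a gr.v_lattice(4)[of z] gen_in_B
        by (simp add: eq_diff_eq add.commute)
      also have "\<dots> = [:- 1, - of_nat a:]" by simp
      finally have "[:0, 0:] \<le> [:- 1, - of_nat a :: rat:]" by simp
      then show False unfolding linear_le_iff by simp
    qed
    \<comment> \<open>Such an \<open>f\<close> is divisible by \<open>x\<close>, and factors of
      invariants are invariant; this would make \<open>x\<close> invariant.\<close>
    have small: False if f: "f \<in> B" "f \<noteq> 0" "\<And>i. i > 0 \<Longrightarrow> D i f = 0" "v f = [:0, - of_nat a:]" "a > 0" for f a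
    proof -
      obtain g where g: "g \<in> B" "f = x * g" using x_dvd[OF f(1,2,4)] f(5) by auto
      then have "D i0 x = 0" using hs.factorially_closed[of x g] f gen_in_B assms by blast
      then show False using nonzero_D by simp
    qed
    obtain n where n: "D n x \<noteq> 0" "\<And>i. i > n \<Longrightarrow> D i x = 0"
      using hs.top_coefficient[of x] gen_in_B by auto
    \<comment> \<open>The composition rule makes the top coefficient of the image of
      \<open>x\<close> invariant. Its value is that of a power of \<open>x\<close>, by
      \<open>small\<close> of the zeroth.\<close>
    define f where "f = D n x"
    have f: "f \<in> B" "f \<noteq> 0" "\<And>i. i > 0 \<Longrightarrow> D i f = 0"
      using n hs.D_B hs.D_D gen_in_B by (auto simp: f_def)
    obtain a where a: "v f = [:0, - of_nat a:]" using inv f gr.dl_invariant by blast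
    then have a0: "a = 0" using small[OF f a] by auto
    \<comment> \<open>Otherwise the difference would be an invariant of negative value, which
      \<open>small\<close> excludes.\<close>
    have fc: "f = \<kappa> (lc f)"
    proof (rule ccontr)
      assume ne: "f \<noteq> \<kappa> (lc f)"
      define g where "g = f + \<kappa> (- lc f)"
      have lcf: "lc f \<noteq> 0" using f lc_nonzero by blast
      have g: "g \<in> B" "g \<noteq> 0" "g = f - \<kappa> (lc f)"
        using hs.B_add[OF f(1) hs.\<kappa>_B[of "- lc f"]] ne by (auto simp: g_def \<kappa>_uminus)
      have gi: "D i g = 0" if "i > 0" for i
        using f that hs.D_\<kappa> hs.D_add hs.\<kappa>_B by (simp add: g_def)
      have "v g < v f" unfolding g(3)
        using f a a0 lcf v_\<kappa>[OF lcf] lc_\<kappa>[OF lcf] \<kappa>_nonzero[OF lcf] ne by (intro v_diff_less) auto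
      moreover obtain a' where a': "v g = [:0, - of_nat a':]" using inv g gi gr.dl_invariant by blast
      ultimately have "[:0, - of_nat a':] < [:0, 0 :: rat:]" using a a0 by simp
      then have "a' > 0" unfolding linear_less_iff by auto
      then show False using small[OF g(1,2) gi a'] by blast
    qed
    \<comment> \<open>The slope bound makes \<open>v f\<close> negative, since
      \<open>v x < 0\<close> and \<open>\<rho> < 0\<close>; but \<open>v f = 0\<close>.\<close>
    have "v f \<le> v x + of_nat n * \<rho>" using gr.below_D[of x n] f gen_in_B by (simp add: below_def f_def)
    moreover have "of_nat n * \<rho> \<le> 0" using \<rho> by (simp add: mult_nonneg_nonpos)
    moreover have "v x < 0"
      using linear_less_iff[of 0 "- 1" 0 0] by (simp add: v_gen)
    ultimately show False using a a0 by simp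
  qed
qed

end

section \<open>The algebra inside the Laurent series over \<open>k[z]\<close>\<close>

text \<open>The series are in \<open>x\<close>, with polynomials in \<open>z\<close> as
  coefficients. The zero series gets the value 0 by convention, but \<open>below\<close> and
  \<open>lead_at\<close> treat it separately.\<close>

definition fls_val :: "'k::field poly fls \<Rightarrow> rat poly" where
  "fls_val a = [: of_nat (degree (fls_nth a (fls_subdegree a))), - of_int (fls_subdegree a) :]"

definition fls_lc :: "'k::field poly fls \<Rightarrow> 'k" where
  "fls_lc a = Polynomial.lead_coeff (fls_nth a (fls_subdegree a))"

definition fls_scalar :: "'k::field \<Rightarrow> 'k poly fls" where
  "fls_scalar c = fls_const [:c:]"

text \<open>In this coefficientwise form the bound is visibly closed under sums. Its entries are
  arbitrary rationals because bounds involving slopes need not be values.\<close>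

lemma below_fls_val_iff:
  "below fls_val [:\<alpha>, \<beta>:] a \<longleftrightarrow>
    (\<forall>i. (of_int (- i) > \<beta> \<longrightarrow> fls_nth a i = 0) \<and>
         (of_int (- i) = \<beta> \<longrightarrow> fls_nth a i = 0 \<or> of_nat (degree (fls_nth a i)) \<le> \<alpha>))"
  (is "_ \<longleftrightarrow> ?R")
proof (cases "a = 0")
  case False
  let ?n = "fls_subdegree a"
  have nz: "fls_nth a ?n \<noteq> 0" using False by simp
  show ?thesis
  proof
    assume "below fls_val [:\<alpha>, \<beta>:] a"
    then have *: "- of_int ?n < \<beta> \<or> - of_int ?n = \<beta> \<and> of_nat (degree (fls_nth a ?n)) \<le> \<alpha>"
      using False by (simp add: below_def fls_val_def linear_le_iff)
    have "fls_nth a i = 0" if "of_int (- i) > - (of_int ?n :: rat)" for i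
      using that by simp
    moreover have "i = ?n" if "- of_int ?n = \<beta>" "of_int (- i) = \<beta>" for i
      using that by (metis of_int_eq_iff of_int_minus neg_equal_iff_equal)
    ultimately show ?R using * by (metis order_less_trans)
  next
    assume ?R
    then have "\<not> of_int (- ?n) > \<beta>" "of_int (- ?n) = \<beta> \<Longrightarrow> of_nat (degree (fls_nth a ?n)) \<le> \<alpha>"
      using nz by blast+
    then show "below fls_val [:\<alpha>, \<beta>:] a"
      using False by (auto simp: below_def fls_val_def linear_le_iff)
  qed
qed (simp add: below_def)

lemma below_fls_val_add_linear:
  assumes "below fls_val [:\<alpha>, \<beta>:] a" "below fls_val [:\<alpha>, \<beta>:] b"
  shows "below fls_val [:\<alpha>, \<beta>:] (a + b)"
  unfolding below_fls_val_iff fls_plus_nth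
proof (intro allI conjI impI)
  note a = assms(1)[unfolded below_fls_val_iff, rule_format] and b = assms(2)[unfolded below_fls_val_iff, rule_format]
  fix i
  show "fls_nth a i + fls_nth b i = 0" if "of_int (- i) > \<beta>" using a[of i] b[of i] that by simp
  assume i: "of_int (- i) = \<beta>"
  have "of_nat (degree (fls_nth a i + fls_nth b i)) \<le> (of_nat (max (degree (fls_nth a i)) (degree (fls_nth b i))) :: rat)"
    by (simp only: of_nat_le_iff degree_add_le_max)
  then show "fls_nth a i + fls_nth b i = 0 \<or> of_nat (degree (fls_nth a i + fls_nth b i)) \<le> \<alpha>"
    using a[of i] b[of i] i by (auto simp: max_def split: if_splits)
qed

text \<open>Under the bound, the leading part is the coefficient of one fixed monomial in
  \<open>x\<close> and \<open>z\<close>, so its additivity is immediate.\<close>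

lemma lead_at_fls_val:
  assumes "below fls_val [:of_nat J, of_int \<Omega>:] a"
  shows "lead_at fls_val fls_lc [:of_nat J, of_int \<Omega>:] a = coeff (fls_nth a (- \<Omega>)) J"
proof -
  note * = assms[unfolded below_fls_val_iff, rule_format]
  have nth: "fls_nth a (- \<Omega>) = 0 \<or> degree (fls_nth a (- \<Omega>)) \<le> J"
    using *[of "- \<Omega>"] by simp
  have van: "fls_nth a i = 0" if "i < - \<Omega>" for i
  proof -
    have "\<Omega> < - i" using that by simp
    then have "of_int (- i) > (of_int \<Omega> :: rat)" by (simp only: of_int_less_iff)
    then show ?thesis using *[of i] by blast
  qed
  show ?thesis
  proof (cases "a \<noteq> 0 \<and> fls_val a = [:of_nat J, of_int \<Omega>:]")
    case True
    then have "of_int (- fls_subdegree a) = (of_int \<Omega> :: rat)"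
      and J: "J = degree (fls_nth a (fls_subdegree a))" by (auto simp: fls_val_def)
    then have "- fls_subdegree a = \<Omega>" by (simp only: of_int_eq_iff)
    then have "fls_subdegree a = - \<Omega>" by simp
    then show ?thesis using True J by (simp add: lead_at_def fls_lc_def)
  next
    case False
    have "coeff (fls_nth a (- \<Omega>)) J = 0"
    proof (rule ccontr)
      assume nz: "coeff (fls_nth a (- \<Omega>)) J \<noteq> 0"
      then have n0: "fls_nth a (- \<Omega>) \<noteq> 0" by auto
      then have "fls_subdegree a = - \<Omega>" by (intro fls_subdegree_eqI van)
      moreover have "degree (fls_nth a (- \<Omega>)) = J" using nth n0 le_degree[OF nz] by simp
      ultimately show False using False n0 by (auto simp: fls_val_def)
    qed
    moreover have "lead_at fls_val fls_lc [:of_nat J, of_int \<Omega>:] a = 0"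
      using False by (cases "a = 0") (auto simp: lead_at_def)
    ultimately show ?thesis by simp
  qed
qed

global_interpretation fls: leading_form fls_val fls_lc fls_scalar
proof
  show 1: "below fls_val w (a + b)" if ab: "below fls_val w a" "below fls_val w b"
    for w and a b :: "'k::field poly fls"
  proof (cases "a = 0 \<or> b = 0")
    case False
    define u where "u = max (fls_val a) (fls_val b)"
    obtain \<alpha> \<beta> where "u = [:\<alpha>, \<beta>:]" unfolding u_def max_def fls_val_def by metis
    moreover have "below fls_val u a" "below fls_val u b" by (auto simp: below_def u_def)
    ultimately have "below fls_val u (a + b)" using below_fls_val_add_linear by blast
    moreover have "u \<le> w" using ab False by (auto simp: u_def below_def)
    ultimately show ?thesis by (auto simp: below_def)
  qed (use ab in auto)
  show "lead_at fls_val fls_lc w (a + b) = lead_at fls_val fls_lc w a + lead_at fls_val fls_lc w b"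
    if "below fls_val w a" "below fls_val w b" for w and a b :: "'k::field poly fls"
  proof (cases "\<exists>J \<Omega>. w = [:of_nat J, of_int \<Omega>:]")
    case True
    then show ?thesis using that 1[OF that] by (auto simp: lead_at_fls_val)
  next
    case False
    \<comment> \<open>Such a \<open>w\<close> is the value of no series, so all three leading parts
      vanish.\<close>
    have "fls_val c \<noteq> w" for c :: "'k poly fls"
      using False unfolding fls_val_def by (metis of_int_minus)
    then show ?thesis by (simp add: lead_at_def)
  qed
qed (auto simp: fls_val_def fls_lc_def fls_scalar_def degree_mult_eq lead_coeff_mult coeff_mult_degree_sum fls_plus_const one_pCons mult.commute)

section \<open>Evaluation homomorphisms on iterated polynomial rings\<close>

definition rhom :: "('a::comm_ring_1 \<Rightarrow> 'b::comm_ring_1) \<Rightarrow> bool" where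
  "rhom h \<longleftrightarrow> (\<forall>a b. h (a + b) = h a + h b) \<and> (\<forall>a b. h (a * b) = h a * h b) \<and> h 1 = 1"

lemma rhomD:
  assumes "rhom h"
  shows "h (a + b) = h a + h b" "h (a * b) = h a * h b" "h 1 = 1" "h 0 = 0" "h (- a) = - h a"
    "h (a - b) = h a - h b" "h (a ^ n) = h a ^ n" "h (sum f A) = (\<Sum>i\<in>A. h (f i))"
proof -
  show add: "h (a + b) = h a + h b" "h (a * b) = h a * h b" "h 1 = 1" for a b using assms by (auto simp: rhom_def)
  show z: "h 0 = 0" using add(1)[of 0 0] by simp
  show m: "h (- a) = - h a" for a using add(1)[of a "- a"] z by (simp add: eq_neg_iff_add_eq_0 add.commute)
  show "h (a - b) = h a - h b" using add(1)[of a "- b"] m by simp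
  show "h (a ^ n) = h a ^ n" by (induction n) (auto simp: add)
  show "h (sum f A) = (\<Sum>i\<in>A. h (f i))" by (induction A rule: infinite_finite_induct) (auto simp: add z)
qed

definition eval_poly :: "('a::comm_ring_1 \<Rightarrow> 'b::comm_ring_1) \<Rightarrow> 'b \<Rightarrow> 'a poly \<Rightarrow> 'b" where
  "eval_poly h c p = poly (map_poly h p) c"

lemma eval_poly_pCons: "rhom h \<Longrightarrow> eval_poly h c (pCons a p) = h a + c * eval_poly h c p"
  by (simp add: eval_poly_def map_poly_pCons rhomD)

lemma eval_poly_0 [simp]: "eval_poly h c 0 = 0"
  by (simp add: eval_poly_def)

lemma eval_poly_const: "rhom h \<Longrightarrow> eval_poly h c [:a:] = h a"
  by (simp add: eval_poly_pCons)

lemma eval_poly_var: "rhom h \<Longrightarrow> eval_poly h c [:0, 1:] = c"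
  by (simp add: eval_poly_pCons rhomD)

lemma rhom_map_poly: "rhom h \<Longrightarrow> rhom (map_poly h)"
  unfolding rhom_def[of "map_poly h"]
  by (auto intro!: poly_eqI simp: coeff_map_poly rhomD coeff_mult one_pCons map_poly_pCons)

lemma rhom_eval_poly: "rhom h \<Longrightarrow> rhom (eval_poly h c)"
  unfolding rhom_def[of "eval_poly h c"] eval_poly_def by (simp add: rhomD(1-3)[OF rhom_map_poly])

lemma eval_poly_sum: "rhom h \<Longrightarrow> eval_poly h c p = (\<Sum>i\<le>degree p. h (coeff p i) * c ^ i)"
  by (induction p) (auto simp: eval_poly_pCons rhomD sum_distrib_left sum.atMost_Suc_shift algebra_simps
      simp del: sum.atMost_Suc)

lemma rhom_coeff_0: "rhom (\<lambda>p. coeff p 0)"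
  by (auto simp: rhom_def coeff_mult)

text \<open>A monic polynomial is no zero divisor modulo \<open>c\<close>: the leading coefficient
  of the product is that of \<open>b\<close>, so \<open>c\<close> divides the leading term of
  \<open>b\<close>, which is split off.\<close>

lemma const_dvd_mult_monic:
  fixes c :: "'a::idom" and b q :: "'a poly"
  assumes "[:c:] dvd b * q" "Polynomial.lead_coeff q = 1"
  shows "[:c:] dvd b"
  using assms(1)
proof (induction "degree b" arbitrary: b rule: less_induct)
  case less
  show ?case
  proof (cases "b = 0")
    case False
    have "c dvd coeff (b * q) (degree (b * q))" using less(2) const_poly_dvd_iff by blast
    then have c: "c dvd Polynomial.lead_coeff b" using assms(2) by (simp only: lead_coeff_mult) simp
    define m where "m = monom (Polynomial.lead_coeff b) (degree b)"
    have m: "[:c:] dvd m" using c by (auto simp: m_def const_poly_dvd_iff)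
    show ?thesis
    proof (cases "degree b = 0")
      case True
      then have "b = m" by (auto simp: m_def monom_0 elim: degree_eq_zeroE)
      then show ?thesis using m by simp
    next
      case d: False
      have "degree (b - m) < degree b"
      proof (rule degree_lessI)
        show "\<forall>k\<ge>degree b. coeff (b - m) k = 0"
          by (auto simp: m_def coeff_eq_0)
      qed (use d in auto)
      moreover have "[:c:] dvd (b - m) * q"
        using less(2) m by (simp add: left_diff_distrib dvd_diff)
      ultimately have "[:c:] dvd b - m" by (rule less(1))
      then show ?thesis using m by (metis diff_add_cancel dvd_add)
    qed
  qed auto
qed

lemma (in leading_form) strict_sum:
  "(\<And>i. i \<in> A \<Longrightarrow> f i = 0 \<or> v (f i) < w) \<Longrightarrow> sum f A = 0 \<or> v (sum f A) < w"
proof (induction A rule: infinite_finite_induct)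
  case (insert i A)
  show ?case
  proof (cases "f i = 0 \<or> sum f A = 0")
    case True
    then show ?thesis using insert.hyps insert.IH insert.prems by (metis add.left_neutral add.right_neutral insertCI sum.insert)
  next
    case False
    define u where "u = max (v (f i)) (v (sum f A))"
    have "below v u (f i + sum f A)" by (rule below_add) (auto simp: below_def u_def)
    moreover have "u < w" using insert False by (auto simp: u_def)
    ultimately show ?thesis using insert by (auto simp: below_def)
  qed
qed auto

lemma (in leading_form) v_dominant:
  assumes "a \<noteq> 0" "b = 0 \<or> v b < v a"
  shows "a + b \<noteq> 0" "v (a + b) = v a"
  using v_add_less[of a "v b" b] assms by (auto simp: below_def)

lemma (in double_danielewski) span_of_sum:
  "(\<And>i. i \<in> A \<Longrightarrow> f i \<in> span_of W) \<Longrightarrow> sum f A \<in> span_of W"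
  by (induction A rule: infinite_finite_induct) (auto intro: span_of.zero span_of_add)

lemma rhom_fls_scalar: "rhom fls_scalar"
  by (simp add: rhom_def fls.\<kappa>_add fls.\<kappa>_mult)

section \<open>The embedding of the algebra into Laurent series\<close>

locale presentation =
  fixes d e :: nat and P :: "'k::field poly poly" and Q :: "'k poly poly poly"
  assumes d_pos: "d \<ge> 1" and e_pos: "e \<ge> 1"
    and P_monic: "Polynomial.lead_coeff P = 1" and Q_monic: "Polynomial.lead_coeff Q = 1"
    and P_deg: "degree P \<ge> 1" and Q_deg: "degree Q \<ge> 1"
begin

abbreviation "r \<equiv> degree P"
abbreviation "s \<equiv> degree Q"

abbreviation x :: "'k poly fls" where "x \<equiv> fls_X"
definition z :: "'k poly fls" where "z = fls_const [:0, 1:]"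
abbreviation ev_X where "ev_X \<equiv> eval_poly fls_scalar x"
abbreviation ev_Z where "ev_Z \<equiv> eval_poly ev_X z"
text \<open>The shift divides by \<open>x^d\<close>; in the same way \<open>t\<close> involves
  division by \<open>x^e\<close>.\<close>

definition y where "y = fls_shift (int d) (ev_Z P)"
abbreviation ev_Y where "ev_Y \<equiv> eval_poly ev_Z y"
definition t where "t = fls_shift (int e) (ev_Y Q)"
definition ev :: "'k poly poly poly poly \<Rightarrow> 'k poly fls" where "ev = eval_poly ev_Y t"

lemma rhom_ev: "rhom ev_X" "rhom ev_Z" "rhom ev_Y" "rhom ev"
  unfolding ev_def by (intro rhom_eval_poly rhom_fls_scalar)+

lemma x_y: "x ^ d * y = ev_Z P" and x_t: "x ^ e * t = ev_Y Q"
  by (simp_all add: y_def t_def fls_X_power_conv_shift_1 fls_times_both_shifted_simp)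

lemma z_nonzero [simp]: "z \<noteq> 0"
  by (simp add: z_def)

lemma val_x: "fls_val x = [:0, -1:]" and val_z: "fls_val z = [:1, 0:]"
  by (simp_all add: fls_val_def z_def)

lemma of_nat_linear: "of_nat n * [:a, b:] = [:of_nat n * a, of_nat n * b:]" for a b :: rat
  by (simp add: of_nat_poly)

lemma below_ev_X: "below fls_val [:0, 0:] (ev_X p)"
  unfolding eval_poly_sum[OF rhom_fls_scalar]
proof (rule fls.below_sum)
  fix i
  have "fls_val (x ^ i) = [:0, - of_nat i:]"
    unfolding fls.v_power[OF fls_X_nonzero] val_x of_nat_linear by simp
  then have "below fls_val [:0, 0:] (x ^ i)" by (auto simp: below_def linear_le_iff simp del: pCons_0_0)
  moreover have "below fls_val 0 (fls_scalar (coeff p i))"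
    using fls.v_\<kappa>[of "coeff p i"] by (cases "coeff p i = 0") (auto simp: below_def)
  ultimately have "below fls_val (0 + [:0, 0:]) (fls_scalar (coeff p i) * x ^ i)"
    by (intro fls.below_mult)
  then show "below fls_val [:0, 0:] (fls_scalar (coeff p i) * x ^ i)" by simp
qed

lemma below_ev_X_z: "below fls_val [:of_nat i, 0:] (ev_X p * z ^ i)"
proof -
  have "below fls_val ([:0, 0:] + of_nat i * [:1, 0:]) (ev_X p * z ^ i)"
    by (rule fls.below_mult[OF below_ev_X]) (simp add: below_def fls.v_power val_z)
  then show ?thesis unfolding of_nat_linear by simp
qed

lemma below_ev_Z: "below fls_val [:of_nat (degree q), 0:] (ev_Z q)"
  unfolding eval_poly_sum[OF rhom_ev(1)]
  by (rule fls.below_sum, rule fls.below_mono[OF below_ev_X_z]) (simp add: linear_le_iff del: pCons_0_0)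

lemma ev_Z_P: "ev_Z P = z ^ r + (\<Sum>i<r. ev_X (coeff P i) * z ^ i)"
  using P_monic by (simp add: eval_poly_sum[OF rhom_ev(1)] rhomD[OF rhom_ev(1)] flip: lessThan_Suc_atMost)

lemma ev_Y_Q: "ev_Y Q = y ^ s + (\<Sum>i<s. ev_Z (coeff Q i) * y ^ i)"
  using Q_monic by (simp add: eval_poly_sum[OF rhom_ev(2)] rhomD[OF rhom_ev(2)] flip: lessThan_Suc_atMost)

text \<open>The other terms of \<open>P(x,z)\<close> have nonnegative order in \<open>x\<close> and
  a smaller power of \<open>z\<close>, so \<open>z^r\<close> dominates; division by
  \<open>x^d\<close> then shifts the value.\<close>

lemma val_y: "y \<noteq> 0" "fls_val y = [:of_nat r, of_nat d:]"
proof -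
  define b where "b = (\<Sum>i<r. ev_X (coeff P i) * z ^ i)"
  have vz: "fls_val (z ^ r) = [:of_nat r, 0:]"
    unfolding fls.v_power[OF z_nonzero] val_z of_nat_linear by simp
  have "b = 0 \<or> fls_val b < fls_val (z ^ r)" unfolding b_def
  proof (rule fls.strict_sum)
    fix i assume "i \<in> {..<r}"
    then have "[:of_nat i, 0:] < fls_val (z ^ r)" unfolding vz linear_less_iff by simp
    then show "ev_X (coeff P i) * z ^ i = 0 \<or> fls_val (ev_X (coeff P i) * z ^ i) < fls_val (z ^ r)"
      using below_ev_X_z[of i "coeff P i"] by (auto simp: below_def)
  qed
  then have *: "ev_Z P \<noteq> 0" "fls_val (ev_Z P) = fls_val (z ^ r)"
    unfolding ev_Z_P b_def[symmetric] using fls.v_dominant[of "z ^ r" b] by auto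
  then show y0: "y \<noteq> 0" unfolding x_y[symmetric] by auto
  have xd: "x ^ d \<noteq> 0" by simp
  have eq: "of_nat d * fls_val x + fls_val y = [:of_nat r, 0:]"
    using * unfolding x_y[symmetric] vz by (simp add: fls.v_mult[OF xd y0] fls.v_power)
  have "fls_val y = (of_nat d * fls_val x + fls_val y) - of_nat d * fls_val x" by simp
  also have "\<dots> = [:of_nat r, 0:] - of_nat d * [:0, - 1:]" unfolding eq by (simp only: val_x)
  finally have "fls_val y = [:of_nat r, 0:] - of_nat d * [:0, - 1:]" .
  then show "fls_val y = [:of_nat r, of_nat d:]" unfolding of_nat_linear by simp
qed

lemma val_t: "t \<noteq> 0" "fls_val t = [:of_nat (r * s), of_nat (d * s + e):]"
proof -
  define b where "b = (\<Sum>i<s. ev_Z (coeff Q i) * y ^ i)"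
  have vy: "fls_val (y ^ i) = [:of_nat (r * i), of_nat (d * i):]" for i
    unfolding fls.v_power[OF val_y(1)] val_y of_nat_linear by (simp add: mult.commute)
  have "b = 0 \<or> fls_val b < fls_val (y ^ s)" unfolding b_def
  proof (rule fls.strict_sum)
    fix i assume i: "i \<in> {..<s}"
    let ?q = "coeff Q i"
    have "below fls_val ([:of_nat (degree ?q), 0:] + fls_val (y ^ i)) (ev_Z ?q * y ^ i)"
      by (rule fls.below_mult[OF below_ev_Z fls.below_refl])
    \<comment> \<open>Since \<open>d\<close> is positive, a lower power of \<open>y\<close> loses in
      the dominating coordinate, whatever the degree of its coefficient in \<open>Z\<close>.\<close>
    moreover have "d * i < d * s" using i d_pos by simp
    then have "(of_nat (d * i) :: rat) < of_nat (d * s)" by (simp only: of_nat_less_iff)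
    then have "[:of_nat (degree ?q), 0:] + fls_val (y ^ i) < fls_val (y ^ s)"
      unfolding vy by (simp add: linear_less_iff del: of_nat_mult)
    ultimately show "ev_Z ?q * y ^ i = 0 \<or> fls_val (ev_Z ?q * y ^ i) < fls_val (y ^ s)"
      by (auto simp: below_def)
  qed
  then have *: "ev_Y Q \<noteq> 0" "fls_val (ev_Y Q) = fls_val (y ^ s)"
    unfolding ev_Y_Q b_def[symmetric] using fls.v_dominant[of "y ^ s" b] val_y by auto
  then show t0: "t \<noteq> 0" unfolding x_t[symmetric] by auto
  have xe: "x ^ e \<noteq> 0" by simp
  have eq: "of_nat e * fls_val x + fls_val t = [:of_nat (r * s), of_nat (d * s):]"
    using * unfolding x_t[symmetric] vy by (simp add: fls.v_mult[OF xe t0] fls.v_power)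
  have "fls_val t = (of_nat e * fls_val x + fls_val t) - of_nat e * fls_val x" by simp
  also have "\<dots> = [:of_nat (r * s), of_nat (d * s):] - of_nat e * [:0, - 1:]" unfolding eq by (simp only: val_x)
  finally have "fls_val t = [:of_nat (r * s), of_nat (d * s):] - of_nat e * [:0, - 1:]" .
  then show "fls_val t = [:of_nat (r * s), of_nat (d * s + e):]" unfolding of_nat_linear by simp
qed

sublocale dd: double_danielewski fls_val fls_lc fls_scalar x z y t d e r s
proof
  fix a :: "'k poly fls"
  show "\<exists>J \<Omega>. fls_val a = [:of_nat J, of_int \<Omega>:]"
    unfolding fls_val_def by (metis of_int_minus)
qed (use val_y val_t val_x val_z P_deg Q_deg in \<open>simp_all\<close>)

lemma ev_X_span:
  assumes "\<And>a. W (fls_val (dd.mon a i j l))"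
  shows "ev_X p * dd.mon 0 i j l \<in> dd.span_of W"
  unfolding eval_poly_sum[OF rhom_fls_scalar] sum_distrib_right
proof (rule dd.span_of_sum)
  fix a
  have "fls_scalar (coeff p a) * x ^ a * dd.mon 0 i j l = fls_scalar (coeff p a) * dd.mon a i j l"
    by (simp add: dd.mon_def mult_ac)
  then show "fls_scalar (coeff p a) * x ^ a * dd.mon 0 i j l \<in> dd.span_of W"
    using dd.span_of_mon assms by metis
qed

lemma ev_Z_span:
  assumes "\<And>a i. W (fls_val (dd.mon a i j l))"
  shows "ev_Z p * dd.mon 0 0 j l \<in> dd.span_of W"
  unfolding eval_poly_sum[OF rhom_ev(1)] sum_distrib_right
proof (rule dd.span_of_sum)
  fix i
  have "ev_X (coeff p i) * z ^ i * dd.mon 0 0 j l = ev_X (coeff p i) * dd.mon 0 i j l"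
    by (simp add: dd.mon_def mult_ac)
  then show "ev_X (coeff p i) * z ^ i * dd.mon 0 0 j l \<in> dd.span_of W"
    using ev_X_span assms by metis
qed

text \<open>The comparison behind \<open>val_y\<close> and \<open>val_t\<close>, repeated for the
  individual monomials of the lower terms.\<close>

sublocale dd: double_danielewski_relations fls_val fls_lc fls_scalar x z y t d e r s
proof
  show "x ^ d * y - z ^ r \<in> dd.span_of (\<lambda>u. u < fls_val (z ^ r))"
    unfolding x_y ev_Z_P add_diff_cancel_left'
  proof (rule dd.span_of_sum)
    fix i assume i: "i \<in> {..<r}"
    have "fls_val (dd.mon a i 0 0) < fls_val (dd.mon 0 r 0 0)" for a
      unfolding dd.v_mon linear_less_iff using i by auto
    moreover have "dd.mon 0 r 0 0 = z ^ r" by (simp add: dd.mon_def)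
    ultimately have "ev_X (coeff P i) * dd.mon 0 i 0 0 \<in> dd.span_of (\<lambda>u. u < fls_val (z ^ r))"
      using ev_X_span[of "\<lambda>u. u < fls_val (z ^ r)"] by simp
    then show "ev_X (coeff P i) * z ^ i \<in> dd.span_of (\<lambda>u. u < fls_val (z ^ r))"
      by (simp add: dd.mon_def)
  qed
  show "x ^ e * t - y ^ s \<in> dd.span_of (\<lambda>u. u < fls_val (y ^ s))"
    unfolding x_t ev_Y_Q add_diff_cancel_left'
  proof (rule dd.span_of_sum)
    fix j assume j: "j \<in> {..<s}"
    have "int (d * j) < int (d * s)" using j d_pos by simp
    then have "int (d * j + (d * s + e) * 0) - int a < int (d * s + (d * s + e) * 0) - int 0" for a by linarith
    then have "fls_val (dd.mon a i j 0) < fls_val (dd.mon 0 0 s 0)" for a i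
      unfolding dd.v_mon linear_less_iff of_int_less_iff by blast
    moreover have "dd.mon 0 0 s 0 = y ^ s" by (simp add: dd.mon_def)
    ultimately have "ev_Z (coeff Q j) * dd.mon 0 0 j 0 \<in> dd.span_of (\<lambda>u. u < fls_val (y ^ s))"
      using ev_Z_span[of "\<lambda>u. u < fls_val (y ^ s)"] by simp
    then show "ev_Z (coeff Q j) * y ^ j \<in> dd.span_of (\<lambda>u. u < fls_val (y ^ s))"
      by (simp add: dd.mon_def)
  qed
qed

abbreviation "B \<equiv> dd.B"

lemma B_power: "a \<in> B \<Longrightarrow> a ^ n \<in> B"
  using dd.\<kappa>_in_span[of "\<lambda>_. True" 1] by (induction n) (auto intro: dd.B_times)

lemma eval_poly_in_B: "rhom h \<Longrightarrow> (\<And>a. h a \<in> B) \<Longrightarrow> c \<in> B \<Longrightarrow> eval_poly h c p \<in> B"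
  unfolding eval_poly_sum by (intro dd.span_of_sum dd.B_times B_power)

lemma ev_in_B: "ev_X p \<in> B" "ev_Z q \<in> B" "ev_Y q' \<in> B" "ev f \<in> B"
proof -
  show X: "ev_X p \<in> B" for p by (intro eval_poly_in_B rhom_fls_scalar dd.\<kappa>_in_span dd.gen_in_B TrueI)
  show Z: "ev_Z p \<in> B" for p by (intro eval_poly_in_B rhom_ev X dd.gen_in_B)
  show Y: "ev_Y p \<in> B" for p by (intro eval_poly_in_B rhom_ev Z dd.gen_in_B)
  show "ev p \<in> B" for p unfolding ev_def by (intro eval_poly_in_B rhom_ev Y dd.gen_in_B)
qed

lemma ev_gen: "ev (const4 c) = fls_scalar c" "ev var_X4 = x" "ev var_Y4 = y" "ev var_T4 = t"
    "ev [:[:[:0, 1:]:]:] = z" "ev [:[:G:]:] = ev_Z G" "ev [:q:] = ev_Y q"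
  by (simp_all add: ev_def const4_def var_X4_def var_Y4_def var_T4_def eval_poly_const eval_poly_var rhom_ev rhom_fls_scalar
      eval_poly_pCons rhomD(3,4)[OF rhom_ev(1)] rhomD(3,4)[OF rhom_ev(2)] rhomD(3,4)[OF rhom_ev(3)] rhomD(3,4)[OF rhom_fls_scalar])

lemma B_eq_range: "B = range ev"
proof
  show "range ev \<subseteq> B" using ev_in_B by blast
  show "B \<subseteq> range ev"
  proof
    fix b assume "b \<in> B"
    then show "b \<in> range ev"
    proof (induction rule: dd.span_of.induct)
      case zero
      then show ?case using rhomD(4)[OF rhom_ev(4)] by (metis rangeI)
    next
      case (add b a i j l c)
      then obtain f where "b = ev f" by blast
      then have "b + fls_scalar c * dd.mon a i j l =
        ev (f + const4 c * (var_X4 ^ a * [:[:[:0, 1:]:]:] ^ i * var_Y4 ^ j * var_T4 ^ l))"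
        by (simp only: rhomD[OF rhom_ev(4)] ev_gen(1-5) dd.mon_def)
      then show ?case by blast
    qed
  qed
qed

lemma fls_nth_scalar: "fls_nth (fls_scalar c) n = (if n = 0 then [:c:] else 0)"
  by (simp add: fls_scalar_def)

lemma fls_nth_ev_X: "fls_nth (ev_X p) n = (if n \<ge> 0 then [:coeff p (nat n):] else 0)"
proof (induction p arbitrary: n)
  case (pCons c p)
  have "nat n = Suc (nat (n - 1))" if "n > 0" using that by simp
  then show ?case
    by (auto simp: eval_poly_pCons rhom_fls_scalar fls_X_times_conv_shift pCons.IH fls_nth_scalar coeff_pCons
        split: nat.splits)
qed simp

text \<open>The coefficient of \<open>x^a z^j\<close> can be read off, so the embedding is injective
  on polynomials in \<open>X\<close> and \<open>Z\<close>.\<close>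

lemma coeff_fls_nth_ev_Z: "coeff (fls_nth (ev_Z G) (int a)) j = coeff (coeff G j) a"
proof (induction G arbitrary: j)
  case (pCons p G)
  then show ?case
    by (simp add: eval_poly_pCons rhom_ev z_def fls_nth_ev_X coeff_pCons split: nat.splits)
qed simp

lemma ev_Z_eq_0: "ev_Z G = 0 \<Longrightarrow> G = 0"
  using coeff_fls_nth_ev_Z by (metis coeff_0 fls_zero_nth poly_eqI)

end

section \<open>The kernel of the embedding\<close>

lemma map_poly_right_inverse:
  assumes "g 0 = 0" "h 0 = 0" "\<And>c. h (g c) = c"
  shows "map_poly h (map_poly g p) = p"
  by (rule poly_eqI) (simp add: coeff_map_poly assms)

definition at_X0 :: "'k::field poly poly poly poly \<Rightarrow> 'k poly poly poly" where
  "at_X0 = map_poly (map_poly (map_poly (\<lambda>p. coeff p 0)))"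

lemma rhom_at_X0: "rhom at_X0"
  unfolding at_X0_def by (intro rhom_map_poly rhom_coeff_0)

lemma at_X0_surj: "\<exists>C. at_X0 C = c"
proof -
  have "at_X0 (map_poly (map_poly (map_poly (\<lambda>c. [:c:]))) c) = c"
    unfolding at_X0_def by (intro map_poly_right_inverse) auto
  then show ?thesis by blast
qed

lemma coeff_at_X0: "coeff (coeff (coeff (at_X0 F) i) j) l = coeff (coeff (coeff (coeff F i) j) l) 0"
  by (simp add: at_X0_def coeff_map_poly)

lemma at_X0_eq_0: "at_X0 F = 0 \<Longrightarrow> var_X4 dvd F"
proof -
  assume "at_X0 F = 0"
  then have "coeff (coeff (coeff (coeff F i) j) l) 0 = 0" for i j l
    using coeff_at_X0 by (metis coeff_0)
  then have "[:0, 1:] dvd coeff (coeff (coeff F i) j) l" for i j l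
    by (metis dvdI mult_pCons_left pCons_cases coeff_pCons_0 add.left_neutral mult_1 smult_0_left one_pCons)
  then show ?thesis by (simp add: var_X4_def const_poly_dvd_iff)
qed

context presentation
begin

definition "rel1 = var_X4 ^ d * var_Y4 - [:[:P:]:]"
definition "rel2 = var_X4 ^ e * var_T4 - [:Q:]"
definition "ker_B = {A * rel1 + C * rel2 | A C. True}"

lemma ev_rel: "ev rel1 = 0" "ev rel2 = 0"
  unfolding rel1_def rel2_def rhomD[OF rhom_ev(4)]
  by (simp_all only: ev_gen(1-6) x_y diff_self) (simp only: ev_gen(1-5,7) x_t diff_self)

lemma ev_ker: "F \<in> ker_B \<Longrightarrow> ev F = 0"
  by (auto simp: ker_B_def rhomD[OF rhom_ev(4)] ev_rel)

lemma ker_add: "F \<in> ker_B \<Longrightarrow> G \<in> ker_B \<Longrightarrow> F + G \<in> ker_B"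
proof -
  assume "F \<in> ker_B" "G \<in> ker_B"
  then obtain A C A' C' where "F = A * rel1 + C * rel2" "G = A' * rel1 + C' * rel2"
    by (auto simp: ker_B_def)
  then have "F + G = (A + A') * rel1 + (C + C') * rel2" by (simp add: algebra_simps)
  then show ?thesis unfolding ker_B_def by blast
qed

lemma ker_mult: "F \<in> ker_B \<Longrightarrow> G * F \<in> ker_B"
proof -
  assume "F \<in> ker_B"
  then obtain A C where "F = A * rel1 + C * rel2" by (auto simp: ker_B_def)
  then have "G * F = (G * A) * rel1 + (G * C) * rel2" by (simp add: algebra_simps)
  then show ?thesis unfolding ker_B_def by blast
qed

lemma rel_in_ker: "rel1 \<in> ker_B" "rel2 \<in> ker_B"
proof -
  have "rel1 = 1 * rel1 + 0 * rel2" "rel2 = 0 * rel1 + 1 * rel2" by simp_all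
  then show "rel1 \<in> ker_B" "rel2 \<in> ker_B" unfolding ker_B_def by blast+
qed

lemma ker_uminus: "F \<in> ker_B \<Longrightarrow> - F \<in> ker_B"
  using ker_mult[of F "- 1"] by simp

definition P0 where "P0 = map_poly (\<lambda>p. coeff p 0) P"
definition Q0 where "Q0 = map_poly (map_poly (\<lambda>p. coeff p 0)) Q"

lemma at_X0_rel: "at_X0 rel1 = - [:[:P0:]:]" "at_X0 rel2 = - [:Q0:]"
proof -
  have X: "at_X0 var_X4 = 0" by (simp add: at_X0_def var_X4_def map_poly_pCons)
  have "at_X0 [:[:P:]:] = [:[:P0:]:]" "at_X0 [:Q:] = [:Q0:]"
    by (simp_all add: at_X0_def P0_def Q0_def map_poly_pCons)
  then show "at_X0 rel1 = - [:[:P0:]:]" "at_X0 rel2 = - [:Q0:]"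
    using d_pos e_pos by (simp_all add: rel1_def rel2_def rhomD[OF rhom_at_X0] X power_0_left)
qed

lemma P0_nonzero: "P0 \<noteq> 0"
proof -
  have "coeff P0 r = 1" using P_monic by (simp add: P0_def coeff_map_poly)
  then show ?thesis by auto
qed

lemma Q0_monic: "Polynomial.lead_coeff Q0 = 1"
proof -
  have 1: "map_poly (\<lambda>p::'k poly. coeff p 0) 1 = 1" by (simp add: one_pCons map_poly_pCons)
  have "coeff Q0 s = 1" using Q_monic by (simp add: Q0_def coeff_map_poly 1)
  moreover have "degree Q0 \<le> s" unfolding Q0_def by (rule degree_le) (simp add: coeff_map_poly coeff_eq_0)
  ultimately have "degree Q0 = s" using le_degree[of Q0 s] by simp
  then show ?thesis using \<open>coeff Q0 s = 1\<close> by simp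
qed

text \<open>\<open>x\<close> is no zero divisor modulo the relations, since the leading coefficient 1 of \<open>Q(0,Y,Z)\<close> makes
  \<open>P(0,Z), Q(0,Y,Z)\<close> a regular sequence.\<close>

lemma X_cancel:
  assumes "var_X4 * F \<in> ker_B"
  shows "F \<in> ker_B"
proof -
  obtain A C where AC: "var_X4 * F = A * rel1 + C * rel2" using assms by (auto simp: ker_B_def)
  have X: "at_X0 var_X4 = 0" by (simp add: at_X0_def var_X4_def map_poly_pCons)
  \<comment> \<open>Setting \<open>X = 0\<close> leaves a syzygy between \<open>P(0,Z)\<close> and
    \<open>Q(0,Y,Z)\<close>.\<close>
  have eq: "at_X0 A * [:[:P0:]:] = - (at_X0 C * [:Q0:])"
  proof -
    have "0 = at_X0 A * (- [:[:P0:]:]) + at_X0 C * (- [:Q0:])"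
      using arg_cong[OF AC, of at_X0] by (simp only: rhomD[OF rhom_at_X0] X at_X0_rel mult_zero_left)
    then show ?thesis by (metis add_eq_0_iff minus_mult_right minus_minus)
  qed
  have "[:[:P0:]:] dvd at_X0 C * [:Q0:]"
    using eq by (metis dvd_minus_iff dvd_triv_right)
  then have "[:P0:] dvd coeff (at_X0 C) n * Q0" for n
    by (simp add: const_poly_dvd_iff[of "[:P0:]"] mult.commute)
  then have "[:P0:] dvd coeff (at_X0 C) n" for n
    using const_dvd_mult_monic Q0_monic by blast
  then have "[:[:P0:]:] dvd at_X0 C" by (simp add: const_poly_dvd_iff)
  then obtain c where c: "at_X0 C = [:[:P0:]:] * c" by (auto elim: dvdE)
  have "[:[:P0:]:] * at_X0 A = [:[:P0:]:] * (- (c * [:Q0:]))"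
    using eq c by (simp only: mult_ac mult_minus_right)
  then have a: "at_X0 A = - (c * [:Q0:])" using P0_nonzero by (subst (asm) mult_left_cancel) auto
  \<comment> \<open>The syzygy is \<open>c\<close> times the Koszul one. Lifting \<open>c\<close>
    and subtracting the corresponding trivial syzygy of \<open>rel1\<close> and \<open>rel2\<close>
    makes both coefficients vanish at \<open>X = 0\<close>.\<close>
  obtain D where D: "at_X0 D = c" using at_X0_surj by blast
  have "at_X0 (A - D * rel2) = 0" "at_X0 (C + D * rel1) = 0"
    by (simp_all only: rhomD[OF rhom_at_X0] a c D at_X0_rel mult_minus_right diff_self
        mult.commute[of c "[:[:P0:]:]"] right_minus)
  then obtain A' C' where A': "A - D * rel2 = var_X4 * A'" and C': "C + D * rel1 = var_X4 * C'"
    using at_X0_eq_0 by (metis dvdE)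
  have "var_X4 * F = (A - D * rel2) * rel1 + (C + D * rel1) * rel2"
    unfolding AC by (simp add: algebra_simps)
  also have "\<dots> = var_X4 * (A' * rel1 + C' * rel2)" unfolding A' C' by (simp add: algebra_simps)
  finally have "var_X4 * F = var_X4 * (A' * rel1 + C' * rel2)" .
  moreover have "var_X4 \<noteq> (0 :: 'k poly poly poly poly)" by (simp add: var_X4_def)
  ultimately have "F = A' * rel1 + C' * rel2" by (metis mult_left_cancel)
  then show ?thesis unfolding ker_B_def by blast
qed

lemma X_power_cancel: "var_X4 ^ n * F \<in> ker_B \<Longrightarrow> F \<in> ker_B"
  by (induction n) (auto simp: mult.assoc intro: X_cancel)

definition const2 :: "'k poly poly \<Rightarrow> 'k poly poly poly poly" where "const2 G = [:[:G:]:]"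

lemma rhom_const2: "rhom const2"
  by (simp add: rhom_def const2_def one_pCons)

lemma var_X4_const2: "var_X4 = const2 [:[:0, 1:]:]"
  by (simp add: const2_def var_X4_def)

lemma ev_const2: "ev (const2 G) = ev_Z G"
  unfolding const2_def by (rule ev_gen(6))

text \<open>Modulo the relations, a power of \<open>X\<close> turns \<open>F\<close> into a
  polynomial in \<open>X\<close> and \<open>Z\<close>, where the embedding is known to be
  injective.\<close>

definition clears where "clears F \<longleftrightarrow> (\<exists>K G. var_X4 ^ K * F - const2 G \<in> ker_B)"

lemma clears_add: "clears F \<Longrightarrow> clears F' \<Longrightarrow> clears (F + F')"
proof -
  assume "clears F" "clears F'"
  then obtain K G K' G' where 1: "var_X4 ^ K * F - const2 G \<in> ker_B" "var_X4 ^ K' * F' - const2 G' \<in> ker_B"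
    unfolding clears_def by blast
  have "var_X4 ^ K' * (var_X4 ^ K * F - const2 G) + var_X4 ^ K * (var_X4 ^ K' * F' - const2 G') \<in> ker_B"
    by (intro ker_add ker_mult 1)
  moreover have "var_X4 ^ K' * (var_X4 ^ K * F - const2 G) + var_X4 ^ K * (var_X4 ^ K' * F' - const2 G') =
      var_X4 ^ (K + K') * (F + F') - const2 ([:[:0, 1:]:] ^ K' * G + [:[:0, 1:]:] ^ K * G')"
    unfolding rhomD[OF rhom_const2] var_X4_const2[symmetric] by (simp add: algebra_simps power_add)
  ultimately show ?thesis unfolding clears_def by metis
qed

lemma clears_mult: "clears F \<Longrightarrow> clears F' \<Longrightarrow> clears (F * F')"
proof -
  assume "clears F" "clears F'"
  then obtain K G K' G' where 1: "var_X4 ^ K * F - const2 G \<in> ker_B" "var_X4 ^ K' * F' - const2 G' \<in> ker_B"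
    unfolding clears_def by blast
  have "(var_X4 ^ K' * F') * (var_X4 ^ K * F - const2 G) + const2 G * (var_X4 ^ K' * F' - const2 G') \<in> ker_B"
    by (intro ker_add ker_mult 1)
  moreover have "(var_X4 ^ K' * F') * (var_X4 ^ K * F - const2 G) + const2 G * (var_X4 ^ K' * F' - const2 G') =
      var_X4 ^ (K + K') * (F * F') - const2 (G * G')"
    unfolding rhomD[OF rhom_const2] by (simp add: algebra_simps power_add)
  ultimately show ?thesis unfolding clears_def by metis
qed

lemma clears_const: "clears (const2 G)"
proof -
  have "var_X4 ^ 0 * const2 G - const2 G \<in> ker_B" using ker_mult[OF rel_in_ker(1), of 0] by simp
  then show ?thesis unfolding clears_def by blast
qed

lemma clears_Y: "clears var_Y4"
  using rel_in_ker(1) unfolding rel1_def clears_def const2_def by blast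

lemma clears_poly3: "clears [:q:]"
proof (induction q)
  case 0
  then show ?case using clears_const[of 0] by (simp add: const2_def)
next
  case (pCons g q)
  have "[:pCons g q:] = const2 g + var_Y4 * [:q:]" by (simp add: var_Y4_def const2_def)
  also have "clears \<dots>" by (intro clears_add clears_mult clears_const clears_Y pCons.IH)
  finally show ?case .
qed

lemma clears_T: "clears var_T4"
proof -
  obtain K G where "var_X4 ^ K * [:Q:] - const2 G \<in> ker_B" using clears_poly3 unfolding clears_def by blast
  then have "var_X4 ^ K * rel2 + (var_X4 ^ K * [:Q:] - const2 G) \<in> ker_B"
    by (intro ker_add ker_mult rel_in_ker)
  moreover have "var_X4 ^ K * rel2 + (var_X4 ^ K * q - c) = var_X4 ^ (K + e) * var_T4 - c" if "rel2 = var_X4 ^ e * var_T4 - q" for q c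
    unfolding that by (simp add: power_add algebra_simps)
  ultimately have "var_X4 ^ (K + e) * var_T4 - const2 G \<in> ker_B"
    unfolding rel2_def by metis
  then show ?thesis unfolding clears_def by blast
qed

lemma clears_all: "clears F"
proof (induction F)
  case 0
  then show ?case using clears_const[of 0] by (simp add: const2_def)
next
  case (pCons q F)
  have "pCons q F = [:q:] + var_T4 * F" by (simp add: var_T4_def)
  also have "clears \<dots>" by (intro clears_add clears_mult clears_poly3 clears_T pCons.IH)
  finally show ?case .
qed

text \<open>After clearing denominators the resulting \<open>G\<close> maps to 0 and hence vanishes;
  then the power of \<open>X\<close> is cancelled modulo the relations.\<close>

lemma ev_eq_0_iff: "ev F = 0 \<longleftrightarrow> F \<in> ker_B"
proof
  assume F: "ev F = 0"
  obtain K G where KG: "var_X4 ^ K * F - const2 G \<in> ker_B" using clears_all unfolding clears_def by blast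
  have "ev (var_X4 ^ K * F) - ev (const2 G) = 0" using ev_ker[OF KG] rhomD(6)[OF rhom_ev(4)] by simp
  then have "ev_Z G = 0" using F rhomD(2)[OF rhom_ev(4)] ev_gen by (simp add: ev_const2)
  then have "G = 0" by (rule ev_Z_eq_0)
  then show "F \<in> ker_B" using KG X_power_cancel rhomD(4)[OF rhom_const2] by simp
qed (rule ev_ker)

lemma clear_denominators:
  assumes "b \<in> B"
  obtains K G where "x ^ K * b = ev_Z G"
proof -
  obtain F where F: "b = ev F" using assms B_eq_range by auto
  obtain K G where KG: "var_X4 ^ K * F - const2 G \<in> ker_B" using clears_all unfolding clears_def by blast
  have "ev (var_X4 ^ K * F) - ev (const2 G) = 0" using ev_ker[OF KG] rhomD(6)[OF rhom_ev(4)] by simp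
  then have "x ^ K * b = ev_Z G" using F rhomD(2,7)[OF rhom_ev(4)] ev_gen by (simp add: ev_const2)
  then show ?thesis using that by blast
qed

end

section \<open>Exponential maps on a commutative ring in terms of coefficients\<close>

context cring
begin

lemma UP_coeff: "p \<in> carrier (UP R) \<Longrightarrow> up_ring.coeff (UP R) p n = p n"
  by (simp add: UP_def)

lemma UP_monom: "c \<in> carrier R \<Longrightarrow> up_ring.monom (UP R) c k = (\<lambda>n. if n = k then c else \<zero>)"
  by (auto simp: UP_def)

lemma UP_add: "p \<in> carrier (UP R) \<Longrightarrow> q \<in> carrier (UP R) \<Longrightarrow> (p \<oplus>\<^bsub>UP R\<^esub> q) n = p n \<oplus> q n"
  by (simp add: UP_def)

lemma UP_mult: "p \<in> carrier (UP R) \<Longrightarrow> q \<in> carrier (UP R) \<Longrightarrow>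
    (p \<otimes>\<^bsub>UP R\<^esub> q) n = (\<Oplus>i\<in>{..n}. p i \<otimes> q (n - i))"
  by (simp add: UP_def)

lemma UP_one: "\<one>\<^bsub>UP R\<^esub> = (\<lambda>n. if n = 0 then \<one> else \<zero>)"
  by (simp add: UP_def)

interpretation U: UP_cring R "UP R" by unfold_locales simp
interpretation UU: UP_cring "UP R" "UP (UP R)" by unfold_locales simp

lemma UP_closed: "p \<in> carrier (UP R) \<Longrightarrow> p n \<in> carrier R"
  using U.coeff_closed[of p n] by (simp add: UP_coeff)

lemma UP_deg_above: "p \<in> carrier (UP R) \<Longrightarrow> deg R p < n \<Longrightarrow> p n = \<zero>"
  using U.deg_aboveD[of p n] by (simp add: UP_coeff)

lemma finsum_delta:
  assumes "finite A" "\<And>i. i \<in> A \<Longrightarrow> f i \<in> carrier R"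
  shows "(\<Oplus>i\<in>A. if i = n then f i else \<zero>) = (if n \<in> A then f n else \<zero>)"
proof (cases "n \<in> A")
  case True
  have "(\<Oplus>i\<in>A. if i = n then f i else \<zero>) = (\<Oplus>i\<in>A. if n = i then f i else \<zero>)"
    by (rule finsum_cong') (use assms in auto)
  then show ?thesis using finsum_singleton[of n A f] True assms by auto
next
  case False
  have "(\<Oplus>i\<in>A. if i = n then f i else \<zero>) = (\<Oplus>i\<in>A. \<zero>)"
    by (rule finsum_cong') (use False in auto)
  then show ?thesis using False by simp
qed

lemma eval_at_zero:
  assumes p: "p \<in> carrier (UP R)"
  shows "UnivPoly.eval R R (\<lambda>c. c) \<zero> p = p 0"
proof -
  have "UnivPoly.eval R R (\<lambda>c. c) \<zero> p = (\<Oplus>i\<in>{..deg R p}. if i = 0 then p i else \<zero>)"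
    unfolding U.eval_on_carrier[OF p]
    by (rule finsum_cong') (use p in \<open>auto simp: UP_coeff UP_closed nat_pow_zero\<close>)
  then show ?thesis using p by (simp add: finsum_delta UP_closed)
qed

text \<open>The outer index is the exponent of \<open>U\<close> and the coefficients are polynomials
  in \<open>V\<close>, so the extension applies \<open>\<phi>\<close> to each coefficient.\<close>

lemma extend_V_nth:
  assumes \<phi>: "\<phi> \<in> ring_hom R (UP R)" and p: "p \<in> carrier (UP R)"
  shows "extend_V R \<phi> p \<in> carrier (UP (UP R))" "extend_V R \<phi> p n = \<phi> (p n)"
proof -
  have closed: "\<phi> (p i) \<in> carrier (UP R)" for i
    using ring_hom_closed[OF \<phi>] UP_closed[OF p] by blast
  have "extend_V R \<phi> p = (\<Oplus>\<^bsub>UP (UP R)\<^esub>i\<in>{..deg R p}. up_ring.monom (UP (UP R)) (\<phi> (p i)) i)"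
    unfolding extend_V_def U.eval_on_carrier[OF p]
  proof (rule UU.P.finsum_cong'; (simp add: closed)?)
    fix i
    have "var_U R [^]\<^bsub>UP (UP R)\<^esub> i = up_ring.monom (UP (UP R)) \<one>\<^bsub>UP R\<^esub> i"
      unfolding var_U_def by (subst UU.monom_pow) auto
    then show "up_ring.monom (UP (UP R)) (\<phi> (up_ring.coeff (UP R) p i)) 0 \<otimes>\<^bsub>UP (UP R)\<^esub> var_U R [^]\<^bsub>UP (UP R)\<^esub> i =
        up_ring.monom (UP (UP R)) (\<phi> (p i)) i"
      using UU.monom_mult[OF closed[of i] U.UP_one_closed, of 0 i] closed by (simp add: UP_coeff[OF p])
  qed
  note eq = this
  show c: "extend_V R \<phi> p \<in> carrier (UP (UP R))" unfolding eq by (rule UU.P.finsum_closed) (auto simp: closed)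
  have "extend_V R \<phi> p n = up_ring.coeff (UP (UP R)) (extend_V R \<phi> p) n"
    using cring.UP_coeff[OF U.UP_cring c] by simp
  also have "\<dots> = (\<Oplus>\<^bsub>UP R\<^esub>i\<in>{..deg R p}. if i = n then \<phi> (p i) else \<zero>\<^bsub>UP R\<^esub>)"
    unfolding eq by (subst UU.coeff_finsum) (auto simp: closed intro!: U.P.finsum_cong')
  also have "\<dots> = (if n \<in> {..deg R p} then \<phi> (p n) else \<zero>\<^bsub>UP R\<^esub>)"
    using cring.finsum_delta[OF U.UP_cring, of "{..deg R p}" "\<lambda>i. \<phi> (p i)"] closed by simp
  also have "\<dots> = \<phi> (p n)"
    using UP_deg_above[OF p, of n] ring_hom_zero[OF \<phi> ring_axioms U.UP_ring] by auto
  finally show "extend_V R \<phi> p n = \<phi> (p n)" .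
qed

lemma coeff_var_mult:
  assumes "q \<in> carrier (UP R)"
  shows "up_ring.coeff (UP R) (up_ring.monom (UP R) \<one> 1 \<otimes>\<^bsub>UP R\<^esub> q) n =
     (if n = 0 then \<zero> else up_ring.coeff (UP R) q (n - 1))"
proof (cases n)
  case 0
  then show ?thesis using assms by simp
next
  case (Suc m)
  then show ?thesis using U.coeff_monom_mult[OF one_closed assms, of 1 m] assms by simp
qed

lemma coeff_const_mult:
  assumes "q \<in> carrier (UP R)" "c \<in> carrier R"
  shows "up_ring.coeff (UP R) (up_ring.monom (UP R) c 0 \<otimes>\<^bsub>UP R\<^esub> q) n = c \<otimes> up_ring.coeff (UP R) q n"
  using U.coeff_monom_mult[OF assms(2,1), of 0 n] by simp

abbreviation coeff2 where
  "coeff2 q n m \<equiv> up_ring.coeff (UP R) (up_ring.coeff (UP (UP R)) q n) m"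

lemma var_closed: "var_U R \<in> carrier (UP (UP R))" "var_V R \<in> carrier (UP (UP R))"
  by (auto simp: var_U_def var_V_def)

text \<open>The binomial theorem, with \<open>n\<close> the exponent of \<open>U\<close> and
  \<open>m\<close> that of \<open>V\<close>: a further factor raises one of them, and Pascal's rule
  adds the two contributions.\<close>

lemma coeff2_V_plus_U_power:
  "coeff2 ((var_V R \<oplus>\<^bsub>UP (UP R)\<^esub> var_U R) [^]\<^bsub>UP (UP R)\<^esub> k) n m =
     (if n + m = k then add_pow R (k choose n) (\<one>) else \<zero>)"
proof (induction k arbitrary: n m)
  case 0
  then show ?case by simp
next
  case (Suc k)
  let ?q = "(var_V R \<oplus>\<^bsub>UP (UP R)\<^esub> var_U R) [^]\<^bsub>UP (UP R)\<^esub> k"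
  have q: "?q \<in> carrier (UP (UP R))" using var_closed by simp
  have qn: "up_ring.coeff (UP (UP R)) ?q n \<in> carrier (UP R)" for n using q by simp
  have "(var_V R \<oplus>\<^bsub>UP (UP R)\<^esub> var_U R) [^]\<^bsub>UP (UP R)\<^esub> Suc k =
      var_V R \<otimes>\<^bsub>UP (UP R)\<^esub> ?q \<oplus>\<^bsub>UP (UP R)\<^esub> var_U R \<otimes>\<^bsub>UP (UP R)\<^esub> ?q"
    using var_closed q by (simp add: UU.P.l_distr UU.P.m_comm[OF q])
  then have "coeff2 ((var_V R \<oplus>\<^bsub>UP (UP R)\<^esub> var_U R) [^]\<^bsub>UP (UP R)\<^esub> Suc k) n m =
      (if m = 0 then \<zero> else coeff2 ?q n (m - 1)) \<oplus> (if n = 0 then \<zero> else coeff2 ?q (n - 1) m)"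
    using var_closed q qn
      cring.coeff_const_mult[OF U.UP_cring q U.monom_closed[OF one_closed, of 1], of n]
      cring.coeff_var_mult[OF U.UP_cring q, of n]
      coeff_var_mult[OF qn[of n], of m]
    by (simp add: var_V_def var_U_def del: UU.coeff_mult U.coeff_mult)
  also have "\<dots> = (if n + m = Suc k then add_pow R (Suc k choose n) (\<one>) else \<zero>)"
    unfolding Suc.IH
    by (cases n; cases m) (auto simp: add.nat_pow_mult a_comm)
  finally show ?case .
qed

lemma subst_V_plus_U_nth:
  assumes p: "p \<in> carrier (UP R)"
  shows "subst_V_plus_U R p \<in> carrier (UP (UP R))"
    "subst_V_plus_U R p n m = add_pow R ((n + m) choose n) (p (n + m))"
proof -
  let ?W = "var_V R \<oplus>\<^bsub>UP (UP R)\<^esub> var_U R"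
  let ?t = "\<lambda>i. up_ring.monom (UP (UP R)) (up_ring.monom (UP R) (p i) 0) 0 \<otimes>\<^bsub>UP (UP R)\<^esub> ?W [^]\<^bsub>UP (UP R)\<^esub> i"
  have W: "?W [^]\<^bsub>UP (UP R)\<^esub> i \<in> carrier (UP (UP R))" for i :: nat
    using var_closed by simp
  have t: "?t i \<in> carrier (UP (UP R))" for i using W UP_closed[OF p] by simp
  have eq: "subst_V_plus_U R p = (\<Oplus>\<^bsub>UP (UP R)\<^esub>i\<in>{..deg R p}. ?t i)"
    unfolding subst_V_plus_U_def U.eval_on_carrier[OF p] by (simp add: UP_coeff[OF p])
  show c: "subst_V_plus_U R p \<in> carrier (UP (UP R))" unfolding eq by (rule UU.P.finsum_closed) (use t in auto)
  have tc: "coeff2 (?t i) n m = (if i = n + m then add_pow R (i choose n) (p i) else \<zero>)" for i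
  proof -
    have pi: "p i \<in> carrier R" by (rule UP_closed[OF p])
    have "coeff2 (?t i) n m = p i \<otimes> coeff2 (?W [^]\<^bsub>UP (UP R)\<^esub> i) n m"
      using cring.coeff_const_mult[OF U.UP_cring W[of i] U.monom_closed[OF pi, of 0], of n]
        coeff_const_mult[OF UU.coeff_closed[OF W[of i]] pi] by (simp del: UU.coeff_mult U.coeff_mult)
    also have "\<dots> = (if i = n + m then add_pow R (i choose n) (p i) else \<zero>)"
      unfolding coeff2_V_plus_U_power using pi add_pow_rdistr[of "p i" \<one> "i choose n"] by auto
    finally show ?thesis .
  qed
  have cn: "up_ring.coeff (UP (UP R)) (subst_V_plus_U R p) n \<in> carrier (UP R)" using c by simp
  have "subst_V_plus_U R p n m = coeff2 (subst_V_plus_U R p) n m"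
    using cring.UP_coeff[OF U.UP_cring c] UP_coeff[OF cn] by simp
  also have "\<dots> = (\<Oplus>i\<in>{..deg R p}. coeff2 (?t i) n m)"
    unfolding eq using t by (subst UU.coeff_finsum; (subst U.coeff_finsum)?; auto simp del: UU.coeff_mult U.coeff_mult)
  also have "\<dots> = (\<Oplus>i\<in>{..deg R p}. if i = n + m then add_pow R (i choose n) (p i) else \<zero>)"
    unfolding tc ..
  also have "\<dots> = (if n + m \<in> {..deg R p} then add_pow R ((n + m) choose n) (p (n + m)) else \<zero>)"
    by (rule finsum_delta) (auto simp: UP_closed[OF p])
  also have "\<dots> = add_pow R ((n + m) choose n) (p (n + m))" using UP_deg_above[OF p, of "n + m"] by auto
  finally show "subst_V_plus_U R p n m = add_pow R ((n + m) choose n) (p (n + m))" .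
qed

text \<open>Comparing coefficients at \<open>U^i V^j\<close> turns condition (ii) into the
  composition rule of an iterative higher derivation.\<close>

lemma exponential_map_iff:
  assumes K: "K \<subseteq> carrier R"
  shows "exponential_map K R \<phi> \<longleftrightarrow> \<phi> \<in> ring_hom R (UP R) \<and>
    (\<forall>c\<in>K. \<forall>i>0. \<phi> c i = \<zero>) \<and> (\<forall>a\<in>carrier R. \<phi> a 0 = a) \<and>
    (\<forall>a\<in>carrier R. \<forall>i j. \<phi> (\<phi> a i) j = add_pow R ((i + j) choose i) (\<phi> a (i + j)))"
proof (cases "\<phi> \<in> ring_hom R (UP R)")
  case True
  have closed: "\<phi> a \<in> carrier (UP R)" if "a \<in> carrier R" for a using ring_hom_closed[OF True that] .
  have 1: "(\<forall>a\<in>carrier R. UnivPoly.eval R R (\<lambda>c. c) \<zero> (\<phi> a) = a) \<longleftrightarrow> (\<forall>a\<in>carrier R. \<phi> a 0 = a)"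
    using eval_at_zero[OF closed] by simp
  have 2: "extend_V R \<phi> (\<phi> a) = subst_V_plus_U R (\<phi> a) \<longleftrightarrow> (\<forall>i j. \<phi> (\<phi> a i) j = add_pow R ((i + j) choose i) (\<phi> a (i + j)))"
    if "a \<in> carrier R" for a
    unfolding fun_eq_iff extend_V_nth[OF True closed[OF that]] subst_V_plus_U_nth[OF closed[OF that]] ..
  have 3: "(\<forall>c\<in>K. \<phi> c = up_ring.monom (UP R) c 0) \<longleftrightarrow> (\<forall>c\<in>K. \<forall>i>0. \<phi> c i = \<zero>)"
    if "\<forall>a\<in>carrier R. \<phi> a 0 = a"
    using that K by (auto simp: UP_monom subset_iff fun_eq_iff)
  show ?thesis unfolding exponential_map_def alg_hom_UP_def 1 using True 2 3 by auto
qed (auto simp: exponential_map_def alg_hom_UP_def)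

end

section \<open>The quotient ring as the image of the embedding\<close>

context presentation
begin

abbreviation "R4 \<equiv> (ring_of_type_algebra :: 'k poly_XZYT ring)"
abbreviation "A \<equiv> ring_B d e P Q"
abbreviation "cls \<equiv> class_B d e P Q"

lemma R4_cring: "cring R4"
  by (rule cring_from_type_algebra)

lemma R4_simps: "carrier R4 = UNIV" "a \<otimes>\<^bsub>R4\<^esub> b = a * b" "a \<oplus>\<^bsub>R4\<^esub> b = a + b" "\<one>\<^bsub>R4\<^esub> = 1" "\<zero>\<^bsub>R4\<^esub> = 0"
  by (simp_all add: ring_of_type_algebra_def)

lemma R4_minus: "\<ominus>\<^bsub>R4\<^esub> a = - a"
proof -
  interpret cring R4 by (rule R4_cring)
  show ?thesis by (rule minus_equality) (simp_all add: R4_simps)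
qed

lemma ker_B_ideal: "ideal ker_B R4"
proof (rule idealI)
  interpret cring R4 by (rule R4_cring)
  show "ring R4" by (rule ring_axioms)
  show "subgroup ker_B (add_monoid R4)"
  proof
    show "inv\<^bsub>add_monoid R4\<^esub> f \<in> ker_B" if "f \<in> ker_B" for f
      using ker_uminus[OF that] R4_minus unfolding a_inv_def by metis
  qed (use ker_add ker_mult[OF rel_in_ker(1), of 0] in \<open>simp_all add: R4_simps\<close>)
qed (use ker_mult in \<open>auto simp: R4_simps mult.commute\<close>)

lemma ideal_B_eq: "ideal_B d e P Q = ker_B"
proof
  interpret cring R4 by (rule R4_cring)
  let ?S = "{var_X4 ^ d * var_Y4 - [:[:P:]:], var_X4 ^ e * var_T4 - [:Q:]}"
  have S: "?S = {rel1, rel2}" by (simp add: rel1_def rel2_def)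
  show "ideal_B d e P Q \<subseteq> ker_B"
    unfolding ideal_B_def S by (rule genideal_minimal[OF ker_B_ideal]) (use rel_in_ker in auto)
  have *: "ideal (ideal_B d e P Q) R4" unfolding ideal_B_def by (rule genideal_ideal) (simp add: R4_simps)
  interpret I: ideal "ideal_B d e P Q" R4 by (rule *)
  have rel: "rel1 \<in> ideal_B d e P Q" "rel2 \<in> ideal_B d e P Q"
    unfolding ideal_B_def S using genideal_self[of "{rel1, rel2}"] by (auto simp: R4_simps)
  show "ker_B \<subseteq> ideal_B d e P Q"
  proof
    fix F assume "F \<in> ker_B"
    then obtain G H where F: "F = G * rel1 + H * rel2" by (auto simp: ker_B_def)
    have "G \<otimes>\<^bsub>R4\<^esub> rel1 \<oplus>\<^bsub>R4\<^esub> H \<otimes>\<^bsub>R4\<^esub> rel2 \<in> ideal_B d e P Q"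
      by (intro I.a_closed I.I_l_closed rel) (simp_all add: R4_simps)
    then show "F \<in> ideal_B d e P Q" by (simp add: F R4_simps)
  qed
qed

lemma A_eq: "A = R4 Quot ker_B"
  by (simp add: ring_B_def ideal_B_eq)

lemma A_cring: "cring A"
  unfolding A_eq by (rule ideal.quotient_is_cring[OF ker_B_ideal R4_cring])

lemma cls_hom: "cls \<in> ring_hom R4 A"
  using ideal.rcos_ring_hom[OF ker_B_ideal] unfolding A_eq class_B_def ideal_B_eq by simp

lemma cls_simps: "cls f \<in> carrier A" "cls (f + g) = cls f \<oplus>\<^bsub>A\<^esub> cls g" "cls (f * g) = cls f \<otimes>\<^bsub>A\<^esub> cls g" "cls 1 = \<one>\<^bsub>A\<^esub>"
  using ring_hom_closed[OF cls_hom, of f] ring_hom_add[OF cls_hom, of f g] ring_hom_mult[OF cls_hom, of f g] ring_hom_one[OF cls_hom]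
  by (simp_all add: R4_simps)

lemma carrier_A: "carrier A = range cls"
  unfolding A_eq FactRing_def class_B_def ideal_B_eq A_RCOSETS_def' by (auto simp: R4_simps)

lemma cls_eq_iff: "cls f = cls g \<longleftrightarrow> ev f = ev g"
proof -
  interpret I: ideal ker_B R4 by (rule ker_B_ideal)
  have "ev f = ev g \<longleftrightarrow> f - g \<in> ker_B"
    unfolding ev_eq_0_iff[symmetric] by (simp add: rhomD[OF rhom_ev(4)])
  also have "f - g = f \<ominus>\<^bsub>R4\<^esub> g" by (simp add: a_minus_def R4_minus R4_simps)
  also have "f \<ominus>\<^bsub>R4\<^esub> g \<in> ker_B \<longleftrightarrow> cls f = cls g"
    unfolding class_B_def ideal_B_eq
    using I.quotient_eq_iff_same_a_r_cos[OF ker_B_ideal, of f g] by (simp add: R4_simps)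
  finally show ?thesis by blast
qed

text \<open>The isomorphism from the image back to the quotient; by \<open>cls_eq_iff\<close> the
  choice of a preimage does not matter.\<close>

definition cl :: "'k poly fls \<Rightarrow> 'k poly_XZYT set" where "cl b = cls (SOME f. ev f = b)"

lemma cl_ev: "cl (ev f) = cls f"
  unfolding cl_def cls_eq_iff by (rule someI) simp

lemma cl_simps:
  assumes "a \<in> B"
  shows "cl a \<in> carrier A" "b \<in> B \<Longrightarrow> cl (a + b) = cl a \<oplus>\<^bsub>A\<^esub> cl b" "b \<in> B \<Longrightarrow> cl (a * b) = cl a \<otimes>\<^bsub>A\<^esub> cl b"
proof -
  obtain f where f: "a = ev f" using assms B_eq_range by auto
  show "cl a \<in> carrier A" by (simp add: f cl_ev cls_simps)
  assume "b \<in> B"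
  then obtain g where g: "b = ev g" using B_eq_range by auto
  show "cl (a + b) = cl a \<oplus>\<^bsub>A\<^esub> cl b" "cl (a * b) = cl a \<otimes>\<^bsub>A\<^esub> cl b"
    unfolding f g rhomD(1,2)[OF rhom_ev(4), symmetric] cl_ev by (rule cls_simps)+
qed

lemma cl_one: "cl 1 = \<one>\<^bsub>A\<^esub>"
  using cl_ev[of 1] cls_simps(4) by (simp add: rhomD[OF rhom_ev(4)])

lemma B_0_1: "0 \<in> B" "1 \<in> B"
  using dd.span_of.zero dd.\<kappa>_in_span[of "\<lambda>_. True" 1] by auto

lemma cl_zero: "cl 0 = \<zero>\<^bsub>A\<^esub>"
proof -
  interpret A: cring A by (rule A_cring)
  have "cl 0 \<oplus>\<^bsub>A\<^esub> cl 0 = cl 0" using cl_simps(2)[of 0 0] B_0_1 by simp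
  then show ?thesis using cl_simps(1)[of 0] B_0_1 A.add.l_cancel_one' A.add.l_cancel_one by metis
qed

lemma cl_uminus: "a \<in> B \<Longrightarrow> cl (- a) = \<ominus>\<^bsub>A\<^esub> cl a"
proof -
  interpret A: cring A by (rule A_cring)
  assume a: "a \<in> B"
  then have m: "- a \<in> B" by (rule dd.span_of_uminus)
  show ?thesis
    by (rule A.minus_equality[symmetric]) (use a m cl_simps(2)[of "- a" a] cl_zero cl_simps(1) in auto)
qed

lemma cl_sum: "(\<And>i. i \<in> S \<Longrightarrow> f i \<in> B) \<Longrightarrow> finite S \<Longrightarrow> cl (\<Sum>i\<in>S. f i) = finsum A (\<lambda>i. cl (f i)) S"
proof -
  interpret A: cring A by (rule A_cring)
  assume "finite S" and "\<And>i. i \<in> S \<Longrightarrow> f i \<in> B"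
  then show ?thesis
  proof (induction S rule: finite_induct)
    case (insert i S)
    then have "sum f S \<in> B" by (intro dd.span_of_sum) auto
    moreover have "(\<lambda>i. cl (f i)) \<in> S \<rightarrow> carrier A" using insert cl_simps(1) by auto
    ultimately show ?case using insert by (simp add: cl_simps)
  qed (simp add: cl_zero)
qed

lemma of_nat_in_B: "of_nat n \<in> B"
  unfolding fls.of_nat_\<kappa> by (rule dd.\<kappa>_in_span) simp

lemma cl_of_nat_mult: "a \<in> B \<Longrightarrow> cl (of_nat n * a) = add_pow A n (cl a)"
proof -
  interpret A: cring A by (rule A_cring)
  assume a: "a \<in> B"
  show ?thesis
  proof (induction n)
    case (Suc n)
    have "of_nat n * a \<in> B" using a of_nat_in_B dd.B_times by blast
    then have "cl (of_nat (Suc n) * a) = cl (of_nat n * a) \<oplus>\<^bsub>A\<^esub> cl a"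
      using a by (simp add: distrib_right cl_simps(2)[symmetric] add.commute)
    then show ?case by (simp add: Suc)
  qed (simp add: cl_zero)
qed

lemma cl_inj: "inj_on cl B"
  unfolding B_eq_range by (auto simp: inj_on_def cl_ev cls_eq_iff)

lemma cl_surj: "cl ` B = carrier A"
  unfolding B_eq_range carrier_A by (simp add: image_image cl_ev)

definition rep :: "'k poly_XZYT set \<Rightarrow> 'k poly fls" where "rep = inv_into B cl"

lemma rep: "b \<in> B \<Longrightarrow> rep (cl b) = b" "u \<in> carrier A \<Longrightarrow> cl (rep u) = u" "u \<in> carrier A \<Longrightarrow> rep u \<in> B"
  unfolding rep_def cl_surj[symmetric] using cl_inj
  by (simp_all add: inv_into_f_f f_inv_into_f inv_into_into)

lemma base_eq: "base_B d e P Q = cl ` range fls_scalar"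
  by (simp add: base_B_def image_image cl_ev[symmetric] ev_gen)

lemma x_B_eq: "x_B d e P Q = cl x"
  by (simp add: x_B_def cl_ev[symmetric] ev_gen)

lemma base_closed: "base_B d e P Q \<subseteq> carrier A"
  unfolding base_eq using cl_simps(1) dd.\<kappa>_in_span by auto

text \<open>The coefficients of \<open>\<phi>\<close> are carried over to the Laurent series, where
  values are available.\<close>

lemma hs_of_exponential_map:
  assumes "exponential_map (base_B d e P Q) A \<phi>"
  shows "locally_finite_hs B fls_scalar (\<lambda>i b. rep (\<phi> (cl b) i))"
proof -
  interpret A: cring A by (rule A_cring)
  note * = assms[unfolded A.exponential_map_iff[OF base_closed]]
  have hom: "\<phi> \<in> ring_hom A (UP A)" using * by blast
  have UP: "\<phi> u \<in> carrier (UP A)" if "u \<in> carrier A" for u using ring_hom_closed[OF hom that] .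
  have closed: "\<phi> u i \<in> carrier A" if "u \<in> carrier A" for u i using A.UP_closed[OF UP[OF that]] .
  have clr: "cl (rep (\<phi> (cl b) i)) = \<phi> (cl b) i" if "b \<in> B" for b i
    using rep(2) closed cl_simps(1) that by blast
  have repB: "rep (\<phi> (cl b) i) \<in> B" if "b \<in> B" for b i
    using rep(3) closed cl_simps(1) that by blast
  have cl_eqI: "a = b" if "a \<in> B" "b \<in> B" "cl a = cl b" for a b
    using cl_inj that by (auto dest: inj_onD)
  show ?thesis
  proof
    fix a b :: "'k poly fls" and i j :: nat and c
    show "fls_scalar c \<in> B" by (rule dd.\<kappa>_in_span) simp
    show "rep (\<phi> (cl (fls_scalar c)) i) = 0" if "i > 0"
    proof -
      have "\<phi> (cl (fls_scalar c)) i = \<zero>\<^bsub>A\<^esub>" using * that by (auto simp: base_eq)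
      then show ?thesis using rep(1)[OF B_0_1(1)] by (simp add: cl_zero)
    qed
    assume a: "a \<in> B"
    show "rep (\<phi> (cl a) i) \<in> B" by (rule repB[OF a])
    show "rep (\<phi> (cl a) 0) = a" using * a rep(1) cl_simps(1) by simp
    have DD: "\<phi> (\<phi> (cl a) i) j = add_pow A ((i + j) choose i) (\<phi> (cl a) (i + j))"
      using * cl_simps(1)[OF a] by blast
    show "rep (\<phi> (cl (rep (\<phi> (cl a) i))) j) = of_nat ((i + j) choose i) * rep (\<phi> (cl a) (i + j))"
    proof (rule cl_eqI)
      show "of_nat ((i + j) choose i) * rep (\<phi> (cl a) (i + j)) \<in> B"
        using dd.B_times[OF repB[OF a] of_nat_in_B] .
      show "cl (rep (\<phi> (cl (rep (\<phi> (cl a) i))) j)) = cl (of_nat ((i + j) choose i) * rep (\<phi> (cl a) (i + j)))"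
        unfolding clr[OF a] cl_of_nat_mult[OF repB[OF a]]
        by (rule trans[OF rep(2)[OF closed[OF closed[OF cl_simps(1)[OF a]]]] DD])
    qed (intro repB a)
    have "\<exists>n. bound \<zero>\<^bsub>A\<^esub> n (\<phi> (cl a))"
      using UP[OF cl_simps(1)[OF a]] by (simp add: UP_def up_def)
    then show "\<exists>n. \<forall>i>n. rep (\<phi> (cl a) i) = 0"
      using rep(1)[OF B_0_1(1)] unfolding bound_def cl_zero by metis
    assume b: "b \<in> B"
    show "a + b \<in> B" "a * b \<in> B" using a b dd.span_of_add dd.B_times by blast+
    show "rep (\<phi> (cl (a + b)) i) = rep (\<phi> (cl a) i) + rep (\<phi> (cl b) i)"
    proof (rule cl_eqI)
      have "\<phi> (cl a \<oplus>\<^bsub>A\<^esub> cl b) i = \<phi> (cl a) i \<oplus>\<^bsub>A\<^esub> \<phi> (cl b) i"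
        using ring_hom_add[OF hom cl_simps(1)[OF a] cl_simps(1)[OF b]] A.UP_add UP cl_simps(1) a b by simp
      also have "\<dots> = cl (rep (\<phi> (cl a) i) + rep (\<phi> (cl b) i))"
        by (simp only: clr a b cl_simps(2) repB)
      finally show "cl (rep (\<phi> (cl (a + b)) i)) = cl (rep (\<phi> (cl a) i) + rep (\<phi> (cl b) i))"
        unfolding clr[OF dd.span_of_add[OF b a]] unfolding cl_simps(2)[OF a b] .
    qed (intro repB dd.span_of_add a b)+
    show "rep (\<phi> (cl (a * b)) i) = (\<Sum>j\<le>i. rep (\<phi> (cl a) j) * rep (\<phi> (cl b) (i - j)))"
    proof (rule cl_eqI)
      have mB: "rep (\<phi> (cl a) j) * rep (\<phi> (cl b) (i - j)) \<in> B" for j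
        using a b repB dd.B_times by blast
      show "(\<Sum>j\<le>i. rep (\<phi> (cl a) j) * rep (\<phi> (cl b) (i - j))) \<in> B"
        by (intro dd.span_of_sum mB)
      have "\<phi> (cl a \<otimes>\<^bsub>A\<^esub> cl b) i = finsum A (\<lambda>j. \<phi> (cl a) j \<otimes>\<^bsub>A\<^esub> \<phi> (cl b) (i - j)) {..i}"
        using ring_hom_mult[OF hom cl_simps(1)[OF a] cl_simps(1)[OF b]] A.UP_mult UP cl_simps(1) a b by simp
      moreover have "cl (\<Sum>j\<le>i. rep (\<phi> (cl a) j) * rep (\<phi> (cl b) (i - j))) =
          finsum A (\<lambda>j. \<phi> (cl a) j \<otimes>\<^bsub>A\<^esub> \<phi> (cl b) (i - j)) {..i}"
        by (subst cl_sum) (simp_all add: mB cl_simps(3) repB a b clr)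
      ultimately show "cl (rep (\<phi> (cl (a * b)) i)) = cl (\<Sum>j\<le>i. rep (\<phi> (cl a) j) * rep (\<phi> (cl b) (i - j)))"
        unfolding clr[OF dd.B_times[OF b a]] unfolding cl_simps(3)[OF a b] by (rule trans[OF _ sym])
    qed (intro repB dd.B_times a b)
  qed
qed

lemma exponential_map_of_hs:
  assumes "locally_finite_hs B fls_scalar D"
  shows "exponential_map (base_B d e P Q) A (\<lambda>u i. cl (D i (rep u)))"
proof -
  interpret A: cring A by (rule A_cring)
  interpret locally_finite_hs B fls_scalar D by fact
  have closed: "(\<lambda>i. cl (D i (rep u))) \<in> carrier (UP A)" if u: "u \<in> carrier A" for u
  proof -
    obtain n where "\<forall>i>n. D i (rep u) = 0" using D_finite rep(3)[OF u] by blast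
    then have "bound \<zero>\<^bsub>A\<^esub> n (\<lambda>i. cl (D i (rep u)))" by (auto simp: bound_def cl_zero)
    then show ?thesis using cl_simps(1) D_B rep(3)[OF u] by (auto simp: UP_def intro!: mem_upI)
  qed
  have rep_add: "rep (u \<oplus>\<^bsub>A\<^esub> w) = rep u + rep w" and rep_mult: "rep (u \<otimes>\<^bsub>A\<^esub> w) = rep u * rep w"
    if "u \<in> carrier A" "w \<in> carrier A" for u w
  proof -
    have "rep (cl (rep u + rep w)) = rep u + rep w" "rep (cl (rep u * rep w)) = rep u * rep w"
      by (intro rep(1) B_add B_mult rep(3) that)+
    then show "rep (u \<oplus>\<^bsub>A\<^esub> w) = rep u + rep w" "rep (u \<otimes>\<^bsub>A\<^esub> w) = rep u * rep w"
      using that by (simp_all add: cl_simps(2,3) rep)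
  qed
  have "(\<lambda>u i. cl (D i (rep u))) \<in> ring_hom A (UP A)"
  proof (rule ring_hom_memI)
    fix u w assume uw: "u \<in> carrier A" "w \<in> carrier A"
    show "(\<lambda>i. cl (D i (rep u))) \<in> carrier (UP A)" by (rule closed[OF uw(1)])
    note ruw = rep(3)[OF uw(1)] rep(3)[OF uw(2)]
    show "(\<lambda>i. cl (D i (rep (u \<otimes>\<^bsub>A\<^esub> w)))) = (\<lambda>i. cl (D i (rep u))) \<otimes>\<^bsub>UP A\<^esub> (\<lambda>i. cl (D i (rep w)))"
    proof
      fix i
      have mB: "D j (rep u) * D (i - j) (rep w) \<in> B" for j by (intro B_mult D_B ruw)
      have "cl (D i (rep (u \<otimes>\<^bsub>A\<^esub> w))) = finsum A (\<lambda>j. cl (D j (rep u) * D (i - j) (rep w))) {..i}"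
        unfolding rep_mult[OF uw] D_mult[OF rep(3)[OF uw(1)] rep(3)[OF uw(2)]] by (rule cl_sum) (use mB in auto)
      also have "\<dots> = ((\<lambda>i. cl (D i (rep u))) \<otimes>\<^bsub>UP A\<^esub> (\<lambda>i. cl (D i (rep w)))) i"
        unfolding A.UP_mult[OF closed[OF uw(1)] closed[OF uw(2)]] by (simp only: cl_simps(3)[OF D_B D_B] ruw)
      finally show "cl (D i (rep (u \<otimes>\<^bsub>A\<^esub> w))) = ((\<lambda>i. cl (D i (rep u))) \<otimes>\<^bsub>UP A\<^esub> (\<lambda>i. cl (D i (rep w)))) i" .
    qed
    show "(\<lambda>i. cl (D i (rep (u \<oplus>\<^bsub>A\<^esub> w)))) = (\<lambda>i. cl (D i (rep u))) \<oplus>\<^bsub>UP A\<^esub> (\<lambda>i. cl (D i (rep w)))"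
      by (rule ext) (use uw in \<open>simp add: A.UP_add closed rep_add D_add rep(3) cl_simps(2) D_B\<close>)
  next
    have "rep \<one>\<^bsub>A\<^esub> = fls_scalar 1" using rep(1)[OF B_0_1(2)] by (simp add: cl_one)
    then show "(\<lambda>i. cl (D i (rep \<one>\<^bsub>A\<^esub>))) = \<one>\<^bsub>UP A\<^esub>"
      unfolding A.UP_one using D_0[OF B_0_1(2)] D_\<kappa>[of _ 1] by (auto simp: fun_eq_iff cl_zero cl_one)
  qed
  moreover have "cl (D i (rep u)) = \<zero>\<^bsub>A\<^esub>" if "u \<in> base_B d e P Q" "i > 0" for u i
    using that rep(1) \<kappa>_B by (auto simp: base_eq D_\<kappa> cl_zero)
  moreover have "cl (D j (rep (cl (D i (rep u))))) = add_pow A ((i + j) choose i) (cl (D (i + j) (rep u)))"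
    if "u \<in> carrier A" for u i j
    using that rep(1,3) D_B by (simp add: D_D cl_of_nat_mult)
  ultimately show ?thesis
    unfolding A.exponential_map_iff[OF base_closed] using rep D_0 by simp
qed

end

section \<open>The shear along \<open>z\<close>\<close>

text \<open>The Hasse derivative, which replaces the divided \<open>i\<close>-th derivative in every
  characteristic: the coefficient of \<open>U^i\<close> after substituting \<open>z + U\<close> for
  \<open>z\<close>.\<close>

definition hasse :: "nat \<Rightarrow> 'k::field poly \<Rightarrow> 'k poly" where
  "hasse i p = coeff (eval_poly (\<lambda>c. [:[:c:]:]) [:[:0, 1:], 1:] p) i"

lemma rhom_hasse: "rhom (eval_poly (\<lambda>c::'k::field. [:[:c:]:]) [:[:0, 1:], 1:])"
  by (rule rhom_eval_poly) (simp add: rhom_def one_pCons)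

lemma hasse_add: "hasse i (p + q) = hasse i p + hasse i q"
  by (simp add: hasse_def rhomD[OF rhom_hasse])

lemma hasse_0: "hasse i 0 = 0"
  by (simp add: hasse_def)

lemma hasse_sum: "hasse i (\<Sum>k\<in>S. f k) = (\<Sum>k\<in>S. hasse i (f k))"
  by (induction S rule: infinite_finite_induct) (auto simp: hasse_0 hasse_add)

lemma hasse_mult: "hasse i (p * q) = (\<Sum>j\<le>i. hasse j p * hasse (i - j) q)"
  by (simp add: hasse_def rhomD[OF rhom_hasse] coeff_mult)

lemma hasse_pCons:
  "hasse i (pCons c p) = (if i = 0 then [:c:] else 0) + pCons 0 (hasse i p) + (if i = 0 then 0 else hasse (i - 1) p)"
  unfolding hasse_def by (subst eval_poly_pCons) (auto simp: rhom_def one_pCons coeff_pCons split: nat.splits)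

lemma coeff_hasse: "coeff (hasse i p) n = of_nat ((n + i) choose i) * coeff p (n + i)"
proof (induction p arbitrary: i n)
  case (pCons c p)
  show ?case
  proof (cases i)
    case 0
    then show ?thesis using pCons.IH[of 0] by (simp add: hasse_pCons coeff_pCons split: nat.splits)
  next
    case (Suc i')
    then show ?thesis
      using pCons.IH[of i "n - 1"] pCons.IH[of i' n]
      by (cases n) (simp_all add: hasse_pCons coeff_pCons algebra_simps)
  qed
qed (simp add: hasse_0)

lemma hasse_hasse: "hasse j (hasse i p) = of_nat ((i + j) choose i) * hasse (i + j) p"
proof (rule poly_eqI)
  fix n
  have "((n + j) choose j) * ((n + j + i) choose i) = ((i + j) choose i) * ((n + (i + j)) choose (i + j))"
    using choose_mult[of i "i + j" "n + j + i"] binomial_symmetric[of j "n + j"]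
      binomial_symmetric[of i "n + j + i"]
    by (simp add: ac_simps)
  then have "(of_nat ((n + j) choose j) * of_nat ((n + j + i) choose i) :: 'a) =
     of_nat ((i + j) choose i) * of_nat ((n + (i + j)) choose (i + j))"
    by (metis of_nat_mult)
  note eq = this
  have "coeff (hasse j (hasse i p)) n =
      (of_nat ((n + j) choose j) * of_nat ((n + j + i) choose i)) * coeff p (n + j + i)"
    by (simp only: coeff_hasse mult.assoc)
  also have "n + j + i = n + (i + j)" by simp
  also have "(of_nat ((n + j) choose j) * of_nat ((n + (i + j)) choose i)) * coeff p (n + (i + j)) =
      (of_nat ((i + j) choose i) * of_nat ((n + (i + j)) choose (i + j))) * coeff p (n + (i + j))"
    using eq by (simp only: \<open>n + j + i = n + (i + j)\<close>)
  finally show "coeff (hasse j (hasse i p)) n = coeff (of_nat ((i + j) choose i) * hasse (i + j) p) n"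
    by (simp add: coeff_hasse of_nat_poly mult.assoc)
qed

lemma hasse_id: "hasse 0 p = p"
  by (rule poly_eqI) (simp add: coeff_hasse)

lemma hasse_const: "i > 0 \<Longrightarrow> hasse i [:c:] = 0"
  by (rule poly_eqI) (simp add: coeff_hasse coeff_pCons split: nat.splits)

text \<open>The constant coefficient of this derivative is the leading coefficient of
  \<open>p\<close>, the binomial factor being 1; so no nonconstant polynomial is invariant.\<close>

lemma hasse_degree_nonzero: "p \<noteq> 0 \<Longrightarrow> hasse (degree p) p \<noteq> 0"
  using coeff_hasse[of "degree p" p 0] by auto

text \<open>A common summation range, needed because Hasse derivatives of coefficients can raise the
  subdegree.\<close>

lemma fls_times_nth_bounds:
  fixes f g :: "'a::comm_ring_1 fls"
  assumes "\<And>k. k < a \<Longrightarrow> fls_nth f k = 0" "\<And>k. k < b \<Longrightarrow> fls_nth g k = 0"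
  shows "fls_nth (f * g) n = (\<Sum>k=a..n - b. fls_nth f k * fls_nth g (n - k))"
proof (cases "f = 0 \<or> g = 0")
  case False
  then have le: "a \<le> fls_subdegree f" "b \<le> fls_subdegree g"
    using assms by (meson fls_subdegree_geI)+
  have "fls_nth (f * g) n = (\<Sum>k=fls_subdegree f..n - fls_subdegree g. fls_nth f k * fls_nth g (n - k))"
    by (rule fls_times_nth(2))
  also have "\<dots> = (\<Sum>k=a..n - b. fls_nth f k * fls_nth g (n - k))"
    by (rule sum.mono_neutral_left) (use le in auto)
  finally show ?thesis .
qed auto

definition fls_map :: "('a::zero \<Rightarrow> 'b::zero) \<Rightarrow> 'a fls \<Rightarrow> 'b fls" where
  "fls_map h f = Abs_fls (\<lambda>n. h (fls_nth f n))"

lemma fls_nth_map: "h 0 = 0 \<Longrightarrow> fls_nth (fls_map h f) n = h (fls_nth f n)"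
  unfolding fls_map_def by (rule nth_Abs_fls_lower_bound[of "fls_subdegree f"]) simp

lemma fls_map_hasse_mult:
  "fls_map (hasse i) (f * g) = (\<Sum>j\<le>i. fls_map (hasse j) f * fls_map (hasse (i - j)) g)"
proof (rule fls_eqI)
  fix n
  let ?a = "fls_subdegree f" and ?b = "fls_subdegree g"
  have "fls_nth (fls_map (hasse i) (f * g)) n =
      (\<Sum>k=?a..n - ?b. \<Sum>j\<le>i. hasse j (fls_nth f k) * hasse (i - j) (fls_nth g (n - k)))"
    using fls_times_nth_bounds[of ?a f ?b g n] by (simp add: fls_nth_map hasse_0 hasse_sum hasse_mult)
  also have "\<dots> = (\<Sum>j\<le>i. \<Sum>k=?a..n - ?b. fls_nth (fls_map (hasse j) f) k * fls_nth (fls_map (hasse (i - j)) g) (n - k))"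
    by (subst sum.swap) (simp add: fls_nth_map hasse_0)
  also have "\<dots> = (\<Sum>j\<le>i. fls_nth (fls_map (hasse j) f * fls_map (hasse (i - j)) g) n)"
    by (rule sum.cong[OF refl], rule fls_times_nth_bounds[symmetric]) (simp_all add: fls_nth_map hasse_0)
  finally show "fls_nth (fls_map (hasse i) (f * g)) n = fls_nth (\<Sum>j\<le>i. fls_map (hasse j) f * fls_map (hasse (i - j)) g) n"
    by (simp add: fls_nth_sum)
qed

text \<open>The coefficient of \<open>U^i\<close> under \<open>z \<mapsto> z + x^N U\<close>; the
  negative shift multiplies by \<open>x^(N i)\<close>.\<close>

definition shear :: "nat \<Rightarrow> nat \<Rightarrow> 'k::field poly fls \<Rightarrow> 'k poly fls" where
  "shear N i f = fls_shift (- int (N * i)) (fls_map (hasse i) f)"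

lemma fls_nth_shear: "fls_nth (shear N i f) n = hasse i (fls_nth f (n - int (N * i)))"
  by (simp add: shear_def fls_nth_map hasse_0)

lemma shear_add: "shear N i (f + g) = shear N i f + shear N i g"
  by (rule fls_eqI) (simp add: fls_nth_shear hasse_add)

lemma shear_mult: "shear N i (f * g) = (\<Sum>j\<le>i. shear N j f * shear N (i - j) g)"
proof -
  have "- int (N * i) = - int (N * j) + - int (N * (i - j))" if "j \<le> i" for j
    using that by (simp add: of_nat_diff algebra_simps)
  then have "shear N j f * shear N (i - j) g = fls_shift (- int (N * i)) (fls_map (hasse j) f * fls_map (hasse (i - j)) g)"
    if "j \<le> i" for j unfolding shear_def fls_times_both_shifted_simp using that by simp
  then have "(\<Sum>j\<le>i. shear N j f * shear N (i - j) g) =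
      (\<Sum>j\<le>i. fls_shift (- int (N * i)) (fls_map (hasse j) f * fls_map (hasse (i - j)) g))" by simp
  also have "\<dots> = shear N i (f * g)"
    unfolding shear_def[of N i "f * g"] fls_map_hasse_mult
    by (rule fls_eqI) (simp add: fls_nth_sum)
  finally show ?thesis by simp
qed

lemma shear_shear: "shear N j (shear N i f) = of_nat ((i + j) choose i) * shear N (i + j) f"
  by (rule fls_eqI) (simp add: fls_nth_shear hasse_hasse fls_of_nat algebra_simps)

lemma shear_0: "shear N 0 f = f"
  by (rule fls_eqI) (simp add: fls_nth_shear hasse_id)

lemma shear_const: "i > 0 \<Longrightarrow> (\<And>n. degree (fls_nth f n) = 0) \<Longrightarrow> shear N i f = 0"
  by (rule fls_eqI) (metis degree_eq_zeroE fls_nth_shear fls_zero_nth hasse_const)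

lemma eval_poly_closed:
  assumes "rhom h" "\<And>a. S (h a)" "S c" "\<And>a b. S a \<Longrightarrow> S b \<Longrightarrow> S (a + b)" "\<And>a b. S a \<Longrightarrow> S b \<Longrightarrow> S (a * b)"
  shows "S (eval_poly h c p)"
proof (induction p)
  case 0
  then show ?case using assms(1,2) rhomD(4) by (metis eval_poly_0)
next
  case (pCons a p)
  then show ?case by (simp add: eval_poly_pCons[OF assms(1)] assms)
qed

section \<open>The shear preserves the algebra and has only the expected invariants\<close>

context presentation
begin

definition "D = shear (d + e)"

text \<open>Elements moved by the shear only in multiples of \<open>x\<^sup>M\<close>: this is what allows division
  by \<open>x\<^sup>d\<close> and \<open>x\<^sup>e\<close> in the definition of \<open>y\<close> and \<open>t\<close>.\<close>

definition small_move :: "nat \<Rightarrow> 'k poly fls \<Rightarrow> bool" where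
  "small_move M b \<longleftrightarrow> b \<in> B \<and> (\<forall>i>0. \<exists>c\<in>B. D i b = x ^ M * c) \<and> (\<exists>n. \<forall>i>n. D i b = 0)"

lemma D_0: "D 0 b = b"
  by (simp add: D_def shear_0)

lemma D_in_B: "small_move M b \<Longrightarrow> D i b \<in> B"
proof (cases "i = 0")
  case False
  assume b: "small_move M b"
  then obtain c where "c \<in> B" "D i b = x ^ M * c" using False unfolding small_move_def by blast
  then show ?thesis using dd.B_times B_power dd.gen_in_B by simp
qed (simp add: small_move_def D_0)

lemma small_moveI:
  "b \<in> B \<Longrightarrow> (\<And>i. i > 0 \<Longrightarrow> \<exists>c\<in>B. D i b = x ^ M * c) \<Longrightarrow> (\<And>i. i > n \<Longrightarrow> D i b = 0) \<Longrightarrow> small_move M b"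
  unfolding small_move_def by blast

lemma small_moveD:
  assumes "small_move M b"
  shows "b \<in> B" "i > 0 \<Longrightarrow> \<exists>c\<in>B. D i b = x ^ M * c" "\<exists>n. \<forall>i>n. D i b = 0"
  using assms unfolding small_move_def by blast+

lemma multiples_add:
  "\<exists>c\<in>B. f = x ^ M * c \<Longrightarrow> \<exists>c\<in>B. g = x ^ M * c \<Longrightarrow> \<exists>c\<in>B. f + g = x ^ M * c"
proof -
  assume "\<exists>c\<in>B. f = x ^ M * c" "\<exists>c\<in>B. g = x ^ M * c"
  then obtain c c' where "c \<in> B" "c' \<in> B" "f = x ^ M * c" "g = x ^ M * c'" by blast
  then show ?thesis by (intro bexI[of _ "c + c'"] dd.span_of_add) (simp_all add: distrib_left)
qed

lemma multiples_mult: "\<exists>c\<in>B. f = x ^ M * c \<Longrightarrow> b \<in> B \<Longrightarrow> \<exists>c\<in>B. f * b = x ^ M * c"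
proof -
  assume "\<exists>c\<in>B. f = x ^ M * c" and b: "b \<in> B"
  then obtain c where "c \<in> B" "f = x ^ M * c" by blast
  then show ?thesis using b by (intro bexI[of _ "c * b"] dd.B_times) (simp_all add: mult.assoc)
qed

lemma multiples_0: "\<exists>c\<in>B. 0 = x ^ M * c"
  by (intro bexI[of _ 0] dd.span_of.zero) simp

lemma D_add: "D i (a + b) = D i a + D i b" and D_mult: "D i (a * b) = (\<Sum>j\<le>i. D j a * D (i - j) b)"
  by (simp_all add: D_def shear_add shear_mult)

lemma small_move_add:
  assumes "small_move M a" "small_move M b"
  shows "small_move M (a + b)"
proof -
  obtain n m where nm: "\<forall>i>n. D i a = 0" "\<forall>i>m. D i b = 0" using assms small_moveD(3) by meson
  show ?thesis
    by (rule small_moveI[of _ _ "n + m"])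
       (use nm small_moveD[OF assms(1)] small_moveD[OF assms(2)] in
         \<open>simp_all add: D_add dd.span_of_add multiples_add\<close>)
qed

lemma small_move_mult:
  assumes "small_move M a" "small_move M b"
  shows "small_move M (a * b)"
proof -
  note a = small_moveD[OF assms(1)] and b = small_moveD[OF assms(2)]
  obtain n m where nm: "\<forall>i>n. D i a = 0" "\<forall>i>m. D i b = 0" using a(3) b(3) by blast
  have sum: "\<exists>c\<in>B. sum f S = x ^ M * c" if "\<And>j. j \<in> S \<Longrightarrow> \<exists>c\<in>B. f j = x ^ M * c" for f and S :: "nat set"
    using that by (induction S rule: infinite_finite_induct) (simp_all add: multiples_0 multiples_add B_0_1)
  show ?thesis
  proof (rule small_moveI[of _ _ "n + m"])
    show "a * b \<in> B" by (rule dd.B_times[OF b(1) a(1)])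
    fix i :: nat
    show "\<exists>c\<in>B. D i (a * b) = x ^ M * c" if i: "i > 0"
      unfolding D_mult
    proof (rule sum)
      fix j assume "j \<in> {..i}"
      show "\<exists>c\<in>B. D j a * D (i - j) b = x ^ M * c"
      proof (cases "j = 0")
        case True
        then show ?thesis using multiples_mult[OF b(2) D_in_B[OF assms(1)], of "i - j" j] i by (simp add: mult.commute)
      next
        case False
        then show ?thesis using multiples_mult[OF a(2) D_in_B[OF assms(2)]] by simp
      qed
    qed
    show "D i (a * b) = 0" if "i > n + m"
      unfolding D_mult
    proof (rule sum.neutral, rule ballI)
      fix j assume "j \<in> {..i}"
      then have "j > n \<or> i - j > m" using that by auto
      then show "D j a * D (i - j) b = 0" using nm by auto
    qed
  qed
qed

lemma small_move_mono: "small_move M b \<Longrightarrow> M' \<le> M \<Longrightarrow> small_move M' b"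
proof -
  assume b: "small_move M b" and "M' \<le> M"
  then have M: "x ^ M = x ^ M' * x ^ (M - M')" by (simp flip: power_add)
  have "\<exists>c\<in>B. D i b = x ^ M' * c" if i: "i > 0" for i
  proof -
    obtain c where "c \<in> B" "D i b = x ^ M * c" using b i by (auto simp: small_move_def)
    moreover have "x ^ (M - M') * c \<in> B" using \<open>c \<in> B\<close> dd.B_times B_power dd.gen_in_B by blast
    ultimately show ?thesis unfolding M mult.assoc by blast
  qed
  then show ?thesis using b by (auto simp: small_move_def)
qed

lemma small_move_invariant: "b \<in> B \<Longrightarrow> (\<And>i. i > 0 \<Longrightarrow> D i b = 0) \<Longrightarrow> small_move M b"
  using dd.span_of.zero by (auto simp: small_move_def)

lemma D_x_power: "i > 0 \<Longrightarrow> D i (x ^ n) = 0"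
  unfolding D_def by (rule shear_const) auto

lemma D_scalar: "i > 0 \<Longrightarrow> D i (fls_scalar c) = 0"
  unfolding D_def by (rule shear_const) (auto simp: fls_scalar_def)

lemma D_x_mult: "D i (x ^ n * b) = x ^ n * D i b"
proof -
  have "D i (x ^ n * b) = (\<Sum>j\<le>i. D j (x ^ n) * D (i - j) b)" by (simp add: D_def shear_mult)
  also have "\<dots> = (\<Sum>j\<le>i. if j = 0 then x ^ n * D i b else 0)"
    by (rule sum.cong) (auto simp: D_0 D_x_power)
  finally show ?thesis by simp
qed

lemma small_move_divide:
  assumes "small_move (M + n) (x ^ n * b)" "b \<in> B"
  shows "small_move M b"
proof -
  have "\<exists>c\<in>B. D i b = x ^ M * c" if i: "i > 0" for i
  proof -
    obtain c where "c \<in> B" "x ^ n * D i b = x ^ (M + n) * c"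
      using small_moveD(2)[OF assms(1) i] by (auto simp: D_x_mult)
    then show ?thesis by (intro bexI[of _ c]) (auto simp: power_add mult_ac)
  qed
  then show ?thesis using assms by (auto simp: small_move_def D_x_mult)
qed

lemma small_move_gen: "small_move (d + e) x" "small_move (d + e) z" "small_move (d + e) (fls_scalar c)"
proof -
  show "small_move (d + e) x" using small_move_invariant[OF dd.gen_in_B(1)] D_x_power[of _ 1] by simp
  show "small_move (d + e) (fls_scalar c)" by (intro small_move_invariant dd.\<kappa>_in_span D_scalar TrueI)
  have z1: "D 1 z = x ^ (d + e)"
    by (rule fls_eqI) (auto simp: D_def fls_nth_shear z_def hasse_pCons hasse_0)
  have zi: "D i z = 0" if "i > 1" for i
    by (rule fls_eqI) (use that in \<open>auto simp: D_def fls_nth_shear z_def hasse_pCons hasse_0\<close>)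
  have "\<exists>c\<in>B. D i z = x ^ (d + e) * c" if "i > 0" for i
    using that z1 zi[of i] B_0_1 by (cases "i = 1") (auto intro!: bexI[of _ 1] bexI[of _ 0])
  then show "small_move (d + e) z" using dd.gen_in_B zi by (auto simp: small_move_def)
qed

lemma small_move_ev_Z: "small_move (d + e) (ev_Z G)"
  by (intro eval_poly_closed[where S = "small_move (d + e)"] rhom_ev rhom_fls_scalar
      small_move_gen small_move_add small_move_mult)

text \<open>The exponent \<open>d + e\<close> is used up in stages: polynomials in \<open>x\<close>
  and \<open>z\<close> move by multiples of \<open>x^(d+e)\<close>, hence \<open>y\<close> by
  multiples of \<open>x^e\<close>, and \<open>t\<close> still within \<open>B\<close>.\<close>

lemma small_move_ev: "small_move 0 (ev f)"
proof -
  have y: "small_move e y"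
    by (rule small_move_divide[of _ d]) (use small_move_ev_Z dd.gen_in_B in \<open>simp_all add: x_y add.commute\<close>)
  have Y: "small_move e (ev_Y q)" for q
    by (intro eval_poly_closed[where S = "small_move e"] rhom_ev small_move_mono[OF small_move_ev_Z]
      y small_move_add small_move_mult) simp
  have t: "small_move 0 t"
    by (rule small_move_divide[of _ e]) (use Y dd.gen_in_B in \<open>simp_all add: x_t\<close>)
  show ?thesis unfolding ev_def
    by (intro eval_poly_closed[where S = "small_move 0"] rhom_ev small_move_mono[OF Y]
      t small_move_add small_move_mult) simp
qed

lemma hs_D: "locally_finite_hs B fls_scalar D"
proof
  have all: "small_move 0 b" if "b \<in> B" for b using that small_move_ev B_eq_range by auto
  show "D i a \<in> B" if "a \<in> B" for a i using D_in_B[OF all[OF that]] .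
  show "\<exists>n. \<forall>i>n. D i a = 0" if "a \<in> B" for a using all[OF that] by (simp add: small_move_def)
  show "fls_scalar c \<in> B" for c by (rule dd.\<kappa>_in_span) simp
qed (auto simp: D_0 D_scalar intro: dd.span_of_add dd.B_times,
     simp_all add: D_add D_mult, simp add: D_def shear_shear)

lemma ev_Z_bounded: "\<exists>M. \<forall>n>M. fls_nth (ev_Z G) (int n) = 0"
proof (induction G)
  case (pCons p G)
  then obtain M where M: "\<forall>n>M. fls_nth (ev_Z G) (int n) = 0" by blast
  have "fls_nth (ev_Z (pCons p G)) (int n) = 0" if "n > max M (degree p)" for n
    using M that by (simp add: eval_poly_pCons[OF rhom_ev(1)] fls_nth_ev_X z_def coeff_eq_0)
  then show ?case by blast
qed simp

text \<open>The coefficients of an invariant are constant in \<open>z\<close> by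
  \<open>hasse_degree_nonzero\<close>. Clearing denominators bounds the powers of \<open>x\<close>
  above, and the values of monomials exclude negative ones.\<close>

lemma invariants_D:
  assumes b: "b \<in> B" and inv: "\<And>i. i > 0 \<Longrightarrow> D i b = 0"
  shows "\<exists>p. b = ev_X p"
proof (cases "b = 0")
  case True
  then show ?thesis by (intro exI[of _ 0]) simp
next
  case False
  have const: "degree (fls_nth b n) = 0" for n
  proof (rule ccontr)
    assume deg: "degree (fls_nth b n) \<noteq> 0"
    let ?i = "degree (fls_nth b n)"
    have "hasse ?i (fls_nth b n) = fls_nth (D ?i b) (n + int ((d + e) * ?i))"
      by (simp add: D_def fls_nth_shear)
    also have "\<dots> = 0" using inv[of ?i] deg by simp
    finally show False using hasse_degree_nonzero[of "fls_nth b n"] deg by (cases "fls_nth b n = 0") auto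
  qed
  obtain K G where KG: "x ^ K * b = ev_Z G" using clear_denominators[OF b] .
  obtain M where M: "\<forall>n>M. fls_nth (ev_Z G) (int n) = 0" using ev_Z_bounded by blast
  have "fls_nth b (int n) = fls_nth (x ^ K * b) (int (n + K))" for n
    unfolding fls_X_power_conv_shift_1 by (simp add: fls_shifted_times_simps)
  then have bd: "fls_nth b (int n) = 0" if "n > M" for n
    using KG M[rule_format, of "n + K"] that by simp
  \<comment> \<open>\<open>v b\<close> has first coordinate 0, which forces the exponents of
    \<open>z\<close>, \<open>y\<close> and \<open>t\<close> to vanish; so the order of
    \<open>b\<close> is the exponent of \<open>x\<close>.\<close>
  obtain a i j l where m: "fls_val (dd.mon a i j l) = fls_val b" using dd.v_semigroup[OF b False] by blast
  then have "(of_nat (i + r * (j + s * l)) :: rat) = of_nat 0"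
      "(of_int (int (d * j + (d * s + e) * l) - int a) :: rat) = of_int (- fls_subdegree b)"
    unfolding dd.v_mon unfolding fls_val_def const pCons_eq_iff of_int_minus by blast+
  then have "i + r * (j + s * l) = 0" "int (d * j + (d * s + e) * l) - int a = - fls_subdegree b"
    unfolding of_nat_eq_iff of_int_eq_iff .
  then have "fls_subdegree b \<ge> 0" using P_deg Q_deg by (cases "l = 0"; cases "j = 0") auto
  then have neg: "fls_nth b n = 0" if "n < 0" for n using that by simp
  define p where "p = Abs_poly (\<lambda>n. coeff (fls_nth b (int n)) 0)"
  have p: "coeff p n = coeff (fls_nth b (int n)) 0" for n
    unfolding p_def by (subst coeff_Abs_poly[of M]) (auto simp: bd)
  have "b = ev_X p"
  proof (rule fls_eqI)
    fix n
    show "fls_nth b n = fls_nth (ev_X p) n"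
      using const[of n] neg[of n] by (auto simp: fls_nth_ev_X p elim: degree_eq_zeroE)
  qed
  then show ?thesis by blast
qed

section \<open>The two inclusions\<close>

lemma x_invariant_of_hs:
  assumes "locally_finite_hs B fls_scalar D'" "r * s \<noteq> 1" "d * s + e \<noteq> 1" "r * e \<noteq> 1" "i > 0"
  shows "D' i x = 0"
proof -
  interpret double_danielewski_hs fls_val fls_lc fls_scalar x z y t d e r s D'
    by (intro double_danielewski_hs.intro dd.double_danielewski_relations_axioms
        double_danielewski_hs_axioms.intro assms e_pos)
  show ?thesis by (rule x_invariant[OF assms(5)])
qed

text \<open>Invariance passes through the ring operations, so it is enough to have it for scalars
  and, by \<open>x_invariant_of_hs\<close>, for \<open>x\<close>.\<close>

lemma generate_ring_subset_invariants:
  assumes ne: "r * s \<noteq> 1" "d * s + e \<noteq> 1" "r * e \<noteq> 1"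
    and \<phi>: "exponential_map (base_B d e P Q) A \<phi>"
    and u: "u \<in> generate_ring A (base_B d e P Q \<union> {x_B d e P Q})"
  shows "u \<in> exp_invariants A \<phi>"
proof -
  interpret A: cring A by (rule A_cring)
  define D' where "D' i b = rep (\<phi> (cl b) i)" for i b
  have hs: "locally_finite_hs B fls_scalar D'" using hs_of_exponential_map[OF \<phi>] unfolding D'_def .
  interpret hs: locally_finite_hs B fls_scalar D' by (rule hs)
  have D'0: "D' i 0 = 0" for i
    using hs.D_add[OF B_0_1(1) B_0_1(1), of i] by (metis add_0 add_cancel_right_right)
  have "\<exists>b\<in>B. u = cl b \<and> (\<forall>i>0. D' i b = 0)" using u
  proof (induction rule: generate_ring.induct)
    case one
    then show ?case using hs.D_\<kappa>[of _ 1] B_0_1 cl_one by auto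
  next
    case (incl h)
    then consider c where "h = cl (fls_scalar c)" | "h = cl x" by (auto simp: base_eq x_B_eq)
    then show ?case
    proof cases
      case 1
      then show ?thesis using hs.\<kappa>_B hs.D_\<kappa> by blast
    next
      case 2
      then show ?thesis using x_invariant_of_hs[OF hs ne] dd.gen_in_B by blast
    qed
  next
    case (a_inv h)
    then obtain b where b: "b \<in> B" "h = cl b" "\<forall>i>0. D' i b = 0" by blast
    have mb: "- b \<in> B" using b dd.span_of_uminus by blast
    have "D' i (- b) = 0" if "i > 0" for i
      using hs.D_add[OF b(1) mb, of i] b(3) that by (simp add: D'0)
    then show ?case using b mb cl_uminus by (intro bexI[of _ "- b"]) auto
  next
    case (eng_add h1 h2)
    then obtain a b where "a \<in> B" "h1 = cl a" "\<forall>i>0. D' i a = 0" "b \<in> B" "h2 = cl b" "\<forall>i>0. D' i b = 0" by blast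
    then show ?case by (intro bexI[of _ "a + b"]) (auto simp: cl_simps hs.D_add hs.B_add)
  next
    case (eng_mult h1 h2)
    then obtain a b where ab: "a \<in> B" "h1 = cl a" "\<forall>i>0. D' i a = 0" "b \<in> B" "h2 = cl b" "\<forall>i>0. D' i b = 0" by blast
    have "D' j a * D' (i - j) b = 0" if "i > 0" for i j using ab that by (cases "j = 0") auto
    then have "\<forall>i>0. D' i (a * b) = 0"
      unfolding hs.D_mult[OF ab(1) ab(4)] by (intro allI impI sum.neutral ballI)
    then show ?case using ab by (intro bexI[of _ "a * b"]) (auto simp: cl_simps hs.B_mult)
  qed
  then obtain b where b: "b \<in> B" "u = cl b" "\<forall>i>0. D' i b = 0" by blast
  have uA: "u \<in> carrier A" using b cl_simps by blast
  note * = \<phi>[unfolded A.exponential_map_iff[OF base_closed]]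
  have "\<phi> u \<in> carrier (UP A)" by (rule ring_hom_closed[OF conjunct1[OF *] uA])
  then have "\<phi> u i \<in> carrier A" for i by (rule A.UP_closed)
  then have "cl (D' i b) = \<phi> u i" for i unfolding D'_def b(2)[symmetric] by (rule rep(2))
  then have "\<phi> u i = \<zero>\<^bsub>A\<^esub>" if "i > 0" for i using b(3) that cl_zero by metis
  moreover have "\<phi> u 0 = u" using * uA by blast
  ultimately have "\<phi> u = up_ring.monom (UP A) u 0" by (simp add: A.UP_monom[OF uA] fun_eq_iff)
  then show ?thesis using uA by (simp add: exp_invariants_def)
qed

lemma invariants_subset_generate_ring:
  assumes u: "u \<in> exp_invariants A (\<lambda>u i. cl (D i (rep u)))"
  shows "u \<in> generate_ring A (base_B d e P Q \<union> {x_B d e P Q})"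
proof -
  interpret A: cring A by (rule A_cring)
  interpret hs: locally_finite_hs B fls_scalar D by (rule hs_D)
  let ?H = "base_B d e P Q \<union> {x_B d e P Q}"
  have uA: "u \<in> carrier A" and eq: "(\<lambda>i. cl (D i (rep u))) = up_ring.monom (UP A) u 0"
    using u by (auto simp: exp_invariants_def)
  have repB: "rep u \<in> B" using rep(3)[OF uA] .
  have "D i (rep u) = 0" if "i > 0" for i
  proof -
    have "cl (D i (rep u)) = cl 0" using fun_cong[OF eq, of i] that by (simp add: A.UP_monom[OF uA] cl_zero)
    then show ?thesis using inj_onD[OF cl_inj] hs.D_B[OF repB] B_0_1 by blast
  qed
  then obtain p where p: "rep u = ev_X p" using invariants_D[OF repB] by blast
  have "cl (ev_X p) \<in> generate_ring A ?H" for p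
  proof (induction p)
    case 0
    then show ?case using A.zero_in_generate by (simp add: cl_zero)
  next
    case (pCons c p)
    have "cl (fls_scalar c + x * ev_X p) = cl (fls_scalar c) \<oplus>\<^bsub>A\<^esub> cl x \<otimes>\<^bsub>A\<^esub> cl (ev_X p)"
      using hs.\<kappa>_B dd.gen_in_B ev_in_B hs.B_mult by (simp add: cl_simps)
    moreover have "cl (fls_scalar c) \<in> generate_ring A ?H" "cl x \<in> generate_ring A ?H"
      by (auto simp: base_eq x_B_eq intro: generate_ring.incl)
    ultimately show ?case using pCons
      by (simp add: eval_poly_pCons[OF rhom_fls_scalar] generate_ring.eng_add generate_ring.eng_mult)
  qed
  then show ?thesis using rep(2)[OF uA] p by metis
qed

text \<open>Every exponential map fixes the subring generated by the scalars and \<open>x\<close>,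
  and the shear fixes nothing more.\<close>

lemma makar_limanov_eq:
  assumes "r * s \<noteq> 1" "d * s + e \<noteq> 1" "r * e \<noteq> 1"
  shows "makar_limanov (base_B d e P Q) A = generate_ring A (base_B d e P Q \<union> {x_B d e P Q})"
  using generate_ring_subset_invariants[OF assms] invariants_subset_generate_ring exponential_map_of_hs[OF hs_D]
  unfolding makar_limanov_def by blast

end

theorem theorem3p8:
  fixes d e r s :: nat
    and P :: "'k::field poly_XZ"
    and Q :: "'k poly_XZY"
  assumes "d \<ge> 1" and "e \<ge> 1"
    and "Polynomial.lead_coeff P = 1" and "r = Polynomial.degree P"
    and "Polynomial.lead_coeff Q = 1" and "s = Polynomial.degree Q"
    and "(r \<ge> 2 \<and> s \<ge> 2) \<or> (r \<ge> 2 \<and> s = 1) \<or> (r = 1 \<and> s \<ge> 2 \<and> e \<ge> 2)"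
  shows "makar_limanov (base_B d e P Q) (ring_B d e P Q) =
         generate_ring (ring_B d e P Q) (base_B d e P Q \<union> {x_B d e P Q})"
proof -
  interpret presentation d e P Q by unfold_locales (use assms in auto)
  \<comment> \<open>Positivity of \<open>d\<close>, \<open>s\<close> and \<open>e\<close> makes the
    determinant \<open>d s + e\<close> at least 2; the case distinction excludes 1 for
    \<open>r s\<close> and \<open>r e\<close>.\<close>
  have "d * degree Q \<ge> 1" using assms by auto
  then have "d * degree Q + e \<noteq> 1" using assms by linarith
  then show ?thesis by (intro makar_limanov_eq) (use assms in auto)
qed

end
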